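(* Let $n\ge2$, $\lambda=(\lambda_1>\cdots>\lambda_n>0)$, and let $f$ be the filling map, $\mathcal A(\lambda)$ the set of admissible pairs, and $\mathcal F(\lambda)$ the set of fillings described below. Then: (1) $f(\mathcal A(\lambda))=\mathcal F(\lambda)$. (2) For every $\sigma\in\mathcal F(\lambda)$ and every $(w,T)\in\mathcal A(\lambda)$ with $f(w,T)=\sigma$, one has $\mathrm{ct}(f(w,T))=w(\mu(T))$. (3) For every $\sigma\in\mathcal F(\lambda)$, \[\sum_{(w,T)\in\mathcal A(\lambda),\ f(w,T)=\sigma} t^{\frac12(\ell(w)+\ell(wT)-|T|)}(1-t)^{|T|}=t^{N(\sigma)}(1-t)^{\mathrm{des}(\sigma)}.\]
   Context: Type $C_n$ in $\mathbb R^n$ (basis $\varepsilon_i$, standard inner product); positive roots $\varepsilon_i\pm\varepsilon_j$ ($i<j$), $2\varepsilon_i$, written $(i,j)=\varepsilon_i-\varepsilon_j$, $(i,\bar\jmath)=\varepsilon_i+\varepsilon_j$, $(i,\bar\imath)=2\varepsilon_i$; coroot $\alpha^\vee=2\alpha/\langle\alpha,\alpha\rangle$; $H_{\beta,l}=\{\mu:\langle\mu,\beta^\vee\rangle=l\}$ and $s_{\beta,l}(\mu)=\mu-(\langle\mu,\beta^\vee\rangle-l)\beta$ is the affine reflection in it; $s_\beta=s_{\beta,0}$. Signed permutations: $[\bar n]=\{1<\cdots<n<\bar n<\cdots<\bar1\}$, $\bar{\bar\imath}=i$; $B_n$ = bijections $w$ of $[\bar n]$ with $w(\bar\imath)=\overline{w(i)}$,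 window notation $w(1)\cdots w(n)$; $B_n$ acts on $\mathbb R^n$ by $w(\varepsilon_i)=\varepsilon_{w(i)}$, $\varepsilon_{\bar\imath}=-\varepsilon_i$. The reflection $s_\beta$ for $\beta=(i,j)$, $(i,\bar\jmath)$, $(i,\bar\imath)$ is the signed permutation whose right multiplication swaps positions $i,j$; swaps positions $i,j$ and bars both entries; bars the entry in position $i$, respectively (we write the reflection with the same symbol as the root; the same operations are applied to any column/word $C$). Length $\ell(w)=\ell_+(w)+\ell_-(w)$, $\ell_+(w)=|\{(k,l):1\le k<l\le n,\ w(k)>w(l)\}|$, $\ell_-(w)=|\{(k,l):1\le k\le l\le n,\ w(k)>\overline{w(l)}\}|$ (order of $[\bar n]$). Bruhat order: transitive closure of $u<us_\beta$ whenever $\beta$ positive root and $\ell(us_\beta)>\ell(u)$. The $\lambda$-chain. For $1\le k\le n$ and $j\ge1$: $\Gamma_j'=((1,\bar\jmath),\ldots,(j-1,\bar\jmath))$; $\Gamma_j(k)=((1,\bar\jmath),\ldots,(j-1,\bar\jmath),(j,\overline{k+1}),\ldots,(j,\bar n),(j,\bar\jmath),(j,n),(j,n-1),\ldots,(j,k+1))$. Let $\lambda'_i=|\{k:\lambda_k\ge i\}|$. Set $\Gamma_{ij}=\Gamma_j(\lambda'_i)$, $\Gamma'_{ij}=\Gamma'_j$, $\Gamma^i=\Gamma'_{i2}\cdots\Gamma'_{i,\lambda'_i}\Gamma_{i1}\cdots\Gamma_{i,\lambda'_i}$ and $\Gamma=\Gamma^{\lambda_1}\Gamma^{\lambda_1-1}\cdots\Gamma^1=(\beta_1,\ldots,\beta_m)$.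 Let $r_k=s_{\beta_k}$ and $\widehat r_k=s_{\beta_k,l_k}$ with $l_k=|\{j\le k:\beta_j=\beta_k\}|$. Admissible pairs. For $J=\{j_1<\cdots<j_s\}\subseteq[m]$ let $T=(\beta_{j_1},\ldots,\beta_{j_s})$ (remembering positions), $|T|=s$, $wT=wr_{j_1}\cdots r_{j_s}$, $\mu(T)=\widehat r_{j_1}\cdots\widehat r_{j_s}(\lambda)$. $\mathcal A(\lambda)$ is the set of pairs $(w,T)$ with $w\in B_n$ and $w>wr_{j_1}>wr_{j_1}r_{j_2}>\cdots>wr_{j_1}\cdots r_{j_s}$ in Bruhat order (not necessarily covers). Filling map. For a pair $(w,T)$, let $\pi_{ij}$ (resp. $\pi'_{ik}$) be $w$ times the product, in order, of the reflections of $T$ whose positions lie strictly before the factor $\Gamma_{ij}$ (resp. $\Gamma'_{ik}$) of $\Gamma$. $f(w,T)$ is the filling with columns $C_{ij}=\pi_{ij}(1)\cdots\pi_{ij}(\lambda'_i)$ and $C'_{ik}=\pi'_{ik}(1)\cdots\pi'_{ik}(\lambda'_i)$, arranged as below. Fillings: $\sigma=\mathcal C^{\lambda_1}\cdots\mathcal C^1$ (columns left to right, top-aligned), $\mathcal C^i=C'_{i2}\cdots C'_{i,\lambda'_i}C_{i1}\cdots C_{i,\lambda'_i}$ ($i>1$), $\mathcal C^1=C'_{12}\cdots C'_{1n}C_{11}$, columns in $\mathcal C^i$ of height $\lambda'_i$; conventions $C'_{i,\lambda'_i+1}=C_{i1}$, and for $i>1$, $C_{i,\lambda'_i+1}=C'_{i-1,2}$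 if $\lambda'_{i-1}>1$, $=C_{i-1,1}$ otherwise. $\mathcal F(\lambda)$: fillings with entries in $[\bar n]$ such that (1) rows weakly decrease left to right; (2) no column has two entries $a,b$ with $a=\pm b$; (3a) for $i>1$, $1\le j\le\lambda'_i$: there are $1\le r_1<\cdots<r_p<j$ ($p\ge0$) with, for $D=C_{ij}(r_1,\bar\jmath)\cdots(r_p,\bar\jmath)$ and $E$ the first $\lambda'_i$ entries of $C_{i,j+1}$: $E(r)=D(r)$ for $r\ne j$, $E(j)\notin\{\pm D(r):r\ne j\}$, $E(j)\le D(j)$; (3b) for $2\le k\le\lambda'_i$: $C'_{i,k+1}=C'_{ik}(r_1,\bar k)\cdots(r_p,\bar k)$ for some $1\le r_1<\cdots<r_p<k$. Content: $\bar\sigma=\bar{\mathcal C}^{\lambda_1}\cdots\bar{\mathcal C}^1$, $\bar{\mathcal C}^i=C'_{i2}C_{i1}$ (with $C'_{i2}=C_{i1}$ if $\lambda'_i=1$); $\mathrm{ct}(\sigma)=\frac12\sum_e\varepsilon_e$ over all entries $e$ of $\bar\sigma$. Statistics: $w[i,j]=w(i)\cdots w(j)$; $N_{ab}(w)=|\{i:a<w(i)<b\}|$; intervals open in $[\bar n]$; $\sigma_{ab}=1$ if $a,b\in\{\bar n,\ldots,\bar1\}$, else $0$. For columns $D\ge C$ entrywise of height $d$: Case 0: $D=C$: $N=\mathrm{des}=0$. Case 1: $C=D(r,\bar\jmath)$, $r<j$, $a=D(r)$, $b=D(j)$: $N(D,C)=N_{\bar ba}(D[r+1,j-1])+|(\bar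 b,a)\setminus\{\pm D(i):i\le j\}|+\sigma_{ab}$, $\mathrm{des}=1$. Case 2: $C=D(r_1,\bar\jmath)\cdots(r_p,\bar\jmath)$, $r_1<\dots<r_p<j$, $D_i=D(r_1,\bar\jmath)\cdots(r_i,\bar\jmath)$: $N=\sum_{i=1}^pN(D_{i-1},D_i)$, $\mathrm{des}=p$. Case 3: $C$ differs from $D'=D(r_1,\bar\jmath)\cdots(r_p,\bar\jmath)$ ($p\ge0$) only in position $j$, $C(j)\notin\{\pm D'(r):r\ne j\}$, $C(j)<D'(j)$: $N(D,C)=N(D,D')+N_{C(j),D'(j)}(D[j+1,d])$, $\mathrm{des}=p+1$. If $C$ has height $d+1$ use $C[1,d]$. For $\sigma$ with columns $C_m,\ldots,C_1$ left to right: $N(\sigma)=\sum_{i=1}^{m-1}N(C_{i+1},C_i)+\ell_+(C_1)$, $\mathrm{des}(\sigma)=\sum_{i=1}^{m-1}\mathrm{des}(C_{i+1},C_i)$. *)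

theory Defs
  imports Complex_Main "HOL-Combinatorics.Permutations"
begin

text \<open>
  The barred letter of \<open>i\<close> is encoded as the negative integer \<open>- i\<close>, so that barring is
  negation and \<open>a = \<plusminus>b\<close> is literal.  The order is \<open>1 < \<dots> < n < -n < \<dots> < -1\<close>.
\<close>

definition letters :: "nat \<Rightarrow> int set" where
  "letters n = {e. 1 \<le> \<bar>e\<bar> \<and> \<bar>e\<bar> \<le> int n}"

definition letter_less :: "int \<Rightarrow> int \<Rightarrow> bool" (infix \<open>\<prec>\<close> 50) where
  "a \<prec> b \<longleftrightarrow> (0 < a \<and> b < 0) \<or> (sgn a = sgn b \<and> a < b)"

definition letter_le :: "int \<Rightarrow> int \<Rightarrow> bool" (infix \<open>\<preceq>\<close> 50) where
  "a \<preceq> b \<longleftrightarrow> a \<prec> b \<or> a = b"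

text \<open>
  Signed permutations are total functions fixing everything outside \<^term>\<open>letters n\<close>;
  the group product is \<open>\<circ>\<close>.
\<close>

definition signed_perms :: "nat \<Rightarrow> (int \<Rightarrow> int) set" where
  "signed_perms n = {w. w permutes letters n \<and> (\<forall>e. w (- e) = - w e)}"

text \<open>Positions in words, columns and partitions are counted from 1.\<close>

definition entry :: "int list \<Rightarrow> nat \<Rightarrow> int" where
  "entry C k = C ! (k - 1)"

definition subword :: "int list \<Rightarrow> nat \<Rightarrow> nat \<Rightarrow> int list" where
  "subword C i j = map (entry C) [i..<Suc j]"

definition window :: "nat \<Rightarrow> (int \<Rightarrow> int) \<Rightarrow> int list" where
  "window h w = map (\<lambda>k. w (int k)) [1..<Suc h]"

definition ell_plus :: "int list \<Rightarrow> nat" where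
  "ell_plus C = card {(k, l). 1 \<le> k \<and> k < l \<and> l \<le> length C \<and> entry C l \<prec> entry C k}"

definition ell_minus :: "int list \<Rightarrow> nat" where
  "ell_minus C = card {(k, l). 1 \<le> k \<and> k \<le> l \<and> l \<le> length C \<and> - entry C l \<prec> entry C k}"

definition ell :: "nat \<Rightarrow> (int \<Rightarrow> int) \<Rightarrow> nat" where
  "ell n w = ell_plus (window n w) + ell_minus (window n w)"

text \<open>
  Vectors of \<open>\<real>\<^sup>n\<close> are functions \<^typ>\<open>nat \<Rightarrow> real\<close> vanishing outside \<open>{1..n}\<close>.
  A root \<open>(i, j)\<close> with \<open>j\<close> signed is the vector \<open>\<epsilon>\<^sub>i - \<epsilon>\<^sub>j\<close>, where \<open>\<epsilon>\<close> of a barred letter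
  is \<open>-\<epsilon>\<close> of the letter; this covers \<open>\<epsilon>\<^sub>i - \<epsilon>\<^sub>j\<close>, \<open>\<epsilon>\<^sub>i + \<epsilon>\<^sub>j\<close> and \<open>2\<epsilon>\<^sub>i\<close> uniformly.
\<close>

type_synonym root = "int \<times> int"

definition eps :: "int \<Rightarrow> nat \<Rightarrow> real" where
  "eps e k = (if e = int k then 1 else if e = - int k then - 1 else 0)"

definition inner_prod :: "nat \<Rightarrow> (nat \<Rightarrow> real) \<Rightarrow> (nat \<Rightarrow> real) \<Rightarrow> real" where
  "inner_prod n u v = (\<Sum>k = 1..n. u k * v k)"

definition pos_roots :: "nat \<Rightarrow> root set" where
  "pos_roots n =
     {(i, j) | i j. 1 \<le> i \<and> i < j \<and> j \<le> int n} \<union>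
     {(i, - j) | i j. 1 \<le> i \<and> i < j \<and> j \<le> int n} \<union>
     {(i, - i) | i. 1 \<le> i \<and> i \<le> int n}"

definition root_vec :: "root \<Rightarrow> nat \<Rightarrow> real" where
  "root_vec \<beta> = (\<lambda>k. eps (fst \<beta>) k - eps (snd \<beta>) k)"

definition coroot :: "nat \<Rightarrow> root \<Rightarrow> nat \<Rightarrow> real" where
  "coroot n \<beta> = (\<lambda>k. 2 * root_vec \<beta> k / inner_prod n (root_vec \<beta>) (root_vec \<beta>))"

definition affine_refl :: "nat \<Rightarrow> root \<Rightarrow> nat \<Rightarrow> (nat \<Rightarrow> real) \<Rightarrow> (nat \<Rightarrow> real)" where
  "affine_refl n \<beta> l v = (\<lambda>k. v k - (inner_prod n v (coroot n \<beta>) - real l) * root_vec \<beta> k)"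

definition vec_act :: "nat \<Rightarrow> (int \<Rightarrow> int) \<Rightarrow> (nat \<Rightarrow> real) \<Rightarrow> (nat \<Rightarrow> real)" where
  "vec_act n w v = (\<lambda>k. \<Sum>i = 1..n. v i * eps (w (int i)) k)"

definition signed_refl :: "root \<Rightarrow> int \<Rightarrow> int" where
  "signed_refl \<beta> e = (case \<beta> of (i, j) \<Rightarrow>
     if e = i then j else if e = j then i
     else if e = - i then - j else if e = - j then - i else e)"

definition bruhat_less :: "nat \<Rightarrow> (int \<Rightarrow> int) \<Rightarrow> (int \<Rightarrow> int) \<Rightarrow> bool" where
  "bruhat_less n =
     (\<lambda>u v. u \<in> signed_perms n \<and>
        (\<exists>\<beta>\<in>pos_roots n. v = u \<circ> signed_refl \<beta> \<and> ell n u < ell n v))\<^sup>+\<^sup>+"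

text \<open>\<open>bar_swap C r j\<close> is \<open>C(r, -j)\<close>: swap positions \<open>r < j\<close> and bar both entries.\<close>

definition bar_swap :: "int list \<Rightarrow> nat \<Rightarrow> nat \<Rightarrow> int list" where
  "bar_swap C r j = C[r - 1 := - entry C j, j - 1 := - entry C r]"

definition bar_swaps :: "int list \<Rightarrow> nat \<Rightarrow> nat list \<Rightarrow> int list" where
  "bar_swaps C j rs = foldl (\<lambda>D r. bar_swap D r j) C rs"

definition increasing_below :: "nat \<Rightarrow> nat list \<Rightarrow> bool" where
  "increasing_below j rs \<longleftrightarrow> sorted_wrt (<) rs \<and> set rs \<subseteq> {1..<j}"

text \<open>
  A partition is \<open>lam 1, \<dots>, lam n\<close>; values of \<open>lam\<close> outside \<open>{1..n}\<close> are never used.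
  The labels \<open>Plain i j\<close> and \<open>Primed i k\<close> name both the factors \<open>\<Gamma>\<^sub>i\<^sub>j\<close>, \<open>\<Gamma>'\<^sub>i\<^sub>k\<close> of the
  \<open>\<lambda>\<close>-chain and the columns \<open>C\<^sub>i\<^sub>j\<close>, \<open>C'\<^sub>i\<^sub>k\<close> of a filling.
\<close>

datatype label = Plain nat nat | Primed nat nat

definition conj_part :: "nat \<Rightarrow> (nat \<Rightarrow> nat) \<Rightarrow> nat \<Rightarrow> nat" where
  "conj_part n lam i = card {k \<in> {1..n}. i \<le> lam k}"

definition Gamma_primed :: "nat \<Rightarrow> root list" where
  "Gamma_primed j = map (\<lambda>r. (int r, - int j)) [1..<j]"

definition Gamma_plain :: "nat \<Rightarrow> nat \<Rightarrow> nat \<Rightarrow> root list" where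
  "Gamma_plain n j k =
     map (\<lambda>r. (int r, - int j)) [1..<j] @
     map (\<lambda>x. (int j, - int x)) [k + 1..<Suc n] @
     [(int j, - int j)] @
     map (\<lambda>x. (int j, int x)) (rev [k + 1..<Suc n])"

fun factor :: "nat \<Rightarrow> (nat \<Rightarrow> nat) \<Rightarrow> label \<Rightarrow> root list" where
  "factor n lam (Plain i j) = Gamma_plain n j (conj_part n lam i)"
| "factor n lam (Primed i k) = Gamma_primed k"

fun height :: "nat \<Rightarrow> (nat \<Rightarrow> nat) \<Rightarrow> label \<Rightarrow> nat" where
  "height n lam (Plain i j) = conj_part n lam i"
| "height n lam (Primed i k) = conj_part n lam i"

definition block :: "nat \<Rightarrow> (nat \<Rightarrow> nat) \<Rightarrow> nat \<Rightarrow> label list" where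
  "block n lam i =
     map (Primed i) [2..<Suc (conj_part n lam i)] @ map (Plain i) [1..<Suc (conj_part n lam i)]"

definition chain_labels :: "nat \<Rightarrow> (nat \<Rightarrow> nat) \<Rightarrow> label list" where
  "chain_labels n lam = concat (map (block n lam) (rev [1..<Suc (lam 1)]))"

definition lambda_chain :: "nat \<Rightarrow> (nat \<Rightarrow> nat) \<Rightarrow> root list" where
  "lambda_chain n lam = concat (map (factor n lam) (chain_labels n lam))"

definition beta :: "nat \<Rightarrow> (nat \<Rightarrow> nat) \<Rightarrow> nat \<Rightarrow> root" where
  "beta n lam k = lambda_chain n lam ! (k - 1)"

definition level :: "nat \<Rightarrow> (nat \<Rightarrow> nat) \<Rightarrow> nat \<Rightarrow> nat" where
  "level n lam k = card {j \<in> {1..k}. beta n lam j = beta n lam k}"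

text \<open>
  \<open>T\<close> is represented by the set \<open>J\<close> of its positions; \<open>mult_word\<close> is \<open>w r\<^sub>k\<^sub>1 \<cdots> r\<^sub>k\<^sub>p\<close>
  for a list of positions, \<open>mult_T\<close> is \<open>wT\<close>.
\<close>

definition mult_word :: "nat \<Rightarrow> (nat \<Rightarrow> nat) \<Rightarrow> (int \<Rightarrow> int) \<Rightarrow> nat list \<Rightarrow> (int \<Rightarrow> int)" where
  "mult_word n lam w ks = foldl (\<lambda>u k. u \<circ> signed_refl (beta n lam k)) w ks"

definition mult_T :: "nat \<Rightarrow> (nat \<Rightarrow> nat) \<Rightarrow> (int \<Rightarrow> int) \<Rightarrow> nat set \<Rightarrow> (int \<Rightarrow> int)" where
  "mult_T n lam w J = mult_word n lam w (sorted_list_of_set J)"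

definition mu :: "nat \<Rightarrow> (nat \<Rightarrow> nat) \<Rightarrow> nat set \<Rightarrow> (nat \<Rightarrow> real)" where
  "mu n lam J =
     foldr (\<lambda>k. affine_refl n (beta n lam k) (level n lam k)) (sorted_list_of_set J)
       (\<lambda>i. if i \<in> {1..n} then real (lam i) else 0)"

definition admissible :: "nat \<Rightarrow> (nat \<Rightarrow> nat) \<Rightarrow> ((int \<Rightarrow> int) \<times> nat set) set" where
  "admissible n lam =
     {(w, J). w \<in> signed_perms n \<and> J \<subseteq> {1..length (lambda_chain n lam)} \<and>
        (\<forall>p < card J. bruhat_less n
           (mult_word n lam w (take (Suc p) (sorted_list_of_set J)))
           (mult_word n lam w (take p (sorted_list_of_set J))))}"

text \<open>
  A filling assigns to every label in \<open>columns n lam\<close> (listed left to right) a column, and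
  \<open>[]\<close> to all other labels, so that equality of fillings is equality of functions.
\<close>

type_synonym filling = "label \<Rightarrow> int list"

definition columns :: "nat \<Rightarrow> (nat \<Rightarrow> nat) \<Rightarrow> label list" where
  "columns n lam =
     concat (map (block n lam) (rev [2..<Suc (lam 1)])) @ map (Primed 1) [2..<Suc n] @ [Plain 1 1]"

definition roots_before :: "nat \<Rightarrow> (nat \<Rightarrow> nat) \<Rightarrow> label \<Rightarrow> nat" where
  "roots_before n lam L =
     length (concat (map (factor n lam) (takeWhile (\<lambda>M. M \<noteq> L) (chain_labels n lam))))"

definition filling_map :: "nat \<Rightarrow> (nat \<Rightarrow> nat) \<Rightarrow> (int \<Rightarrow> int) \<times> nat set \<Rightarrow> filling" where
  "filling_map n lam = (\<lambda>(w, J) L.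
     if L \<in> set (columns n lam)
     then window (height n lam L) (mult_T n lam w {k \<in> J. k \<le> roots_before n lam L})
     else [])"

fun next_label :: "nat \<Rightarrow> (nat \<Rightarrow> nat) \<Rightarrow> label \<Rightarrow> label" where
  "next_label n lam (Plain i j) =
     (if j < conj_part n lam i then Plain i (j + 1)
      else if 1 < conj_part n lam (i - 1) then Primed (i - 1) 2 else Plain (i - 1) 1)"
| "next_label n lam (Primed i k) =
     (if k < conj_part n lam i then Primed i (k + 1) else Plain i 1)"

definition agree_except :: "nat \<Rightarrow> int list \<Rightarrow> int list \<Rightarrow> bool" where
  "agree_except j D E \<longleftrightarrow> length E = length D \<and>
     (\<forall>r\<in>{1..length D} - {j}. entry E r = entry D r \<and>
        entry E j \<noteq> entry D r \<and> entry E j \<noteq> - entry D r)"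

definition fillings :: "nat \<Rightarrow> (nat \<Rightarrow> nat) \<Rightarrow> filling set" where
  "fillings n lam = {\<sigma>.
     (\<forall>L. L \<notin> set (columns n lam) \<longrightarrow> \<sigma> L = []) \<and>
     (\<forall>L\<in>set (columns n lam). length (\<sigma> L) = height n lam L \<and> set (\<sigma> L) \<subseteq> letters n) \<and>
     (\<forall>p q r. p < q \<and> q < length (columns n lam) \<and>
        r \<in> {1..length (\<sigma> (columns n lam ! p))} \<and> r \<in> {1..length (\<sigma> (columns n lam ! q))} \<longrightarrow>
        entry (\<sigma> (columns n lam ! q)) r \<preceq> entry (\<sigma> (columns n lam ! p)) r) \<and>
     (\<forall>L\<in>set (columns n lam). \<forall>r\<in>{1..length (\<sigma> L)}. \<forall>s\<in>{1..length (\<sigma> L)}. r \<noteq> s \<longrightarrow>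
        entry (\<sigma> L) r \<noteq> entry (\<sigma> L) s \<and> entry (\<sigma> L) r \<noteq> - entry (\<sigma> L) s) \<and>
     (\<forall>i\<in>{2..lam 1}. \<forall>j\<in>{1..conj_part n lam i}. \<exists>rs. increasing_below j rs \<and>
        (let D = bar_swaps (\<sigma> (Plain i j)) j rs;
             E = take (conj_part n lam i) (\<sigma> (next_label n lam (Plain i j)))
         in agree_except j D E \<and> entry E j \<preceq> entry D j)) \<and>
     (\<forall>i\<in>{1..lam 1}. \<forall>k\<in>{2..conj_part n lam i}. \<exists>rs. increasing_below k rs \<and>
        \<sigma> (next_label n lam (Primed i k)) = bar_swaps (\<sigma> (Primed i k)) k rs)}"

definition ct :: "nat \<Rightarrow> (nat \<Rightarrow> nat) \<Rightarrow> filling \<Rightarrow> (nat \<Rightarrow> real)" where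
  "ct n lam \<sigma> = (\<lambda>k. 1 / 2 * (\<Sum>i = 1..lam 1.
     \<Sum>e \<leftarrow> \<sigma> (if conj_part n lam i = 1 then Plain i 1 else Primed i 2) @ \<sigma> (Plain i 1). eps e k))"

definition N_between :: "int \<Rightarrow> int \<Rightarrow> int list \<Rightarrow> nat" where
  "N_between a b C = card {i \<in> {1..length C}. a \<prec> entry C i \<and> entry C i \<prec> b}"

definition N_swap :: "nat \<Rightarrow> int list \<Rightarrow> nat \<Rightarrow> nat \<Rightarrow> nat" where
  "N_swap n D r j = (let a = entry D r; b = entry D j in
     N_between (- b) a (subword D (r + 1) (j - 1)) +
     card ({e \<in> letters n. - b \<prec> e \<and> e \<prec> a} - (\<Union>i\<in>{1..j}. {entry D i, - entry D i})) +
     (if a < 0 \<and> b < 0 then 1 else 0))"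

primrec N_swaps :: "nat \<Rightarrow> nat \<Rightarrow> int list \<Rightarrow> nat list \<Rightarrow> nat" where
  "N_swaps n j D [] = 0"
| "N_swaps n j D (r # rs) = N_swap n D r j + N_swaps n j (bar_swap D r j) rs"

definition column_ge :: "int list \<Rightarrow> int list \<Rightarrow> bool" where
  "column_ge D C \<longleftrightarrow> length D = length C \<and> (\<forall>r\<in>{1..length D}. entry C r \<preceq> entry D r)"

text \<open>
  \<open>col_stat n D C N d\<close>: the pair of columns \<open>D \<ge> C\<close> of equal height has statistics \<open>N\<close> and
  \<open>des = d\<close>.  A single swap is the instance of \<open>swaps\<close> with \<open>rs = [r]\<close>.  For columns
  without entries \<open>a = \<plusminus>b\<close> at most one set of data \<open>(rs, j)\<close> fits: \<open>j\<close> is the last position in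
  which \<open>D\<close> and \<open>C\<close> differ and \<open>rs\<close> lists the other ones.
\<close>

inductive col_stat :: "nat \<Rightarrow> int list \<Rightarrow> int list \<Rightarrow> nat \<Rightarrow> nat \<Rightarrow> bool"
  for n :: nat and D C :: "int list" where
  equal: "C = D \<Longrightarrow> col_stat n D C 0 0"
| swaps: "column_ge D C \<Longrightarrow> j \<le> length D \<Longrightarrow> increasing_below j rs \<Longrightarrow> rs \<noteq> [] \<Longrightarrow>
    C = bar_swaps D j rs \<Longrightarrow> col_stat n D C (N_swaps n j D rs) (length rs)"
| change: "column_ge D C \<Longrightarrow> j \<in> {1..length D} \<Longrightarrow> increasing_below j rs \<Longrightarrow>
    D' = bar_swaps D j rs \<Longrightarrow> agree_except j D' C \<Longrightarrow> entry C j \<prec> entry D' j \<Longrightarrow>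
    col_stat n D C
      (N_swaps n j D rs + N_between (entry C j) (entry D' j) (subword D (j + 1) (length D)))
      (length rs + 1)"

definition N_col :: "nat \<Rightarrow> int list \<Rightarrow> int list \<Rightarrow> nat" where
  "N_col n D C = (THE N. \<exists>d. col_stat n D (take (length D) C) N d)"

definition des_col :: "nat \<Rightarrow> int list \<Rightarrow> int list \<Rightarrow> nat" where
  "des_col n D C = (THE d. \<exists>N. col_stat n D (take (length D) C) N d)"

definition N_filling :: "nat \<Rightarrow> (nat \<Rightarrow> nat) \<Rightarrow> filling \<Rightarrow> nat" where
  "N_filling n lam \<sigma> = (let cs = map \<sigma> (columns n lam) in
     (\<Sum>p < length cs - 1. N_col n (cs ! p) (cs ! (p + 1))) + ell_plus (last cs))"

definition des_filling :: "nat \<Rightarrow> (nat \<Rightarrow> nat) \<Rightarrow> filling \<Rightarrow> nat" where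
  "des_filling n lam \<sigma> = (let cs = map \<sigma> (columns n lam) in
     (\<Sum>p < length cs - 1. des_col n (cs ! p) (cs ! (p + 1))))"

text \<open>
  The number \<open>(\<ell>(w) + \<ell>(wT) - |T|) / 2\<close>, written without truncating operations.
\<close>

definition half_exponent :: "nat \<Rightarrow> (nat \<Rightarrow> nat) \<Rightarrow> (int \<Rightarrow> int) \<Rightarrow> nat set \<Rightarrow> nat" where
  "half_exponent n lam w J =
     (THE e. 2 * int e = int (ell n w) + int (ell n (mult_T n lam w J)) - int (card J))"

lemma finite_admissible: "finite (admissible n lam)"
proof -
  have "letters n \<subseteq> {- int n..int n}" by (auto simp: letters_def)
  then have "finite (letters n)" by (rule finite_subset) simp
  then have "finite (signed_perms n)"
    using finite_permutations[of "letters n"]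
    by (rule_tac finite_subset[where B = "{w. w permutes letters n}"]) (auto simp: signed_perms_def)
  then have "finite (signed_perms n \<times> Pow {1..length (lambda_chain n lam)})" by simp
  then show ?thesis by (rule rev_finite_subset) (auto simp: admissible_def)
qed

end

theory Submission
  imports Defs
begin

text \<open>
  A pair \<open>(w, T)\<close> is a path of signed permutations that descends in length along the
  \<open>\<lambda>\<close>-chain, and a step \<open>u > ur\<close> is weighted by \<open>t\<^bsup>(\<ell>(u) - \<ell>(ur) - 1)/2\<^esup>(1 - t)\<close>.  The last column
  of a filling has height \<open>n\<close> and so fixes the signed permutation \<open>v\<close> reached there.

  \<^item> After \<open>v\<close>, the reflections \<open>(r, -j)\<close>, \<open>r \<le> j\<close>, are met in the order in which the pairs counted
    by \<open>\<ell>\<^sub>-\<close> can be removed one at a time; each of them changes the weight \<open>t\<^bsup>\<ell>\<^esup>\<close> into the same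
    weight with one pair less, until \<open>t\<^bsup>\<ell>\<^sub>+(v)\<^esup>\<close> is left.
  \<^item> Before \<open>v\<close>, the chain is read backwards.  The swaps \<open>(r, -j)\<close> inside a column are determined
    by the two neighbouring columns.  The remaining roots of a factor, which involve position \<open>j\<close>
    and the positions below the column, are summed over by induction on the number of these
    positions: peeling off the outermost pair \<open>(j, k+1)\<close>, \<open>(j, -(k+1))\<close>, the new contributions
    form a telescoping geometric sum, and the result depends on the columns only.

  Surjectivity of the filling map then follows by evaluating the generating function at \<open>t = 2\<close>.
  For the content, \<open>w(\<mu>(T))\<close> and the content both equal \<open>wT(\<lambda>)\<close> plus a combination of the same
  roots; the coefficients agree because the number of occurrences of a root in a block of the
  chain is its pairing with the fundamental weight \<open>\<omega>\<^bsub>\<lambda>'\<^sub>i\<^esub>\<close>.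
\<close>

text \<open>The obstacle is that a filling does not show the entries below its columns: many pairs
  may share one filling, and only the sum of their weights is simple. The weights are therefore
  transported along the chain by \<open>up_step\<close>, a linear operator on functions of the
  current signed permutation. This is possible because a reflection always changes the length by an
  odd number: half of \<open>ell w + ell wT - |T|\<close> equals \<open>ell wT\<close> plus one
  integer \<open>gap\<close> for each step, so the weight is a product of local factors.

  Both telescoping arguments rest on \<open>t + (1 - t) = 1\<close>: skipping a root costs a factor
  \<open>t\<close>, using it a factor \<open>1 - t\<close>. Up to the last column the operators act
  on indicator functions of columns. After it no column constrains the path, so they are moved by
  adjunction onto the weight \<open>t ^ ell\<close>, with \<open>stat\<close> as the intermediate
  exponent.

  The ring is arbitrary, so the identity can be specialised to the integers at \<open>t = 2\<close>.
  There its right side is plus or minus a power of 2, hence nonzero, and no fibre over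
  \<open>fillings\<close> is empty.\<close>

lemma letter_less_irrefl [simp]: "\<not> a \<prec> a"
  by (auto simp: letter_less_def)

lemma letter_less_trans: "a \<prec> b \<Longrightarrow> b \<prec> c \<Longrightarrow> a \<prec> c"
  by (auto simp: letter_less_def sgn_if split: if_splits)

lemma letter_less_asym: "a \<prec> b \<Longrightarrow> \<not> b \<prec> a"
  by (auto simp: letter_less_def sgn_if split: if_splits)

lemma letter_less_linear: "a \<noteq> 0 \<Longrightarrow> b \<noteq> 0 \<Longrightarrow> a \<noteq> b \<Longrightarrow> \<not> a \<prec> b \<Longrightarrow> b \<prec> a"
  by (auto simp: letter_less_def sgn_if split: if_splits)

lemma letter_less_minus: "- a \<prec> - b \<longleftrightarrow> b \<prec> a"
  by (auto simp: letter_less_def sgn_if split: if_splits)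

text \<open>An order embedding into the reals that commutes with negation.\<close>

definition key :: "int \<Rightarrow> real" where
  "key a = - 1 / real_of_int a"

text \<open>Positive letters go to negative reals and barred letters to positive ones, and
  \<open>- 1 / a\<close> increases on each half. Inequalities between letters and their bars thereby
  become linear arithmetic.\<close>

lemma letter_less_key: "a \<noteq> 0 \<Longrightarrow> b \<noteq> 0 \<Longrightarrow> a \<prec> b \<longleftrightarrow> key a < key b"
  by (cases "a > 0"; cases "b > 0") (auto simp: letter_less_def key_def sgn_if field_simps)

lemma key_minus [simp]: "key (- a) = - key a"
  by (simp add: key_def)

lemma key_eq_iff [simp]: "key a = key b \<longleftrightarrow> a = b"
  by (auto simp: key_def field_simps)

lemma key_neg_iff: "a \<noteq> 0 \<Longrightarrow> a < 0 \<longleftrightarrow> 0 < key a"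
  by (auto simp: key_def field_simps)

lemma letter_le_refl [simp]: "a \<preceq> a"
  by (simp add: letter_le_def)

lemma letter_le_trans: "a \<preceq> b \<Longrightarrow> b \<preceq> c \<Longrightarrow> a \<preceq> c"
  unfolding letter_le_def using letter_less_trans by blast

lemma finite_letters [simp]: "finite (letters n)"
  by (rule finite_subset[of _ "{- int n..int n}"]) (auto simp: letters_def)

lemma minus_in_letters [simp]: "- e \<in> letters n \<longleftrightarrow> e \<in> letters n"
  by (simp add: letters_def)

lemma int_in_letters [simp]: "int k \<in> letters n \<longleftrightarrow> k \<in> {1..n}"
  by (auto simp: letters_def)

lemma zero_notin_letters [simp]: "0 \<notin> letters n"
  by (simp add: letters_def)

section \<open>Signed permutations and the action of reflections on positions\<close>

lemma signed_perms_minus: "v \<in> signed_perms n \<Longrightarrow> v (- e) = - v e"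
  by (simp add: signed_perms_def)

lemma signed_perms_letters: "v \<in> signed_perms n \<Longrightarrow> v e \<in> letters n \<longleftrightarrow> e \<in> letters n"
  by (auto simp: signed_perms_def permutes_in_image)

lemma signed_perms_in_letters: "v \<in> signed_perms n \<Longrightarrow> k \<in> {1..n} \<Longrightarrow> v (int k) \<in> letters n"
  by (simp add: signed_perms_letters)

lemma signed_perms_nonzero: "v \<in> signed_perms n \<Longrightarrow> k \<in> {1..n} \<Longrightarrow> v (int k) \<noteq> 0"
  using signed_perms_in_letters[of v n k] zero_notin_letters[of n] by metis

lemma signed_perms_inj: "v \<in> signed_perms n \<Longrightarrow> v a = v b \<longleftrightarrow> a = b"
  by (auto simp: signed_perms_def dest: permutes_inj injD)

lemma signed_perms_inj_pos:
  "v \<in> signed_perms n \<Longrightarrow> k \<in> {1..n} \<Longrightarrow> l \<in> {1..n} \<Longrightarrow> k \<noteq> l \<Longrightarrow>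
    v (int k) \<noteq> v (int l) \<and> v (int k) \<noteq> - v (int l)"
  using signed_perms_minus[of v n "int l", symmetric]
  by (simp add: signed_perms_inj)

lemma signed_perms_surj:
  assumes "v \<in> signed_perms n" "e \<in> letters n"
  shows "\<exists>k\<in>{1..n}. e = v (int k) \<or> e = - v (int k)"
proof -
  from assms have "v ` letters n = letters n"
    by (simp add: signed_perms_def permutes_image)
  then obtain i where i: "i \<in> letters n" "e = v i" using assms(2) by blast
  show ?thesis
  proof (cases "i > 0")
    case True
    then show ?thesis using i by (intro bexI[of _ "nat i"]) (auto simp: letters_def)
  next
    case False
    then have "e = - v (int (nat (- i)))"
      using i signed_perms_minus[OF assms(1), of i] by simp
    then show ?thesis using i False by (intro bexI[of _ "nat (- i)"]) (auto simp: letters_def)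
  qed
qed

lemma signed_refl_involution: "fst \<beta> \<noteq> 0 \<Longrightarrow> snd \<beta> \<noteq> 0 \<Longrightarrow> signed_refl \<beta> (signed_refl \<beta> e) = e"
  by (cases \<beta>) (auto simp: signed_refl_def)

lemma pos_roots_nonzero: "\<beta> \<in> pos_roots n \<Longrightarrow> fst \<beta> \<noteq> 0 \<and> snd \<beta> \<noteq> 0"
  by (auto simp: pos_roots_def)

lemma pos_roots_cases:
  assumes "b \<in> pos_roots n"
  obtains (swap) i j where "b = (int i, int j)" "1 \<le> i" "i < j" "j \<le> n"
    | (bar) i j where "b = (int i, - int j)" "1 \<le> i" "i < j" "j \<le> n"
    | (neg) i where "b = (int i, - int i)" "1 \<le> i" "i \<le> n"
proof -
  have "\<exists>i j. 1 \<le> i \<and> i < j \<and> j \<le> n \<and> b = (int i, int j)" if "b = (i, j)" "1 \<le> i" "i < j"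
    "j \<le> int n" for i j
    using that by (intro exI[of _ "nat i"] exI[of _ "nat j"]) auto
  moreover have "\<exists>i j. 1 \<le> i \<and> i < j \<and> j \<le> n \<and> b = (int i, - int j)" if "b = (i, - j)" "1 \<le> i"
    "i < j" "j \<le> int n" for i j
    using that by (intro exI[of _ "nat i"] exI[of _ "nat j"]) auto
  moreover have "\<exists>i. 1 \<le> i \<and> i \<le> n \<and> b = (int i, - int i)" if "b = (i, - i)" "1 \<le> i" "i \<le> int n" for i
    using that by (intro exI[of _ "nat i"]) auto
  ultimately show ?thesis using assms that unfolding pos_roots_def by blast
qed

lemma comp_refl_refl: "\<beta> \<in> pos_roots n \<Longrightarrow> v \<circ> signed_refl \<beta> \<circ> signed_refl \<beta> = v"
  using pos_roots_nonzero[of \<beta> n] by (auto simp: fun_eq_iff signed_refl_involution)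

lemma signed_refl_in_signed_perms:
  assumes "\<beta> \<in> pos_roots n"
  shows "signed_refl \<beta> \<in> signed_perms n"
proof -
  have nz: "fst \<beta> \<noteq> 0" "snd \<beta> \<noteq> 0" using pos_roots_nonzero[OF assms] by auto
  have "bij (signed_refl \<beta>)"
    by (rule o_bij[of "signed_refl \<beta>"]) (auto simp: fun_eq_iff signed_refl_involution nz)
  moreover have "signed_refl \<beta> e = e" if "e \<notin> letters n" for e
    using assms that by (auto simp: signed_refl_def pos_roots_def letters_def)
  ultimately have "signed_refl \<beta> permutes letters n"
    by (simp add: permutes_def bij_iff)
  moreover have "signed_refl \<beta> (- e) = - signed_refl \<beta> e" for e
    using nz by (cases \<beta>) (auto simp: signed_refl_def)
  ultimately show ?thesis by (simp add: signed_perms_def)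
qed

lemma comp_refl_in_signed_perms:
  "v \<in> signed_perms n \<Longrightarrow> \<beta> \<in> pos_roots n \<Longrightarrow> v \<circ> signed_refl \<beta> \<in> signed_perms n"
  using signed_refl_in_signed_perms[of \<beta> n]
  by (auto simp: signed_perms_def intro: permutes_compose)

lemma refl_bar_apply:
  assumes "v \<in> signed_perms n" "1 \<le> r" "r < j" "1 \<le> k"
  shows "(v \<circ> signed_refl (int r, - int j)) (int k) =
    (if k = r then - v (int j) else if k = j then - v (int r) else v (int k))"
  using assms signed_perms_minus[OF assms(1)] by (auto simp: signed_refl_def)

lemma refl_swap_apply:
  assumes "1 \<le> j" "j < m" "1 \<le> k"
  shows "(v \<circ> signed_refl (int j, int m)) (int k) =
    (if k = j then v (int m) else if k = m then v (int j) else v (int k))"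
  using assms by (auto simp: signed_refl_def)

lemma refl_neg_apply:
  assumes "v \<in> signed_perms n" "1 \<le> j" "1 \<le> k"
  shows "(v \<circ> signed_refl (int j, - int j)) (int k) = (if k = j then - v (int j) else v (int k))"
  using assms signed_perms_minus[OF assms(1)] by (auto simp: signed_refl_def)

lemma bar_in_pos_roots: "1 \<le> r \<Longrightarrow> r < j \<Longrightarrow> j \<le> n \<Longrightarrow> (int r, - int j) \<in> pos_roots n"
  by (auto simp: pos_roots_def)

lemma swap_in_pos_roots: "1 \<le> j \<Longrightarrow> j < m \<Longrightarrow> m \<le> n \<Longrightarrow> (int j, int m) \<in> pos_roots n"
  by (auto simp: pos_roots_def)

lemma neg_in_pos_roots: "1 \<le> j \<Longrightarrow> j \<le> n \<Longrightarrow> (int j, - int j) \<in> pos_roots n"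
  by (auto simp: pos_roots_def)

section \<open>Columns as windows of signed permutations\<close>

lemma length_window [simp]: "length (window h v) = h"
  by (simp add: window_def)

lemma entry_window [simp]: "1 \<le> k \<Longrightarrow> k \<le> h \<Longrightarrow> entry (window h v) k = v (int k)"
  unfolding entry_def window_def
  by (subst nth_map) (auto simp del: upt_Suc simp: algebra_simps)

lemma list_eq_entryI:
  "length C = length D \<Longrightarrow> (\<And>k. 1 \<le> k \<Longrightarrow> k \<le> length C \<Longrightarrow> entry C k = entry D k) \<Longrightarrow> C = D"
proof (rule nth_equalityI)
  fix i assume a: "\<And>k. 1 \<le> k \<Longrightarrow> k \<le> length C \<Longrightarrow> entry C k = entry D k" "i < length C"
  show "C ! i = D ! i" using a(1)[of "Suc i"] a(2) by (simp add: entry_def)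
qed

lemma window_eq_iff: "window h v = C \<longleftrightarrow> length C = h \<and> (\<forall>k\<in>{1..h}. v (int k) = entry C k)"
proof
  show "length C = h \<and> (\<forall>k\<in>{1..h}. v (int k) = entry C k) \<Longrightarrow> window h v = C"
    by (rule list_eq_entryI) auto
qed auto

section \<open>Lengths\<close>

definition pairs :: "nat set \<Rightarrow> (nat \<times> nat) set" where
  "pairs A = {(k, l). k \<in> A \<and> l \<in> A \<and> k < l}"

lemma finite_pairs: "finite A \<Longrightarrow> finite (pairs A)"
  by (rule finite_subset[of _ "A \<times> A"]) (auto simp: pairs_def)

text \<open>A reflection moves one or two positions. Isolating the pairs that contain such a
  position lets all other summands cancel in a length difference.\<close>

lemma sum_pairs_remove:
  fixes q :: "nat \<Rightarrow> nat \<Rightarrow> int"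
  assumes "finite A" "r \<in> A"
  shows "(\<Sum>(k, l)\<in>pairs A. q k l) =
    (\<Sum>(k, l)\<in>pairs (A - {r}). q k l) + (\<Sum>k\<in>A - {r}. if k < r then q k r else q r k)"
proof -
  let ?e = "\<lambda>k. if k < r then (k, r) else (r, k)"
  have "pairs A = pairs (A - {r}) \<union> ?e ` (A - {r})"
    using assms by (auto simp: pairs_def image_iff split: if_splits)
  moreover have "pairs (A - {r}) \<inter> ?e ` (A - {r}) = {}"
    by (auto simp: pairs_def split: if_splits)
  moreover have "inj_on ?e (A - {r})"
    by (auto simp: inj_on_def split: if_splits)
  ultimately have "(\<Sum>p\<in>pairs A. case_prod q p) =
    (\<Sum>p\<in>pairs (A - {r}). case_prod q p) + (\<Sum>k\<in>A - {r}. case_prod q (?e k))"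
    using assms(1) by (simp only: sum.union_disjoint finite_pairs finite_Diff finite_imageI)
      (simp only: sum.reindex o_def)
  also have "(\<Sum>k\<in>A - {r}. case_prod q (?e k)) = (\<Sum>k\<in>A - {r}. if k < r then q k r else q r k)"
    by (intro sum.cong) auto
  finally show ?thesis by simp
qed

text \<open>
  Restricting the pairs counted by \<open>\<ell>\<^sub>-\<close> to those satisfying \<open>X\<close> interpolates between
  \<open>\<ell>\<^sub>+\<close> and \<open>\<ell>\<close>.
\<close>

definition stat :: "nat \<Rightarrow> (nat \<Rightarrow> nat \<Rightarrow> bool) \<Rightarrow> (int \<Rightarrow> int) \<Rightarrow> nat" where
  "stat n X v = card {(k, l). 1 \<le> k \<and> k < l \<and> l \<le> n \<and> v (int l) \<prec> v (int k)} +
     card {(k, l). 1 \<le> k \<and> k \<le> l \<and> l \<le> n \<and> X k l \<and> - v (int l) \<prec> v (int k)}"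

lemma ell_eq_stat: "ell n v = stat n (\<lambda>_ _. True) v"
  unfolding ell_def stat_def ell_plus_def ell_minus_def
  by (intro arg_cong2[of _ _ _ _ "(+)"] arg_cong[of _ _ card]) auto

lemma ell_plus_eq_stat: "ell_plus (window n v) = stat n (\<lambda>_ _. False) v"
proof -
  have "ell_plus (window n v) =
    card {(k, l). 1 \<le> k \<and> k < l \<and> l \<le> n \<and> v (int l) \<prec> v (int k)}"
    unfolding ell_plus_def by (intro arg_cong[of _ _ card]) auto
  then show ?thesis by (simp add: stat_def)
qed

text \<open>The contribution of one pair of distinct positions to \<open>stat\<close>, for both
  kinds of inversion at once. The diagonal pairs, which occur only in the second kind, are kept
  apart in \<open>diag_count\<close>.\<close>

definition pair_count :: "(nat \<Rightarrow> nat \<Rightarrow> bool) \<Rightarrow> (int \<Rightarrow> int) \<Rightarrow> nat \<Rightarrow> nat \<Rightarrow> int" where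
  "pair_count X v k l =
     of_bool (v (int l) \<prec> v (int k)) + of_bool (X k l \<and> - v (int l) \<prec> v (int k))"

definition diag_count :: "(nat \<Rightarrow> nat \<Rightarrow> bool) \<Rightarrow> (int \<Rightarrow> int) \<Rightarrow> nat \<Rightarrow> int" where
  "diag_count X v k = of_bool (X k k \<and> - v (int k) \<prec> v (int k))"

lemma card_eq_sum_of_bool: "finite A \<Longrightarrow> int (card {x \<in> A. P x}) = (\<Sum>x\<in>A. of_bool (P x))"
  by (simp add: sum.If_cases of_bool_def Int_def)

lemma stat_eq_sum:
  "int (stat n X v) = (\<Sum>(k, l)\<in>pairs {1..n}. pair_count X v k l) +
     (\<Sum>k\<in>{1..n}. diag_count X v k)"
proof -
  let ?P = "pairs {1..n}" let ?d = "(\<lambda>k. (k, k)) ` {1..n}"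
  have "{(k, l). 1 \<le> k \<and> k < l \<and> l \<le> n \<and> v (int l) \<prec> v (int k)} =
    {p \<in> ?P. v (int (snd p)) \<prec> v (int (fst p))}"
    by (auto simp: pairs_def)
  then have 1: "int (card {(k, l). 1 \<le> k \<and> k < l \<and> l \<le> n \<and> v (int l) \<prec> v (int k)}) =
    (\<Sum>p\<in>?P. of_bool (v (int (snd p)) \<prec> v (int (fst p))))"
    by (simp add: finite_pairs card_eq_sum_of_bool)
  let ?Q = "\<lambda>p. X (fst p) (snd p) \<and> - v (int (snd p)) \<prec> v (int (fst p))"
  have "{(k, l). 1 \<le> k \<and> k \<le> l \<and> l \<le> n \<and> X k l \<and> - v (int l) \<prec> v (int k)} =
    {p \<in> ?P \<union> ?d. ?Q p}"
    by (auto simp: pairs_def image_iff)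
  then have "int (card {(k, l). 1 \<le> k \<and> k \<le> l \<and> l \<le> n \<and> X k l \<and> - v (int l) \<prec> v (int k)}) =
    (\<Sum>p\<in>?P \<union> ?d. of_bool (?Q p))"
    using finite_pairs[of "{1..n}"] card_eq_sum_of_bool[of "?P \<union> ?d" ?Q] by simp
  also have "\<dots> = (\<Sum>p\<in>?P. of_bool (?Q p)) + (\<Sum>p\<in>?d. of_bool (?Q p))"
    by (rule sum.union_disjoint) (auto simp: finite_pairs, auto simp: pairs_def)
  also have "(\<Sum>p\<in>?d. of_bool (?Q p)) = (\<Sum>k\<in>{1..n}. of_bool (?Q (k, k)) :: int)"
    by (subst sum.reindex) (auto simp: inj_on_def)
  finally have 2: "int (card {(k, l). 1 \<le> k \<and> k \<le> l \<and> l \<le> n \<and> X k l \<and> - v (int l) \<prec> v (int k)}) =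
    (\<Sum>p\<in>?P. of_bool (?Q p)) + (\<Sum>k\<in>{1..n}. of_bool (?Q (k, k)))" .
  show ?thesis
    unfolding stat_def of_nat_add 1 2 pair_count_def diag_count_def sum.distrib case_prod_beta
    by simp
qed

lemma stat_split_one:
  assumes "j \<in> {1..n}"
  shows "int (stat n X v) =
    (\<Sum>(k, l)\<in>pairs ({1..n} - {j}). pair_count X v k l) +
    (\<Sum>k\<in>{1..n} - {j}. diag_count X v k) +
    (\<Sum>k\<in>{1..n} - {j}. if k < j then pair_count X v k j else pair_count X v j k) +
    diag_count X v j"
  unfolding stat_eq_sum using assms
  by (simp add: sum_pairs_remove[of _ j] sum.remove[of _ j])

text \<open>Each position other than \<open>r\<close> and \<open>j\<close> receives one summand
  holding its pairs with both of them, so the effect of a reflection can be compared position by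
  position.\<close>

lemma stat_split_two:
  assumes "r \<in> {1..n}" "j \<in> {1..n}" "r < j"
  shows "int (stat n X v) =
    (\<Sum>(k, l)\<in>pairs ({1..n} - {r} - {j}). pair_count X v k l) +
    (\<Sum>k\<in>{1..n} - {r} - {j}. diag_count X v k) +
    (\<Sum>k\<in>{1..n} - {r} - {j}. (if k < r then pair_count X v k r else pair_count X v r k) +
       (if k < j then pair_count X v k j else pair_count X v j k)) +
    pair_count X v r j +
    diag_count X v r + diag_count X v j"
proof -
  have m: "j \<in> {1..n} - {r}" using assms by auto
  show ?thesis
    unfolding stat_split_one[OF assms(1)]
      sum_pairs_remove[OF finite_Diff[OF finite_atLeastAtMost] m, of "pair_count X v"]
      sum.remove[OF finite_Diff[OF finite_atLeastAtMost] m]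
    using assms(3) by (simp add: sum.distrib)
qed

text \<open>Here \<open>a\<close> and \<open>b\<close> are the keys at positions
  \<open>r < j\<close>, replaced by \<open>- b\<close> and \<open>- a\<close>, and \<open>y\<close>
  is the key at a third position. The first two identities serve a position between \<open>r\<close>
  and \<open>j\<close>, the last two a position after \<open>j\<close>. In each couple the first
  identity is for the full length; the second is for the statistic restricted to
  \<open>l < j\<close> or \<open>l = j\<close>, \<open>k < r\<close>, which sees exactly half of the
  change.\<close>

lemma of_bool_bar_arith:
  fixes a b y :: real
  assumes "- b < a" "y \<noteq> a" "y \<noteq> - a" "y \<noteq> b" "y \<noteq> - b"
  shows "(of_bool (y < a) + of_bool (- y < a)) + (of_bool (b < y) + of_bool (- b < y)) =
    (of_bool (y < - b) + of_bool (- y < - b)) + (of_bool (- a < y) + of_bool (a < y)) + 2 *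
      (of_bool (- b < y \<and> y < a) :: int)" (is ?t1)
    "(of_bool (y < a) + of_bool (- y < a)) + of_bool (b < y) = (of_bool (y < - b) +
      of_bool (- y < - b)) + of_bool (- a < y) + (of_bool (- b < y \<and> y < a) :: int)" (is ?t2)
    "(of_bool (y < a) + of_bool (- y < a)) + (of_bool (y < b) + of_bool (- y < b)) =
      (of_bool (y < - b) + of_bool (- y < - b)) + (of_bool (y < - a) + of_bool (- y < - a)) + 2 *
        (of_bool (- b < y \<and> y < a) + of_bool (- b < - y \<and> - y < a) :: int)" (is ?t3)
    "of_bool (y < a) + of_bool (y < b) = of_bool (y < - b) + of_bool (y < - a) + (of_bool (- b < y \<and>
      y < a) + of_bool (- b < - y \<and> - y < a) :: int)" (is ?t4)
proof -
  \<comment> \<open>Since \<open>y\<close> avoids \<plusminus>\<open>a\<close> and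
    \<plusminus>\<open>b\<close>, all comparisons reduce to four truth values; \<open>i\<close>
    excludes the combinations that contradict \<open>- b < a\<close>.\<close>
  have c: "- y < a \<longleftrightarrow> \<not> y < - a" "- y < b \<longleftrightarrow> \<not> y < - b" "- y < - b \<longleftrightarrow> \<not> y < b" "- y < - a \<longleftrightarrow> \<not> y < a"
    "b < y \<longleftrightarrow> \<not> y < b" "- b < y \<longleftrightarrow> \<not> y < - b" "- a < y \<longleftrightarrow> \<not> y < - a" "a < y \<longleftrightarrow> \<not> y < a"
    "- b < - y \<longleftrightarrow> y < b"
    using assms(2-) by linarith+
  have i: "y < - b \<Longrightarrow> y < a" "y < - a \<Longrightarrow> y < b" using assms(1) by linarith+
  show "?t1" "?t2" "?t3" "?t4"
    unfolding c using i
    by (cases "y < a"; cases "y < - b"; cases "y < b"; cases "y < - a"; simp only: of_bool_eq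
      if_True if_False simp_thms; simp)+
qed

lemma of_bool_swap_arith:
  fixes a b y :: real
  assumes "b < a" "y \<noteq> a" "y \<noteq> b"
  shows "(of_bool (y < a) + of_bool (- y < a)) + (of_bool (b < y) + of_bool (- b < y)) =
    (of_bool (y < b) + of_bool (- y < b)) + (of_bool (a < y) + of_bool (- a < y)) + 2 *
      (of_bool (b < y \<and> y < a) :: int)"
proof -
  have c: "b < y \<longleftrightarrow> \<not> y < b" "a < y \<longleftrightarrow> \<not> y < a" "- a < y \<longleftrightarrow> - y < a" "- b < y \<longleftrightarrow> - y < b"
    using assms(2-) by linarith+
  have i: "y < b \<Longrightarrow> y < a" using assms(1) by linarith+
  show ?thesis
    unfolding c using i by (cases "y < a"; cases "y < b"; simp)
qed

lemma pair_count_key: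
  "v (int k) \<noteq> 0 \<Longrightarrow> v (int l) \<noteq> 0 \<Longrightarrow> pair_count X v k l =
     of_bool (key (v (int l)) < key (v (int k))) + of_bool (X k l \<and> - key (v (int l)) < key (v (int
       k)))"
  by (simp add: pair_count_def letter_less_key)

lemma diag_count_key:
  "v (int k) \<noteq> 0 \<Longrightarrow> diag_count X v k = of_bool (X k k \<and> 0 < key (v (int k)))"
  by (auto simp: diag_count_def letter_less_key)

definition between_count :: "(int \<Rightarrow> int) \<Rightarrow> int \<Rightarrow> int \<Rightarrow> nat set \<Rightarrow> nat" where
  "between_count v a b I = card {i \<in> I. a \<prec> v (int i) \<and> v (int i) \<prec> b}"

text \<open>The statistic of a single swap, written for a signed permutation instead of a column;
  \<open>N_swap_window\<close> identifies the two.\<close>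

definition bar_count :: "nat \<Rightarrow> (int \<Rightarrow> int) \<Rightarrow> nat \<Rightarrow> nat \<Rightarrow> nat" where
  "bar_count n v r j =
     between_count v (- v (int j)) (v (int r)) {r<..<j} +
     card {e \<in> letters n. - v (int j) \<prec> e \<and> e \<prec> v (int r) \<and>
       (\<forall>i\<in>{1..j}. e \<noteq> v (int i) \<and> e \<noteq> - v (int i))} +
     of_bool (v (int r) < 0 \<and> v (int j) < 0)"

lemma between_count_eq_sum:
  "finite I \<Longrightarrow> int (between_count v a b I) = (\<Sum>i\<in>I. of_bool (a \<prec> v (int i) \<and> v (int i) \<prec> b))"
  by (simp add: between_count_def card_eq_sum_of_bool)

text \<open>A signed permutation uses each letter once up to sign, so the letters absent up to sign
  from the first \<open>j\<close> positions are the values \<plusminus>\<open>v i\<close> with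
  \<open>i > j\<close>, all different. This turns the second summand of \<open>bar_count\<close>
  into a sum over positions.\<close>

lemma card_unused_letters:
  assumes "v \<in> signed_perms n" "j \<le> n"
  shows "card {e \<in> letters n. P e \<and> (\<forall>i\<in>{1..j}. e \<noteq> v (int i) \<and> e \<noteq> - v (int i))} =
    card {i \<in> {j<..n}. P (v (int i))} + card {i \<in> {j<..n}. P (- v (int i))}"
proof -
  let ?f = "\<lambda>i. v (int i)" and ?g = "\<lambda>i. - v (int i)"
  have "{e \<in> letters n. P e \<and> (\<forall>i\<in>{1..j}. e \<noteq> v (int i) \<and> e \<noteq> - v (int i))} =
    ?f ` {i \<in> {j<..n}. P (?f i)} \<union> ?g ` {i \<in> {j<..n}. P (?g i)}" (is "?A = ?B")
  proof
    show "?A \<subseteq> ?B"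
    proof
      fix e assume e: "e \<in> ?A"
      then obtain k where k: "k \<in> {1..n}" "e = v (int k) \<or> e = - v (int k)"
        using signed_perms_surj[OF assms(1)] by blast
      with e have "k \<in> {j<..n}" by force
      with e k show "e \<in> ?B" by auto
    qed
    show "?B \<subseteq> ?A"
    proof
      fix e assume "e \<in> ?B"
      then obtain k where k: "k \<in> {j<..n}" "e = v (int k) \<or> e = - v (int k)" "P e" by blast
      have "e \<noteq> v (int i) \<and> e \<noteq> - v (int i)" if "i \<in> {1..j}" for i
        using signed_perms_inj_pos[OF assms(1), of k i] that k assms(2) by auto
      moreover have "v (int k) \<in> letters n"
        using k by (intro signed_perms_in_letters[OF assms(1)]) auto
      then have "e \<in> letters n" using k(2) by auto
      ultimately show "e \<in> ?A" using k(3) by simp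
    qed
  qed
  moreover have "inj_on ?f {i \<in> {j<..n}. P (?f i)}" "inj_on ?g {i \<in> {j<..n}. P (?g i)}"
    by (auto simp: inj_on_def signed_perms_inj[OF assms(1)])
  moreover have "?f ` {i \<in> {j<..n}. P (?f i)} \<inter> ?g ` {i \<in> {j<..n}. P (?g i)} = {}"
  proof -
    have "v (int i) \<noteq> - v (int l)" if "i \<in> {j<..n}" "l \<in> {j<..n}" for i l
      using that signed_perms_inj[OF assms(1), of "int i" "- int l"]
        signed_perms_minus[OF assms(1)] by auto
    then show ?thesis by blast
  qed
  ultimately show ?thesis by (simp add: card_Un_disjoint card_image)
qed

lemma bar_count_eq_sum:
  assumes "v \<in> signed_perms n" "j \<le> n"
  shows "int (bar_count n v r j) =
    (\<Sum>k\<in>{r<..<j}. of_bool (- v (int j) \<prec> v (int k) \<and> v (int k) \<prec> v (int r))) +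
    (\<Sum>k\<in>{j<..n}. of_bool (- v (int j) \<prec> v (int k) \<and> v (int k) \<prec> v (int r)) +
       of_bool (- v (int j) \<prec> - v (int k) \<and> - v (int k) \<prec> v (int r))) +
    of_bool (v (int r) < 0 \<and> v (int j) < 0)"
  using card_unused_letters[OF assms, of "\<lambda>e. - v (int j) \<prec> e \<and> e \<prec> v (int r)"]
  by (simp only: bar_count_def between_count_eq_sum sum.distrib of_nat_add card_eq_sum_of_bool
      finite_greaterThanAtMost finite_greaterThanLessThan conj_assoc of_nat_of_bool)

text \<open>A position before \<open>r\<close> sees the entries at \<open>r\<close> and
  \<open>j\<close> with both signs and contributes no change. Every other position changes the
  length by twice its share in \<open>bar_count\<close>, the pair \<open>(r, j)\<close> gives the
  extra 1, and the diagonal pairs give twice the sign term. The restricted statistic keeps one half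
  of each change and stops just before the pair \<open>(r, j)\<close>, which is why no extra 1
  appears there.\<close>

lemma stat_bar_diff:
  assumes v: "v \<in> signed_perms n" and rj: "1 \<le> r" "r < j" "j \<le> n"
    and less: "- v (int j) \<prec> v (int r)"
  defines "v' \<equiv> v \<circ> signed_refl (int r, - int j)"
  shows "ell n v = ell n v' + 2 * bar_count n v r j + 1"
    and "stat n (\<lambda>k l. l < j \<or> l = j \<and> k < r) v =
      stat n (\<lambda>k l. l < j \<or> l = j \<and> k < r) v' + bar_count n v r j"
proof -
  let ?R = "{1..n} - {r} - {j}"
  let ?c = "\<lambda>k. if r < k \<and> k < j then of_bool (- v (int j) \<prec> v (int k) \<and> v (int k) \<prec> v (int r))
     else if j < k then of_bool (- v (int j) \<prec> v (int k) \<and> v (int k) \<prec> v (int r)) +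
       of_bool (- v (int j) \<prec> - v (int k) \<and> - v (int k) \<prec> v (int r)) else (0::int)"
  have app: "v' (int k) = (if k = r then - v (int j) else if k = j then - v (int r) else v (int k))"
    if "k \<in> {1..n}" for k
    unfolding v'_def using refl_bar_apply[OF v, of r j k] rj that by auto
  have rjin: "r \<in> {1..n}" "j \<in> {1..n}" using rj by auto
  have nz: "v (int r) \<noteq> 0" "v (int j) \<noteq> 0" using signed_perms_nonzero[OF v] rjin by auto
  have ne: "v (int r) \<noteq> v (int j)" "v (int r) \<noteq> - v (int j)"
    using signed_perms_inj_pos[OF v rjin] rj by auto
  have "(\<Sum>k\<in>?R. ?c k) = (\<Sum>k\<in>{r<..<j} \<union> {j<..n}. ?c k)"
    using rj by (intro sum.mono_neutral_right) auto
  also have "\<dots> = (\<Sum>k\<in>{r<..<j}. ?c k) + (\<Sum>k\<in>{j<..n}. ?c k)"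
    by (rule sum.union_disjoint) auto
  finally have bc: "int (bar_count n v r j) = (\<Sum>k\<in>?R. ?c k) + of_bool (v (int r) < 0 \<and> v (int j) < 0)"
    using bar_count_eq_sum[OF v rj(3), of r] rj by simp
  have eq: "(\<Sum>(k, l)\<in>pairs ?R. pair_count X v k l) = (\<Sum>(k, l)\<in>pairs ?R. pair_count X v' k l)"
    "(\<Sum>k\<in>?R. diag_count X v k) =
      (\<Sum>k\<in>?R. diag_count X v' k)" for X
    by (rule sum.cong; auto simp: pairs_def pair_count_def diag_count_def app)+
  let ?s = "\<lambda>X v k. (if k < r then pair_count X v k r else pair_count X v r k) +
       (if k < j then pair_count X v k j else pair_count X v j k)"
  have kfacts: "v (int k) \<noteq> 0" "v (int k) \<noteq> v (int r)" "v (int k) \<noteq> - v (int r)"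
     "v (int k) \<noteq> v (int j)" "v (int k) \<noteq> - v (int j)" if "k \<in> ?R" for k
    using that rjin signed_perms_nonzero[OF v] signed_perms_inj_pos[OF v] by auto
  let ?X = "\<lambda>k l. l < j \<or> l = j \<and> k < r"
  have d1: "?s (\<lambda>_ _. True) v k = ?s (\<lambda>_ _. True) v' k + 2 * ?c k"
    and d2: "?s ?X v k = ?s ?X v' k + ?c k" if k: "k \<in> ?R" for k
  proof -
    let ?a = "key (v (int r))" and ?b = "key (v (int j))" and ?y = "key (v (int k))"
    have k': "k \<in> {1..n}" "k \<noteq> r" "k \<noteq> j" using k by auto
    have y: "- ?b < ?a" "?y \<noteq> ?a" "?y \<noteq> - ?a" "?y \<noteq> ?b" "?y \<noteq> - ?b"
      using kfacts[OF k] less nz by (simp_all add: letter_less_key flip: key_minus)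
    have pc: "pair_count X v k r = of_bool (?a < ?y) + of_bool (X k r \<and> - ?a < ?y)"
      "pair_count X v' k r = of_bool (- ?b < ?y) + of_bool (X k r \<and> ?b < ?y)"
      "pair_count X v r k = of_bool (?y < ?a) + of_bool (X r k \<and> - ?y < ?a)"
      "pair_count X v' r k = of_bool (?y < - ?b) + of_bool (X r k \<and> - ?y < - ?b)"
      "pair_count X v k j = of_bool (?b < ?y) + of_bool (X k j \<and> - ?b < ?y)"
      "pair_count X v' k j = of_bool (- ?a < ?y) + of_bool (X k j \<and> ?a < ?y)"
      "pair_count X v j k = of_bool (?y < ?b) + of_bool (X j k \<and> - ?y < ?b)"
      "pair_count X v' j k = of_bool (?y < - ?a) + of_bool (X j k \<and> - ?y < - ?a)" for X
      using rj(2) by (simp_all only: pair_count_key key_minus kfacts(1)[OF k] nz k' not_False_eq_True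
        app[OF k'(1)] app[OF rjin(1)] app[OF rjin(2)] if_True if_False simp_thms
        neg_equal_0_iff_equal minus_minus rj(2)[THEN less_not_refl3] rj(2)[THEN less_not_refl2])
    have c: "?c k = (if r < k \<and> k < j then of_bool (- ?b < ?y \<and> ?y < ?a)
      else if j < k then of_bool (- ?b < ?y \<and> ?y < ?a) + of_bool (- ?b < - ?y \<and> - ?y < ?a) else 0)"
      using kfacts[OF k] nz by (simp add: letter_less_key)
    consider "k < r" "k < j" | "\<not> k < r" "k < j" "r < k" | "\<not> k < r" "\<not> k < j" "j < k" "r < k"
      using k' rj by linarith
    then have "?s (\<lambda>_ _. True) v k = ?s (\<lambda>_ _. True) v' k + 2 * ?c k \<and> ?s ?X v k = ?s ?X v' k + ?c k"
    proof cases
      case 1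
      then show ?thesis unfolding pc c using rj by simp
    next
      case 2
      then show ?thesis unfolding pc c using of_bool_bar_arith(1,2)[OF y] rj
        by (simp del: minus_less_iff)
    next
      case 3
      then show ?thesis unfolding pc c using of_bool_bar_arith(3,4)[OF y] rj
        by (simp del: minus_less_iff)
    qed
    then show "?s (\<lambda>_ _. True) v k = ?s (\<lambda>_ _. True) v' k + 2 * ?c k" "?s ?X v k = ?s ?X v' k + ?c k"
      by blast+
  qed
  let ?a = "key (v (int r))" and ?b = "key (v (int j))"
  have kv: "v' (int r) = - v (int j)" "v' (int j) = - v (int r)"
    using app[OF rjin(1)] app[OF rjin(2)] rj(2) by simp_all
  have nz': "v' (int r) \<noteq> 0" "v' (int j) \<noteq> 0" using nz kv by simp_all
  have ab: "- ?b < ?a" using less by (simp add: letter_less_key nz)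
  have a0: "?a \<noteq> 0" "?b \<noteq> 0"
    using nz by (simp_all add: key_def)
  \<comment> \<open>Only summands inside the positions \<open>r\<close> and \<open>j\<close> remain.
    As \<open>- ?b < ?a\<close>, at least one of the two entries is barred, so the full diagonal
    loses two pairs if both are and none otherwise.\<close>
  have top: "pair_count (\<lambda>_ _. True) v r j = pair_count (\<lambda>_ _. True) v' r j + 1"
    "diag_count (\<lambda>_ _. True) v r + diag_count (\<lambda>_ _. True) v j =
      diag_count (\<lambda>_ _. True) v' r + diag_count (\<lambda>_ _. True) v' j + 2 * of_bool (v (int r) < 0 \<and>
        v (int j) < 0)"
    "pair_count ?X v r j = pair_count ?X v' r j"
    "diag_count ?X v r = diag_count ?X v' r + of_bool (v (int r) < 0 \<and> v (int j) < 0)"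
    "diag_count ?X v j = 0" "diag_count ?X v' j = 0"
    unfolding pair_count_key[where v = v and k = r and l = j, OF nz]
      pair_count_key[where v = v' and k = r and l = j, OF nz']
      diag_count_key[where v = v and k = r, OF nz(1)] diag_count_key[where v = v and k = j, OF nz(2)]
      diag_count_key[where v = v' and k = r, OF nz'(1)] diag_count_key[where v = v' and k = j,
        OF nz'(2)]
      key_neg_iff[OF nz(1)] key_neg_iff[OF nz(2)] kv key_minus
    using ab a0 rj(2) by (auto simp: of_bool_def)
  have gen: "p + d + (s + 2 * c) + q + dr + dj = p + d + s + q' + dr' + dj' + 2 * (c + o') + 1"
    if "q = q' + 1" "dr + dj = dr' + dj' + 2 * o'" for p d s c q q' dr dr' dj dj' o' :: int
    using that by algebra
  have D1: "(\<Sum>k\<in>?R. ?s (\<lambda>_ _. True) v k) = (\<Sum>k\<in>?R. ?s (\<lambda>_ _. True) v' k) + 2 * (\<Sum>k\<in>?R. ?c k)"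
    unfolding sum_distrib_left sum.distrib[symmetric] by (rule sum.cong[OF refl d1])
  have "int (ell n v) = int (ell n v') + 2 * int (bar_count n v r j) + 1"
    unfolding ell_eq_stat stat_split_two[OF rjin rj(2)] eq bc D1
    by (rule gen[OF top(1,2)])
  then show "ell n v = ell n v' + 2 * bar_count n v r j + 1" by linarith
  have D2: "(\<Sum>k\<in>?R. ?s ?X v k) = (\<Sum>k\<in>?R. ?s ?X v' k) + (\<Sum>k\<in>?R. ?c k)"
    unfolding sum.distrib[symmetric] by (rule sum.cong[OF refl d2])
  have "int (stat n ?X v) = int (stat n ?X v') + int (bar_count n v r j)"
    unfolding stat_split_two[OF rjin rj(2)] eq bc D2
    by (simp only: top add_0_right ac_simps)
  then show "stat n ?X v = stat n ?X v' + bar_count n v r j" by linarith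
qed

text \<open>Positions before \<open>r\<close> or after \<open>j\<close> see the two entries only as
  an unordered pair. A position strictly between them notices the exchange exactly when its entry
  lies between the two values, and then two inversions disappear.\<close>

lemma ell_swap_diff:
  assumes v: "v \<in> signed_perms n" and rj: "1 \<le> r" "r < j" "j \<le> n"
    and less: "v (int j) \<prec> v (int r)"
  defines "v' \<equiv> v \<circ> signed_refl (int r, int j)"
  shows "ell n v = ell n v' + 2 * between_count v (v (int j)) (v (int r)) {r<..<j} + 1"
proof -
  let ?R = "{1..n} - {r} - {j}"
  let ?c = "\<lambda>k. if r < k \<and> k < j then of_bool (v (int j) \<prec> v (int k) \<and> v (int k) \<prec> v (int r))
     else (0::int)"
  have app: "v' (int k) = (if k = r then v (int j) else if k = j then v (int r) else v (int k))"
    if "k \<in> {1..n}" for k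
    unfolding v'_def using refl_swap_apply[of r j k v] rj that by auto
  have rjin: "r \<in> {1..n}" "j \<in> {1..n}" using rj by auto
  have nz: "v (int r) \<noteq> 0" "v (int j) \<noteq> 0" using signed_perms_nonzero[OF v] rjin by auto
  have ne: "v (int r) \<noteq> v (int j)" "v (int r) \<noteq> - v (int j)"
    using signed_perms_inj_pos[OF v rjin] rj by auto
  have "(\<Sum>k\<in>?R. ?c k) = (\<Sum>k\<in>{r<..<j}. ?c k)"
    using rj by (intro sum.mono_neutral_right) auto
  then have bc: "int (between_count v (v (int j)) (v (int r)) {r<..<j}) = (\<Sum>k\<in>?R. ?c k)"
    by (simp add: between_count_eq_sum)
  have eq: "(\<Sum>(k, l)\<in>pairs ?R. pair_count X v k l) = (\<Sum>(k, l)\<in>pairs ?R. pair_count X v' k l)"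
    "(\<Sum>k\<in>?R. diag_count X v k) =
      (\<Sum>k\<in>?R. diag_count X v' k)" for X
    by (rule sum.cong; auto simp: pairs_def pair_count_def diag_count_def app)+
  let ?s = "\<lambda>X v k. (if k < r then pair_count X v k r else pair_count X v r k) +
       (if k < j then pair_count X v k j else pair_count X v j k)"
  have kfacts: "v (int k) \<noteq> 0" "v (int k) \<noteq> v (int r)" "v (int k) \<noteq> - v (int r)"
     "v (int k) \<noteq> v (int j)" "v (int k) \<noteq> - v (int j)" if "k \<in> ?R" for k
    using that rjin signed_perms_nonzero[OF v] signed_perms_inj_pos[OF v] by auto
  have d1: "?s (\<lambda>_ _. True) v k = ?s (\<lambda>_ _. True) v' k + 2 * ?c k" if k: "k \<in> ?R" for k
  proof -
    let ?a = "key (v (int r))" and ?b = "key (v (int j))" and ?y = "key (v (int k))"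
    have k': "k \<in> {1..n}" "k \<noteq> r" "k \<noteq> j" using k by auto
    have y: "?b < ?a" "?y \<noteq> ?a" "?y \<noteq> ?b"
      using kfacts[OF k] less nz by (simp_all add: letter_less_key flip: key_minus)
    have pc: "pair_count X v k r = of_bool (?a < ?y) + of_bool (X k r \<and> - ?a < ?y)"
      "pair_count X v' k r = of_bool (?b < ?y) + of_bool (X k r \<and> - ?b < ?y)"
      "pair_count X v r k = of_bool (?y < ?a) + of_bool (X r k \<and> - ?y < ?a)"
      "pair_count X v' r k = of_bool (?y < ?b) + of_bool (X r k \<and> - ?y < ?b)"
      "pair_count X v k j = of_bool (?b < ?y) + of_bool (X k j \<and> - ?b < ?y)"
      "pair_count X v' k j = of_bool (?a < ?y) + of_bool (X k j \<and> - ?a < ?y)"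
      "pair_count X v j k = of_bool (?y < ?b) + of_bool (X j k \<and> - ?y < ?b)"
      "pair_count X v' j k = of_bool (?y < ?a) + of_bool (X j k \<and> - ?y < ?a)" for X
      using rj(2) by (simp_all only: pair_count_key key_minus kfacts(1)[OF k] nz k' not_False_eq_True
        app[OF k'(1)] app[OF rjin(1)] app[OF rjin(2)] if_True if_False simp_thms
        neg_equal_0_iff_equal minus_minus rj(2)[THEN less_not_refl3] rj(2)[THEN less_not_refl2])
    have c: "?c k = (if r < k \<and> k < j then of_bool (?b < ?y \<and> ?y < ?a) else 0)"
      using kfacts[OF k] nz by (simp add: letter_less_key)
    consider "k < r" "k < j" | "\<not> k < r" "k < j" "r < k" | "\<not> k < r" "\<not> k < j" "j < k" "r < k"
      using k' rj by linarith
    then show ?thesis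
    proof cases
      case 2
      then show ?thesis unfolding pc c using of_bool_swap_arith[OF y] rj
        by (simp del: minus_less_iff)
    qed (unfold pc c, use rj in simp_all)
  qed
  let ?a = "key (v (int r))" and ?b = "key (v (int j))"
  have kv: "v' (int r) =  v (int j)" "v' (int j) =  v (int r)"
    using app[OF rjin(1)] app[OF rjin(2)] rj(2) by simp_all
  have nz': "v' (int r) \<noteq> 0" "v' (int j) \<noteq> 0" using nz kv by simp_all
  have ab: " ?b < ?a" using less by (simp add: letter_less_key nz)
  have top: "pair_count (\<lambda>_ _. True) v r j = pair_count (\<lambda>_ _. True) v' r j + 1"
    "diag_count (\<lambda>_ _. True) v r + diag_count (\<lambda>_ _. True) v j = diag_count (\<lambda>_ _. True) v' r +
      diag_count (\<lambda>_ _. True) v' j"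
    unfolding pair_count_key[where v = v and k = r and l = j, OF nz]
      pair_count_key[where v = v' and k = r and l = j, OF nz']
      diag_count_key[where v = v and k = r, OF nz(1)] diag_count_key[where v = v and k = j, OF nz(2)]
      diag_count_key[where v = v' and k = r, OF nz'(1)] diag_count_key[where v = v' and k = j,
        OF nz'(2)]
      kv key_minus
    using ab by (auto simp: of_bool_def)
  have D1: "(\<Sum>k\<in>?R. ?s (\<lambda>_ _. True) v k) = (\<Sum>k\<in>?R. ?s (\<lambda>_ _. True) v' k) + 2 * (\<Sum>k\<in>?R. ?c k)"
    unfolding sum_distrib_left sum.distrib[symmetric] by (rule sum.cong[OF refl d1])
  have "int (ell n v) = int (ell n v') + 2 * int (between_count v (v (int j)) (v (int r)) {r<..<j}) + 1"
    unfolding ell_eq_stat stat_split_two[OF rjin rj(2)] eq bc D1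
    using top
    by linarith
  then show ?thesis by linarith
qed

text \<open>The degenerate case \<open>r = j\<close> of the bar reflection: positions before
  \<open>j\<close> see both signs of the entry, later ones contribute two inversions each, and the
  diagonal pair gives the 1. The restriction omits the diagonal pair and the second kind of
  inversion between \<open>j\<close> and later positions, which leaves half of the change.\<close>

lemma stat_neg_diff:
  assumes v: "v \<in> signed_perms n" and j: "1 \<le> j" "j \<le> n" and neg: "v (int j) < 0"
  defines "v' \<equiv> v \<circ> signed_refl (int j, - int j)"
  shows "ell n v = ell n v' + 2 * between_count v (- v (int j)) (v (int j)) {j<..n} + 1"
    and "stat n (\<lambda>k l. l < j \<or> l = j \<and> k < j) v =
      stat n (\<lambda>k l. l < j \<or> l = j \<and> k < j) v' + between_count v (- v (int j)) (v (int j)) {j<..n}"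
proof -
  let ?R = "{1..n} - {j}" let ?X = "\<lambda>k l. l < j \<or> l = j \<and> k < j"
  let ?c = "\<lambda>k. if j < k then of_bool (- v (int j) \<prec> v (int k) \<and> v (int k) \<prec> v (int j))
     else (0::int)"
  have app: "v' (int k) = (if k = j then - v (int j) else v (int k))"
    if "k \<in> {1..n}" for k
    unfolding v'_def using refl_neg_apply[OF v, of j k] j that by auto
  have jin: "j \<in> {1..n}" using j by auto
  have "(\<Sum>k\<in>?R. ?c k) = (\<Sum>k\<in>{j<..n}. ?c k)"
    using j by (intro sum.mono_neutral_right) auto
  then have bc: "int (between_count v (- v (int j)) (v (int j)) {j<..n}) = (\<Sum>k\<in>?R. ?c k)"
    by (simp add: between_count_eq_sum)
  have eq: "(\<Sum>(k, l)\<in>pairs ?R. pair_count X v k l) = (\<Sum>(k, l)\<in>pairs ?R. pair_count X v' k l)"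
    "(\<Sum>k\<in>?R. diag_count X v k) =
      (\<Sum>k\<in>?R. diag_count X v' k)" for X
    by (rule sum.cong; auto simp: pairs_def pair_count_def diag_count_def app)+
  let ?s = "\<lambda>X v k. if k < j then pair_count X v k j else pair_count X v j k"
  have kfacts: "v (int k) \<noteq> 0" "v (int k) \<noteq> v (int j)" "v (int k) \<noteq> - v (int j)" if "k \<in> ?R" for k
    using that jin signed_perms_nonzero[OF v] signed_perms_inj_pos[OF v] by auto
  have nz: "v (int j) \<noteq> 0" using neg by simp
  have kv: "v' (int j) = - v (int j)" using app[OF jin] by simp
  have nz': "v' (int j) \<noteq> 0" using nz kv by simp
  let ?a = "key (v (int j))"
  have a: "0 < ?a" using neg by (simp add: key_neg_iff[OF nz, symmetric])
  have d1: "?s (\<lambda>_ _. True) v k = ?s (\<lambda>_ _. True) v' k + 2 * ?c k"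
    and d2: "?s ?X v k = ?s ?X v' k + ?c k" if k: "k \<in> ?R" for k
  proof -
    let ?y = "key (v (int k))"
    have k': "k \<in> {1..n}" "k \<noteq> j" using k by auto
    have y: "- ?a < ?a" "?y \<noteq> ?a" "?y \<noteq> - ?a"
      using kfacts[OF k] a by (simp, simp_all flip: key_minus)
    have pc: "pair_count X v k j = of_bool (?a < ?y) + of_bool (X k j \<and> - ?a < ?y)"
      "pair_count X v' k j = of_bool (- ?a < ?y) + of_bool (X k j \<and> ?a < ?y)"
      "pair_count X v j k = of_bool (?y < ?a) + of_bool (X j k \<and> - ?y < ?a)"
      "pair_count X v' j k = of_bool (?y < - ?a) + of_bool (X j k \<and> - ?y < - ?a)" for X
      using app[OF k'(1)] k'(2) by (simp_all add: pair_count_key kfacts(1)[OF k] nz nz' kv)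
    have c: "?c k = (if j < k then of_bool (- ?a < ?y \<and> ?y < ?a) else 0)"
      using kfacts[OF k] nz by (simp add: letter_less_key)
    have i: "- ?y < ?a \<longleftrightarrow> \<not> ?y < - ?a" "- ?y < - ?a \<longleftrightarrow> \<not> ?y < ?a" "- ?a < ?y \<longleftrightarrow> \<not> ?y < - ?a"
      "?y < - ?a \<Longrightarrow> ?y < ?a"
      using y by linarith+
    have "?s (\<lambda>_ _. True) v k = ?s (\<lambda>_ _. True) v' k + 2 * ?c k \<and> ?s ?X v k = ?s ?X v' k + ?c k"
    proof (cases "k < j")
      case True
      then show ?thesis unfolding pc c by simp
    next
      case False
      then have "j < k" using k'(2) by simp
      then show ?thesis unfolding pc c i(1-3) using i(4)
        by (cases "?y < ?a"; cases "?y < - ?a"; simp)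
    qed
    then show "?s (\<lambda>_ _. True) v k = ?s (\<lambda>_ _. True) v' k + 2 * ?c k" "?s ?X v k = ?s ?X v' k + ?c k"
      by blast+
  qed
  have top: "diag_count (\<lambda>_ _. True) v j = 1" "diag_count (\<lambda>_ _. True) v' j = 0"
    "diag_count ?X v j = 0" "diag_count ?X v' j = 0"
    using a by (simp_all add: diag_count_key nz nz' kv)
  have D1: "(\<Sum>k\<in>?R. ?s (\<lambda>_ _. True) v k) = (\<Sum>k\<in>?R. ?s (\<lambda>_ _. True) v' k) + 2 * (\<Sum>k\<in>?R. ?c k)"
    unfolding sum_distrib_left sum.distrib[symmetric] by (rule sum.cong[OF refl d1])
  have "int (ell n v) = int (ell n v') + 2 * int (between_count v (- v (int j)) (v (int j)) {j<..n})
    + 1"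
    unfolding ell_eq_stat stat_split_one[OF jin] eq bc D1
    using top by linarith
  then show "ell n v = ell n v' + 2 * between_count v (- v (int j)) (v (int j)) {j<..n} + 1" by linarith
  have D2: "(\<Sum>k\<in>?R. ?s ?X v k) = (\<Sum>k\<in>?R. ?s ?X v' k) + (\<Sum>k\<in>?R. ?c k)"
    unfolding sum.distrib[symmetric] by (rule sum.cong[OF refl d2])
  have "int (stat n ?X v) = int (stat n ?X v') + int (between_count v (- v (int j)) (v (int j))
    {j<..n})"
    unfolding stat_split_one[OF jin] eq bc D2
    using top by linarith
  then show "stat n ?X v = stat n ?X v' + between_count v (- v (int j)) (v (int j)) {j<..n}" by linarith
qed

section \<open>Summation over one factor of the chain\<close>

text \<open>The two letters compared never coincide, so the length formula applies either to
  \<open>v\<close> or to its reflected image, and reflecting twice returns \<open>v\<close>. The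
  other two kinds of reflection are treated in the same way.\<close>

lemma ell_bar_less_iff:
  assumes v: "v \<in> signed_perms n" and rj: "1 \<le> r" "r < j" "j \<le> n"
  shows "ell n (v \<circ> signed_refl (int r, - int j)) < ell n v \<longleftrightarrow> - v (int j) \<prec> v (int r)"
proof (cases "- v (int j) \<prec> v (int r)")
  case True
  then show ?thesis using stat_bar_diff(1)[OF assms True] by simp
next
  case False
  let ?v = "v \<circ> signed_refl (int r, - int j)"
  have "v (int r) \<noteq> - v (int j)" "v (int r) \<noteq> 0" "v (int j) \<noteq> 0"
    using signed_perms_inj_pos[OF v, of r j] signed_perms_nonzero[OF v] rj by auto
  then have "v (int r) \<prec> - v (int j)" using False letter_less_linear[of "- v (int j)" "v (int r)"]
    by auto
  then have "- ?v (int j) \<prec> ?v (int r)"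
    using rj by (simp add: refl_bar_apply[OF v, of r j, unfolded comp_def])
  from stat_bar_diff(1)[OF comp_refl_in_signed_perms[OF v bar_in_pos_roots[OF rj]] rj this]
  have "ell n v < ell n ?v"
    unfolding comp_refl_refl[OF bar_in_pos_roots[OF rj]] by linarith
  then show ?thesis using False by simp
qed

lemma ell_swap_less_iff:
  assumes v: "v \<in> signed_perms n" and rj: "1 \<le> r" "r < j" "j \<le> n"
  shows "ell n (v \<circ> signed_refl (int r, int j)) < ell n v \<longleftrightarrow> v (int j) \<prec> v (int r)"
proof (cases "v (int j) \<prec> v (int r)")
  case True
  then show ?thesis using ell_swap_diff[OF assms True] by simp
next
  case False
  let ?v = "v \<circ> signed_refl (int r, int j)"
  have "v (int r) \<noteq> v (int j)" "v (int r) \<noteq> 0" "v (int j) \<noteq> 0"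
    using signed_perms_inj_pos[OF v, of r j] signed_perms_nonzero[OF v] rj by auto
  then have "v (int r) \<prec> v (int j)" using False letter_less_linear[of "v (int j)" "v (int r)"] by auto
  then have "?v (int j) \<prec> ?v (int r)"
    using rj by (simp add: refl_swap_apply[of r j, unfolded comp_def])
  from ell_swap_diff[OF comp_refl_in_signed_perms[OF v swap_in_pos_roots[OF rj]] rj this]
  have "ell n v < ell n ?v"
    unfolding comp_refl_refl[OF swap_in_pos_roots[OF rj]] by linarith
  then show ?thesis using False by simp
qed

lemma ell_neg_less_iff:
  assumes v: "v \<in> signed_perms n" and j: "1 \<le> j" "j \<le> n"
  shows "ell n (v \<circ> signed_refl (int j, - int j)) < ell n v \<longleftrightarrow> v (int j) < 0"
proof (cases "v (int j) < 0")
  case True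
  then show ?thesis using stat_neg_diff(1)[OF assms True] by simp
next
  case False
  let ?v = "v \<circ> signed_refl (int j, - int j)"
  have "v (int j) \<noteq> 0"
    using signed_perms_nonzero[OF v] j by auto
  then have "?v (int j) < 0"
    using False j by (simp add: refl_neg_apply[OF v, unfolded comp_def])
  from stat_neg_diff(1)[OF comp_refl_in_signed_perms[OF v neg_in_pos_roots[OF j]] j this]
  have "ell n v < ell n ?v"
    unfolding comp_refl_refl[OF neg_in_pos_roots[OF j]] by linarith
  then show ?thesis using False by simp
qed

section \<open>Transfer operators along the chain\<close>

text \<open>The exponent contributed by one step. The truncating division is exact on the steps that
  occur, because a reflection changes the length by an odd number
  (\<open>ell_refl_gap\<close>).\<close>

definition gap :: "nat \<Rightarrow> (int \<Rightarrow> int) \<Rightarrow> (int \<Rightarrow> int) \<Rightarrow> nat" where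
  "gap n u v = (ell n u - ell n v - 1) div 2"

text \<open>If \<open>g u\<close> is the total weight of the paths standing at \<open>u\<close>
  before the root is read, this is the total weight at \<open>v\<close> afterwards: paths that skip
  the root stay at \<open>v\<close>, paths that use it arrive from a longer element.\<close>

definition up_step ::
    "nat \<Rightarrow> 'a::comm_ring_1 \<Rightarrow> root \<Rightarrow> ((int \<Rightarrow> int) \<Rightarrow> 'a) \<Rightarrow> (int \<Rightarrow> int) \<Rightarrow> 'a" where
  "up_step n t \<beta> g v = g v + (if ell n v < ell n (v \<circ> signed_refl \<beta>)
     then t ^ gap n (v \<circ> signed_refl \<beta>) v * (1 - t) * g (v \<circ> signed_refl \<beta>) else 0)"

abbreviation up_steps ::
    "nat \<Rightarrow> 'a::comm_ring_1 \<Rightarrow> root list \<Rightarrow> ((int \<Rightarrow> int) \<Rightarrow> 'a) \<Rightarrow> (int \<Rightarrow> int) \<Rightarrow> 'a" where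
  "up_steps n t bs g \<equiv> foldl (\<lambda>g \<beta>. up_step n t \<beta> g) g bs"

lemma between_count_cong:
  "(\<And>i. i \<in> I \<Longrightarrow> v (int i) = u (int i)) \<Longrightarrow> between_count v a b I = between_count u a b I"
  unfolding between_count_def by (intro arg_cong[of _ _ card]) auto

text \<open>The exponent is evaluated at the longer element \<open>v'\<close>, the one that carries
  the left column, since the statistic of a swap is computed from that column.\<close>

lemma up_step_bar:
  assumes v: "v \<in> signed_perms n" and rj: "1 \<le> r" "r < j" "j \<le> n"
  defines "v' \<equiv> v \<circ> signed_refl (int r, - int j)"
  shows "up_step n t (int r, - int j) g v = g v + (if v (int r) \<prec> - v (int j)
    then t ^ bar_count n v' r j * (1 - t) * g v' else 0)"
proof -
  have v': "v' \<in> signed_perms n" "v' \<circ> signed_refl (int r, - int j) = v"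
    unfolding v'_def using comp_refl_in_signed_perms[OF v] bar_in_pos_roots[OF rj] comp_refl_refl
      by auto
  have a: "v' (int r) = - v (int j)" "v' (int j) = - v (int r)"
    unfolding v'_def using rj refl_bar_apply[OF v rj(1,2)] by auto
  have i: "ell n v < ell n v' \<longleftrightarrow> v (int r) \<prec> - v (int j)"
    using ell_bar_less_iff[OF v'(1) rj] unfolding v'(2) a by simp
  moreover have "gap n v' v = bar_count n v' r j" if "v (int r) \<prec> - v (int j)"
    using stat_bar_diff(1)[OF v'(1) rj] that unfolding v'(2) a by (simp add: gap_def)
  ultimately show ?thesis
    unfolding up_step_def v'_def[symmetric] by simp
qed

text \<open>The positions counted in the exponent are untouched by the reflection, so it can be
  evaluated at \<open>v\<close> itself; the same holds for \<open>up_step_neg\<close>.\<close>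

lemma up_step_swap:
  assumes v: "v \<in> signed_perms n" and rj: "1 \<le> r" "r < j" "j \<le> n"
  defines "v' \<equiv> v \<circ> signed_refl (int r, int j)"
  shows "up_step n t (int r, int j) g v = g v + (if v (int r) \<prec> v (int j)
    then t ^ between_count v (v (int r)) (v (int j)) {r<..<j} * (1 - t) * g v' else 0)"
proof -
  have v': "v' \<in> signed_perms n" "v' \<circ> signed_refl (int r, int j) = v"
    unfolding v'_def using comp_refl_in_signed_perms[OF v] swap_in_pos_roots[OF rj] comp_refl_refl
      by auto
  have a: "v' (int r) = v (int j)" "v' (int j) = v (int r)"
    unfolding v'_def using rj refl_swap_apply[OF rj(1,2), of _ v] by auto
  have b: "between_count v' x y {r<..<j} = between_count v x y {r<..<j}" for x y
    by (rule between_count_cong, unfold v'_def, subst refl_swap_apply) (use rj in auto)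
  have i: "ell n v < ell n v' \<longleftrightarrow> v (int r) \<prec> v (int j)"
    using ell_swap_less_iff[OF v'(1) rj] unfolding v'(2) a by simp
  moreover have "gap n v' v = between_count v (v (int r)) (v (int j)) {r<..<j}" if
    "v (int r) \<prec> v (int j)"
    using ell_swap_diff[OF v'(1) rj] that unfolding v'(2) a b by (simp add: gap_def)
  ultimately show ?thesis
    unfolding up_step_def v'_def[symmetric] by simp
qed

lemma up_step_neg:
  assumes v: "v \<in> signed_perms n" and j: "1 \<le> j" "j \<le> n"
  defines "v' \<equiv> v \<circ> signed_refl (int j, - int j)"
  shows "up_step n t (int j, - int j) g v = g v + (if 0 < v (int j)
    then t ^ between_count v (v (int j)) (- v (int j)) {j<..n} * (1 - t) * g v' else 0)"
proof -
  have v': "v' \<in> signed_perms n" "v' \<circ> signed_refl (int j, - int j) = v"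
    unfolding v'_def using comp_refl_in_signed_perms[OF v] neg_in_pos_roots[OF j] comp_refl_refl by auto
  have a: "v' (int j) = - v (int j)"
    unfolding v'_def using j refl_neg_apply[OF v j(1)] by auto
  have b: "between_count v' x y {j<..n} = between_count v x y {j<..n}" for x y
    by (rule between_count_cong, unfold v'_def, subst refl_neg_apply[OF v]) (use j in auto)
  have i: "ell n v < ell n v' \<longleftrightarrow> 0 < v (int j)"
    using ell_neg_less_iff[OF v'(1) j] unfolding v'(2) a by simp
  moreover have "gap n v' v = between_count v (v (int j)) (- v (int j)) {j<..n}" if "0 < v (int j)"
    using stat_neg_diff(1)[OF v'(1) j] that unfolding v'(2) a b by (simp add: gap_def)
  ultimately show ?thesis
    unfolding up_step_def v'_def[symmetric] by simp
qed

section \<open>Telescoping sums over intervals of letters\<close>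

text \<open>The exponents run through 0, ..., \<open>card S - 1\<close>, so this is a finite
  geometric sum. Elements are inserted in increasing order: a new maximum has exponent 0 and
  multiplies all earlier terms by \<open>t\<close>.\<close>

lemma sum_powers_above:
  fixes t :: "'a::comm_ring_1"
  assumes "finite S" "0 \<notin> S"
  shows "(\<Sum>d\<in>S. (1 - t) * t ^ card {e \<in> S. d \<prec> e}) = 1 - t ^ card S"
proof -
  have "(\<Sum>d\<in>S. (1 - t) * t ^ card {e \<in> S. key d < key e}) = 1 - t ^ card S"
    using assms(1)
  proof (induction rule: finite_ranking_induct[where f = key])
    case (insert x S)
    show ?case
    proof (cases "x \<in> S")
      case False
      have 1: "{e \<in> insert x S. key x < key e} = {}" using insert(2) by force
      have 2: "card {e \<in> insert x S. key d < key e} = Suc (card {e \<in> S. key d < key e})" if "d \<in> S"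
        for d
      proof -
        have "key d < key x" using insert(2)[OF that] False that by (metis key_eq_iff order_le_less)
        then have "{e \<in> insert x S. key d < key e} = insert x {e \<in> S. key d < key e}" by auto
        then show ?thesis using insert(1) False by simp
      qed
      have "(\<Sum>d\<in>insert x S. (1 - t) * t ^ card {e \<in> insert x S. key d < key e}) =
        (1 - t) + (\<Sum>d\<in>S. t * ((1 - t) * t ^ card {e \<in> S. key d < key e}))"
        unfolding sum.insert[OF insert(1) False] 1
        by (intro arg_cong2[of _ _ _ _ "(+)"] sum.cong) (simp, simp, simp only: 2 power_Suc mult_ac)
      also have "\<dots> = (1 - t) + t * (1 - t ^ card S)"
        unfolding insert(3)[symmetric] by (subst sum_distrib_left) (rule refl)
      also have "\<dots> = 1 - t ^ card (insert x S)"
        using insert(1) False by (simp add: algebra_simps)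
      finally show ?thesis .
    qed (use insert in \<open>simp add: insert_absorb\<close>)
  qed simp
  moreover have "{e \<in> S. d \<prec> e} = {e \<in> S. key d < key e}" if "d \<in> S" for d
  proof -
    have "d \<prec> e \<longleftrightarrow> key d < key e" if "e \<in> S" for e
      using that \<open>d \<in> S\<close> assms(2) by (intro letter_less_key) auto
    then show ?thesis by blast
  qed
  ultimately show ?thesis by (simp cong: sum.cong)
qed

text \<open>\<open>B\<close> stands for the letters that may occupy position \<open>j\<close>, and
  \<open>m a e\<close> for the number of entries at the fixed positions after \<open>j\<close> that
  lie strictly between \<open>a\<close> and \<open>e\<close>. Additivity holds at \<open>b\<close>
  in \<open>B\<close> because such a letter is not the entry of a fixed position.\<close>

locale letter_interval =
  fixes B :: "int set" and m :: "int \<Rightarrow> int \<Rightarrow> nat" and t :: "'a::comm_ring_1"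
  assumes fin: "finite B" and nz: "0 \<notin> B" and neg: "d \<in> B \<Longrightarrow> - d \<in> B"
    and m_add: "b \<in> B \<Longrightarrow> a \<preceq> b \<Longrightarrow> b \<preceq> e \<Longrightarrow> m a e = m a b + m b e"
begin

text \<open>The weight of raising the entry at \<open>j\<close> from \<open>p\<close> to
  \<open>d\<close>, with the chain read backwards, when one more fixed position with entry
  \<open>z\<close> has joined those counted by \<open>m\<close>.\<close>

definition wt :: "int \<Rightarrow> int \<Rightarrow> int \<Rightarrow> 'a" where
  "wt p z d = (if p \<preceq> d then t ^ (m p d + of_bool (p \<prec> z \<and> z \<prec> d)) * (if p = d then 1 else 1 - t)
    else 0)"

text \<open>This is \<open>bar_count\<close> for the reflection in \<open>j\<close> and the
  additional position, whose entries are \<open>d\<close> and \<open>y\<close> at the shorter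
  element and hence \<open>- y\<close> and \<open>- d\<close> at the longer one.\<close>

definition ex :: "int \<Rightarrow> int \<Rightarrow> nat" where
  "ex y d = m d (- y) + card {e \<in> B. d \<prec> e \<and> e \<prec> - y \<and> e \<notin> {d, - d, y, - y}} + of_bool (0 < d \<and> 0 < y)"

text \<open>Collects the ways of reaching \<open>- y\<close> from \<open>p\<close> through an
  intermediate \<open>d\<close>, the last step being the bar reflection; its factor
  \<open>1 - t\<close> is left out. Up to a common power of \<open>t\<close>, the exponent of
  \<open>d\<close> is its rank from above among the intermediate letters, so the sum
  telescopes.\<close>

lemma sum_to_minus:
  assumes p: "p \<in> B" and y: "y \<in> B" and py: "p \<noteq> y" "p \<noteq> - y"
  shows "(\<Sum>d\<in>B - {y, - y}. if d \<prec> - y then wt p y d * t ^ ex y d else 0) =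
    (if p \<prec> - y then t ^ (m p (- y) + of_bool (p \<prec> y \<and> y \<prec> - y)) else 0)"
proof -
  let ?S = "{d \<in> B - {y, - y}. p \<preceq> d \<and> d \<prec> - y}"
  let ?q = "m p (- y) + of_bool (p \<prec> y \<and> y \<prec> - y)"
  have ex: "m p d + of_bool (p \<prec> y \<and> y \<prec> d) + ex y d = ?q + card {e \<in> ?S. d \<prec> e}"
    if d: "d \<in> ?S" for d
  proof -
    have dB: "d \<in> B" "d \<noteq> y" "d \<noteq> - y" "p \<preceq> d" "d \<prec> - y" using d by auto
    have z: "d \<noteq> 0" "y \<noteq> 0" "p \<noteq> 0" using dB(1) p y nz by metis+
    have H: "p \<preceq> e" if "d \<prec> e" for e
      using letter_le_trans[OF dB(4)] that by (simp add: letter_le_def)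
    \<comment> \<open>\<open>ex\<close> omits the letter \<open>- d\<close>, which may belong to
      \<open>?S\<close>. The discrepancy is balanced by the two indicator terms, that for
      \<open>y\<close> in \<open>wt\<close> and the sign term of \<open>ex\<close>.\<close>
    have E: "{e \<in> B. d \<prec> e \<and> e \<prec> - y \<and> e \<notin> {d, - d, y, - y}} = {e \<in> ?S. d \<prec> e} - {- d}"
      using H by auto
    have D: "- d \<in> {e \<in> ?S. d \<prec> e} \<longleftrightarrow> d \<prec> - d \<and> - d \<prec> - y"
      using H neg[OF dB(1)] dB(2,3) by auto
    have "card {e \<in> ?S. d \<prec> e} = card ({e \<in> ?S. d \<prec> e} - {- d}) + of_bool (d \<prec> - d \<and> - d \<prec> - y)"
    proof (cases "- d \<in> {e \<in> ?S. d \<prec> e}")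
      case True
      then show ?thesis using D fin card_Suc_Diff1[OF _ True] by simp
    next
      case False
      then have 1: "{e \<in> ?S. d \<prec> e} - {- d} = {e \<in> ?S. d \<prec> e}" by blast
      have "\<not> (d \<prec> - d \<and> - d \<prec> - y)" using False D by blast
      then have "of_bool (d \<prec> - d \<and> - d \<prec> - y) = (0::nat)" by simp
      then show ?thesis unfolding 1 by linarith
    qed
    moreover have "of_bool (p \<prec> y \<and> y \<prec> d) + of_bool (0 < d \<and> 0 < y) =
      (of_bool (p \<prec> y \<and> y \<prec> - y) + of_bool (d \<prec> - d \<and> - d \<prec> - y) :: nat)"
    proof -
      have k: "key p = key d \<or> key p < key d" "key d < - key y" "key d \<noteq> key y" "key p \<noteq> key y"
        using dB z py by (auto simp: letter_le_def letter_less_key)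
      have z': "0 < d \<longleftrightarrow> key d < 0" "0 < y \<longleftrightarrow> key y < 0"
        using z by (auto simp: key_def field_simps)
      have n: "- y \<noteq> 0" "- d \<noteq> 0" using z by auto
      have arith: "of_bool (P < Y \<and> Y < D) + of_bool (D < 0 \<and> Y < 0) =
          (of_bool (P < Y \<and> Y < - Y) + of_bool (D < - D \<and> - D < - Y) :: nat)"
        if "P \<le> D" "D < - Y" "D \<noteq> Y" for P D Y :: real
      proof (cases "Y < 0")
        case True
        then show ?thesis using that by (cases "D < 0"; cases "Y < D"; simp)
      next
        case False
        then show ?thesis using that by simp
      qed
      show ?thesis
        unfolding z' letter_less_key[OF z(3) z(2)] letter_less_key[OF z(2) z(1)]
          letter_less_key[OF z(2) n(1)] letter_less_key[OF z(1) n(2)] letter_less_key[OF n(2) n(1)]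
            key_minus
        by (rule arith) (use k in auto)
    qed
    moreover have "m p (- y) = m p d + m d (- y)"
      using dB(5) by (intro m_add[OF dB(1) dB(4)]) (simp add: letter_le_def)
    ultimately show ?thesis unfolding ex_def E by linarith
  qed
  have "(\<Sum>d\<in>B - {y, - y}. if d \<prec> - y then wt p y d * t ^ ex y d else 0) =
    (\<Sum>d\<in>?S. t ^ ?q * ((if p = d then 1 else 1 - t) * t ^ card {e \<in> ?S. d \<prec> e}))"
  proof (rule sum.mono_neutral_cong_right)
    fix d assume d: "d \<in> ?S"
    then have "(if d \<prec> - y then wt p y d * t ^ ex y d else 0) =
      t ^ (m p d + of_bool (p \<prec> y \<and> y \<prec> d) + ex y d) * (if p = d then 1 else 1 - t)"
      by (simp add: wt_def power_add mult_ac)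
    then show "(if d \<prec> - y then wt p y d * t ^ ex y d else 0) =
      t ^ ?q * ((if p = d then 1 else 1 - t) * t ^ card {e \<in> ?S. d \<prec> e})"
      unfolding ex[OF d] by (simp add: power_add mult_ac)
  qed (use fin in \<open>auto simp: wt_def\<close>)
  also have "\<dots> = (if p \<prec> - y then t ^ ?q else 0)"
  proof (cases "p \<prec> - y")
    case True
    \<comment> \<open>The term \<open>d = p\<close> carries the factor 1 instead of
      \<open>1 - t\<close>. It supplies exactly the power \<open>t ^ card ?S'\<close> that the
      geometric sum over the other letters lacks.\<close>
    let ?S' = "?S - {p}"
    have pS: "p \<in> ?S" using True p py by simp
    have np: "\<not> e \<prec> p" if "e \<in> ?S" for e
      using that letter_less_asym by (auto simp: letter_le_def)
    have "{e \<in> ?S. p \<prec> e} = ?S'" by (auto simp: letter_le_def)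
    moreover have "{e \<in> ?S. d \<prec> e} = {e \<in> ?S'. d \<prec> e}" if "d \<in> ?S'" for d
      using np[of d] that by auto
    ultimately have "(\<Sum>d\<in>?S. (if p = d then 1 else 1 - t) * t ^ card {e \<in> ?S. d \<prec> e}) =
      t ^ card ?S' + (\<Sum>d\<in>?S'. (1 - t) * t ^ card {e \<in> ?S'. d \<prec> e})"
      using fin pS by (subst sum.remove[OF _ pS]) (auto intro!: sum.cong)
    also have "\<dots> = 1"
      using sum_powers_above[of ?S' t] fin nz by simp
    finally show ?thesis using True by (simp flip: sum_distrib_left)
  next
    case False
    then have "?S = {}" using letter_less_trans by (auto simp: letter_le_def)
    then show ?thesis using False by (simp only: sum.empty if_False)
  qed
  finally show ?thesis .
qed

text \<open>The induction step for one additional position: \<open>c\<close> and \<open>x\<close>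
  are the entries at \<open>j\<close> and at that position. The first sum skips the swap of the two
  positions, the second uses it; \<open>G\<close> records whether the bar reflection of the two
  positions is used. The two restricted sums complete each other to a sum over all of
  \<open>B\<close>.\<close>

lemma sum_extend:
  fixes \<gamma> :: "int \<Rightarrow> 'a"
  assumes c: "c \<in> B" and x: "x \<in> B" and xc: "x \<noteq> c" "x \<noteq> - c"
  defines "G \<equiv> \<lambda>y d. \<gamma> d + (if d \<prec> - y then t ^ ex y d * (1 - t) * \<gamma> (- y) else 0)"
  shows "(\<Sum>d\<in>B - {x, - x}. wt c x d * G x d) +
    (if c \<prec> x then t ^ m c x * (1 - t) * (\<Sum>d\<in>B - {c, - c}. wt x c d * G c d) else 0) =
    (\<Sum>d\<in>B. if c \<preceq> d then t ^ m c d * (if c = d then 1 else 1 - t) * \<gamma> d else 0)"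
proof -
  let ?T = "\<lambda>p y. if p \<prec> - y then t ^ (m p (- y) + of_bool (p \<prec> y \<and> y \<prec> - y)) else 0"
  \<comment> \<open>Reads one restricted sum as a linear combination of the values of
    \<open>\<gamma>\<close> on all of \<open>B\<close>. The bar reflection always ends at
    \<open>- y\<close>, and the total coefficient there comes from
    \<open>sum_to_minus\<close>.\<close>
  have one: "(\<Sum>d\<in>B - {y, - y}. wt p y d * G y d) =
     (\<Sum>d\<in>B. ((if d \<noteq> y \<and> d \<noteq> - y then wt p y d else 0) + (if d = - y then (1 - t) * ?T p y
       else 0)) * \<gamma> d)"
    if h: "p \<in> B" "y \<in> B" "p \<noteq> y" "p \<noteq> - y" for p y
  proof -
    have "(\<Sum>d\<in>B - {y, - y}. wt p y d * G y d) = (\<Sum>d\<in>B - {y, - y}. wt p y d * \<gamma> d) +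
      (\<Sum>d\<in>B - {y, - y}. (if d \<prec> - y then wt p y d * t ^ ex y d else 0) * ((1 - t) * \<gamma> (- y)))"
      unfolding G_def sum.distrib[symmetric] by (intro sum.cong) (auto simp: algebra_simps)
    also have "(\<Sum>d\<in>B - {y, - y}. wt p y d * \<gamma> d) =
      (\<Sum>d\<in>B. (if d \<noteq> y \<and> d \<noteq> - y then wt p y d else 0) * \<gamma> d)"
      using fin by (intro sum.mono_neutral_cong_left) auto
    also have "(\<Sum>d\<in>B - {y, - y}. (if d \<prec> - y then wt p y d * t ^ ex y d else 0) * ((1 - t) * \<gamma> (- y))) =
      ?T p y * ((1 - t) * \<gamma> (- y))"
      unfolding sum_distrib_right[symmetric] sum_to_minus[OF h] ..
    also have "\<dots> = (\<Sum>d\<in>B. (if d = - y then (1 - t) * ?T p y else 0) * \<gamma> d)"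
      using neg[OF h(2)] fin
      by (subst sum.mono_neutral_right[of B "{- y}"]) (auto simp: mult_ac)
    finally show ?thesis by (simp add: sum.distrib distrib_right)
  qed
  have nzs: "c \<noteq> 0" "x \<noteq> 0" using c x nz by metis+
  have "c \<noteq> x" "c \<noteq> - x" using xc by auto
  have gen: "S1 + (if q then k * S2 else 0) = (\<Sum>d\<in>B. (a d + (if q then k * b d else 0)) * \<gamma> d)"
    if "S1 = (\<Sum>d\<in>B. a d * \<gamma> d)" "S2 = (\<Sum>d\<in>B. b d * \<gamma> d)" for S1 S2 q k and a b :: "int \<Rightarrow> 'a"
    using that by (cases q) (simp_all add: distrib_right sum.distrib sum_distrib_left mult.assoc)
  from gen[OF one[OF c x \<open>c \<noteq> x\<close> \<open>c \<noteq> - x\<close>] one[OF x c xc], of "c \<prec> x" "t ^ m c x * (1 - t)"]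
  have "(\<Sum>d\<in>B - {x, - x}. wt c x d * G x d) +
    (if c \<prec> x then t ^ m c x * (1 - t) * (\<Sum>d\<in>B - {c, - c}. wt x c d * G c d) else 0) =
    (\<Sum>d\<in>B. (((if d \<noteq> x \<and> d \<noteq> - x then wt c x d else 0) + (if d = - x then (1 - t) * ?T c x else 0)) +
      (if c \<prec> x then t ^ m c x * (1 - t) *
        ((if d \<noteq> c \<and> d \<noteq> - c then wt x c d else 0) + (if d = - c then (1 - t) * ?T x c else 0))
          else 0)) * \<gamma> d)"
    .
  also have "\<dots> = (\<Sum>d\<in>B. if c \<preceq> d then t ^ m c d * (if c = d then 1 else 1 - t) * \<gamma> d else 0)"
  proof (rule sum.cong[OF refl])
    fix d assume d: "d \<in> B"
    have coef: "((if d \<noteq> x \<and> d \<noteq> - x then wt c x d else 0) + (if d = - x then (1 - t) * ?T c x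
      else 0)) +
      (if c \<prec> x then t ^ m c x * (1 - t) *
        ((if d \<noteq> c \<and> d \<noteq> - c then wt x c d else 0) + (if d = - c then (1 - t) * ?T x c else 0))
          else 0) =
      (if c \<preceq> d then t ^ m c d * (if c = d then 1 else 1 - t) else 0)" (is "?L = ?R")
    proof -
      have cx0: "\<not> x \<prec> c" if "c \<prec> x" using that letter_less_asym by blast
      have madd: "t ^ m c e = t ^ m c x * t ^ m x e" if "c \<prec> x" "x \<prec> e" for e
        using m_add[OF x, of c e] that by (simp add: letter_le_def flip: power_add)
      \<comment> \<open>Each of \<plusminus>\<open>c\<close>, \<plusminus>\<open>x\<close> is
        missing from one of the two sums and is checked separately. For other \<open>d\<close> with
        \<open>x\<close> between \<open>c\<close> and \<open>d\<close>, the first sum has an extra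
        factor \<open>t\<close> and the second supplies the missing \<open>1 - t\<close>.\<close>
      consider "d = c" | "d = - c" | "d = x" | "d = - x" | "d \<noteq> c" "d \<noteq> - c" "d \<noteq> x" "d \<noteq> - x" by blast
      then show ?thesis
      proof cases
        case 1
        have "of_bool (c \<prec> x \<and> x \<prec> c) = (0::nat)" using letter_less_asym by auto
        then show ?thesis using 1 xc nzs by (auto simp: wt_def)
      next
        case 2
        have L: "?L = wt c x (- c) + (if c \<prec> x then t ^ m c x * (1 - t) * ((1 - t) * ?T x c) else 0)"
          using 2 xc nzs by auto
        have m: "m c c = 0" using m_add[of c c c] c by simp
        show ?thesis
        proof (cases "c \<prec> x \<and> x \<prec> - c")
          case True
          then have "c \<prec> - c" using letter_less_trans by blast
          with True show ?thesis unfolding L using 2 nzs cx0 madd[of "- c"]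
            by (auto simp: wt_def letter_le_def algebra_simps)
        next
          case False
          then show ?thesis unfolding L using 2 nzs by (auto simp: wt_def letter_le_def)
        qed
      next
        case 3
        have L: "?L = (if c \<prec> x then t ^ m c x * (1 - t) * wt x c x else 0)"
          using 3 xc nzs by auto
        have "m x x = 0" using m_add[of x x x] x by simp
        then show ?thesis unfolding L using 3 xc cx0 by (auto simp: wt_def letter_le_def)
      next
        case 4
        have L: "?L = (1 - t) * ?T c x + (if c \<prec> x then t ^ m c x * (1 - t) * wt x c (- x) else 0)"
          using 4 xc nzs by auto
        show ?thesis
        proof (cases "c \<prec> x \<and> x \<prec> - x")
          case True
          then have "c \<prec> - x" using letter_less_trans by blast
          with True show ?thesis unfolding L using 4 nzs cx0 xc madd[of "- x"]
            by (auto simp: wt_def letter_le_def algebra_simps)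
        next
          case False
          then show ?thesis unfolding L using 4 nzs xc by (auto simp: wt_def letter_le_def)
        qed
      next
        case 5
        have L: "?L = wt c x d + (if c \<prec> x then t ^ m c x * (1 - t) * wt x c d else 0)"
          using 5 by auto
        show ?thesis
        proof (cases "c \<prec> x \<and> x \<prec> d")
          case True
          then have "c \<prec> d" using letter_less_trans by blast
          with True show ?thesis unfolding L using 5 nzs cx0 xc madd[of d]
            by (auto simp: wt_def letter_le_def algebra_simps)
        next
          case False
          then show ?thesis unfolding L using 5 nzs xc by (auto simp: wt_def letter_le_def)
        qed
      qed
    qed
    show "(((if d \<noteq> x \<and> d \<noteq> - x then wt c x d else 0) + (if d = - x then (1 - t) * ?T c x else 0)) +
      (if c \<prec> x then t ^ m c x * (1 - t) *
        ((if d \<noteq> c \<and> d \<noteq> - c then wt x c d else 0) + (if d = - c then (1 - t) * ?T x c else 0))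
          else 0)) * \<gamma> d = (if c \<preceq> d then t ^ m c d * (if c = d then 1 else 1 - t) * \<gamma> d else 0)"
      unfolding coef by simp
  qed
  finally show ?thesis .
qed

end

section \<open>The tail of a factor: roots reaching below the column\<close>

definition tail_roots :: "nat \<Rightarrow> nat \<Rightarrow> nat \<Rightarrow> root list" where
  "tail_roots n j k = map (\<lambda>x. (int j, - int x)) [k + 1..<Suc n] @ [(int j, - int j)] @
     map (\<lambda>x. (int j, int x)) (rev [k + 1..<Suc n])"

lemma Gamma_plain_eq: "Gamma_plain n j k = Gamma_primed j @ tail_roots n j k"
  by (simp add: Gamma_plain_def Gamma_primed_def tail_roots_def)

text \<open>The tail is nested: between its outermost two roots lies the tail for height
  \<open>k + 1\<close>. The induction on \<open>k\<close> therefore runs downwards from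
  \<open>n\<close>, where only the sign change at \<open>j\<close> is left.\<close>

lemma tail_roots_Suc:
  "k < n \<Longrightarrow> tail_roots n j k =
    (int j, - int (Suc k)) # tail_roots n j (Suc k) @ [(int j, int (Suc k))]"
  by (simp add: tail_roots_def upt_conv_Cons del: upt_Suc)

lemma tail_roots_n: "tail_roots n j n = [(int j, - int j)]"
  by (simp add: tail_roots_def)

definition avail :: "nat \<Rightarrow> nat \<Rightarrow> nat \<Rightarrow> (int \<Rightarrow> int) \<Rightarrow> int set" where
  "avail n j k v = {d \<in> letters n. \<forall>r\<in>{1..k} - {j}. d \<noteq> v (int r) \<and> d \<noteq> - v (int r)}"

lemma between_count_add:
  assumes "a \<preceq> b" "b \<preceq> e" "finite I" "\<forall>i\<in>I. v (int i) \<noteq> b \<and> v (int i) \<noteq> 0" "b \<noteq> 0"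
  shows "between_count v a e I = between_count v a b I + between_count v b e I"
proof -
  have "{i \<in> I. a \<prec> v (int i) \<and> v (int i) \<prec> e} =
    {i \<in> I. a \<prec> v (int i) \<and> v (int i) \<prec> b} \<union> {i \<in> I. b \<prec> v (int i) \<and> v (int i) \<prec> e}"
  proof -
    have "a \<prec> y \<and> y \<prec> e \<longleftrightarrow> a \<prec> y \<and> y \<prec> b \<or> b \<prec> y \<and> y \<prec> e" if y: "y \<noteq> b" "y \<noteq> 0" for y
    proof (cases "y \<prec> b")
      case True
      then have "y \<prec> e" using assms(2) letter_less_trans by (auto simp: letter_le_def)
      then show ?thesis using True letter_less_asym by blast
    next
      case False
      then have "b \<prec> y" using letter_less_linear[OF y(2) assms(5) y(1)] by blast
      moreover from this have "a \<prec> y" using assms(1) letter_less_trans by (auto simp: letter_le_def)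
      ultimately show ?thesis using False by blast
    qed
    then show ?thesis using assms(4) by blast
  qed
  moreover have "{i \<in> I. a \<prec> v (int i) \<and> v (int i) \<prec> b} \<inter> {i \<in> I. b \<prec> v (int i) \<and> v (int i) \<prec> e} = {}"
    using letter_less_asym by auto
  ultimately show ?thesis
    unfolding between_count_def using assms(3) by (simp add: card_Un_disjoint)
qed

lemma avail_n:
  assumes v: "v \<in> signed_perms n" and j: "1 \<le> j" "j \<le> n"
  shows "avail n j n v = {v (int j), - v (int j)}"
proof
  show "avail n j n v \<subseteq> {v (int j), - v (int j)}"
  proof
    fix d assume d: "d \<in> avail n j n v"
    then obtain k where "k \<in> {1..n}" "d = v (int k) \<or> d = - v (int k)"
      using signed_perms_surj[OF v, of d] unfolding avail_def by blast
    with d show "d \<in> {v (int j), - v (int j)}" by (cases "k = j") (auto simp: avail_def)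
  qed
  show "{v (int j), - v (int j)} \<subseteq> avail n j n v"
  proof -
    have "v (int j) \<in> letters n" using signed_perms_in_letters[OF v] j by auto
    moreover have "v (int j) \<noteq> v (int r)" "v (int j) \<noteq> - v (int r)" if "r \<in> {1..n} - {j}" for r
      using signed_perms_inj_pos[OF v, of j r] that j by auto
    ultimately show ?thesis by (force simp: avail_def)
  qed
qed

text \<open>As long as the other entries of the column are fixed, \<open>g\<close> is a function
  \<open>\<gamma>\<close> of the entry at \<open>j\<close>; the entries below the column, which the
  tail permutes, are summed out. The statement is for every \<open>\<gamma>\<close>, because
  absorbing the outermost bar reflection replaces \<open>\<gamma>\<close> by a new function in which
  the entry at \<open>k + 1\<close> is a parameter.\<close>

lemma up_steps_tail_roots:
  fixes t :: "'a::comm_ring_1"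
  assumes "v \<in> signed_perms n" "1 \<le> j" "j \<le> k" "k \<le> n"
    and "\<And>u. u \<in> signed_perms n \<Longrightarrow> \<forall>r\<in>{1..k} - {j}. u (int r) = v (int r) \<Longrightarrow> g u = \<gamma> (u (int j))"
  shows "up_steps n t (tail_roots n j k) g v =
    (\<Sum>d\<in>avail n j k v. if v (int j) \<preceq> d
      then t ^ between_count v (v (int j)) d {j<..k} * (if v (int j) = d then 1 else 1 - t) * \<gamma> d
        else 0)"
  using \<open>k \<le> n\<close> assms(1,3,5)
proof (induction k arbitrary: v g \<gamma> rule: inc_induct)
  case base
  note v = \<open>v \<in> signed_perms n\<close>
  have nz: "v (int j) \<noteq> 0" using signed_perms_nonzero[OF v] base assms(2) by auto
  let ?v = "v \<circ> signed_refl (int j, - int j)"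
  have v': "?v \<in> signed_perms n" by (rule comp_refl_in_signed_perms[OF v neg_in_pos_roots]) (use
    assms(2) base in auto)
  have "g v = \<gamma> (v (int j))" using base v by auto
  moreover have "g ?v = \<gamma> (- v (int j))"
  proof -
    have "\<forall>r\<in>{1..n} - {j}. ?v (int r) = v (int r)"
      using refl_neg_apply[OF v assms(2)] by auto
    from base.prems(3)[OF v' this] show ?thesis using refl_neg_apply[OF v assms(2,2)]
      by (simp only: refl if_True)
  qed
  moreover have "v (int j) \<preceq> - v (int j) \<longleftrightarrow> 0 < v (int j)"
    using nz by (auto simp: letter_le_def letter_less_def)
  moreover have "between_count v (v (int j)) (v (int j)) {j<..n} = 0"
    unfolding between_count_def using letter_less_asym by (auto simp: card_eq_0_iff)
  ultimately show ?case
    using nz base unfolding tail_roots_n avail_n[OF v assms(2) base.prems(2)]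
    by (simp add: up_step_neg[OF v assms(2)])
next
  case (step k)
  note v = \<open>v \<in> signed_perms n\<close>
  define K where "K = Suc k"
  have jK: "1 \<le> j" "j < K" "K \<le> n" using step.hyps step.prems assms(2) by (auto simp: K_def)
  let ?x = "v (int K)" and ?c = "v (int j)"
  let ?v1 = "v \<circ> signed_refl (int j, int K)"
  let ?B = "avail n j k v"
  let ?m = "\<lambda>a b. between_count v a b {j<..k}"
  have v1: "?v1 \<in> signed_perms n"
    by (rule comp_refl_in_signed_perms[OF v swap_in_pos_roots[OF jK]])
  have v1_app: "?v1 (int r) = (if r = j then ?x else if r = K then ?c else v (int r))" if "1 \<le> r" for r
    by (rule refl_swap_apply[OF jK(1,2) that])
  have pos: "r \<in> {1..n}" if "r \<in> {1..K}" for r using that jK by auto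
  have inB: "?c \<in> ?B" "?x \<in> ?B" "- ?x \<in> ?B" "- ?c \<in> ?B"
  proof -
    have in_avail: "e \<in> ?B \<and> - e \<in> ?B" if "e = v (int l)" "l \<in> {j, K}" for e l
    proof -
      have "e \<in> letters n" using that signed_perms_in_letters[OF v, of l] jK by auto
      moreover have "e \<noteq> v (int r)" "e \<noteq> - v (int r)" if "r \<in> {1..k} - {j}" for r
        using signed_perms_inj_pos[OF v, of l r] that \<open>e = v (int l)\<close> \<open>l \<in> {j, K}\<close> jK
          by (auto simp: K_def)
      ultimately show ?thesis by (force simp: avail_def)
    qed
    show "?c \<in> ?B" "?x \<in> ?B" "- ?x \<in> ?B" "- ?c \<in> ?B"
      using in_avail[of ?c j] in_avail[of ?x K] by auto
  qed
  have xc: "?x \<noteq> ?c" "?x \<noteq> - ?c"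
    using signed_perms_inj_pos[OF v, of K j] jK by auto
  interpret letter_interval ?B ?m t
  proof
    show "finite ?B" by (simp add: avail_def)
    show B0: "0 \<notin> ?B" by (simp add: avail_def)
    show "- d \<in> ?B" if "d \<in> ?B" for d using that by (force simp: avail_def)
    fix a b e assume b: "b \<in> ?B" "a \<preceq> b" "b \<preceq> e"
    show "?m a e = ?m a b + ?m b e"
    proof (rule between_count_add[OF b(2,3)])
      show "b \<noteq> 0" using b(1) B0 by metis
      show "\<forall>i\<in>{j<..k}. v (int i) \<noteq> b \<and> v (int i) \<noteq> 0"
        using b(1) signed_perms_nonzero[OF v] step.hyps by (auto simp: avail_def)
    qed simp
  qed
  let ?g' = "up_step n t (int j, - int K) g"
  let ?G = "\<lambda>y d. \<gamma> d + (if d \<prec> - y then t ^ ex y d * (1 - t) * \<gamma> (- y) else 0)"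
  \<comment> \<open>With the entry \<open>y\<close> at \<open>K\<close> fixed, the function after
    the first root again depends on the entry at \<open>j\<close> alone; \<open>?G y\<close> is the
    \<open>\<gamma>\<close> for the induction hypothesis.\<close>
  have g': "?g' u = ?G y (u (int j))"
    if u: "u \<in> signed_perms n" "\<forall>r\<in>{1..k} - {j}. u (int r) = v (int r)" "u (int K) = y" for u y
  proof -
    let ?u = "u \<circ> signed_refl (int j, - int K)"
    have u': "?u \<in> signed_perms n"
      by (rule comp_refl_in_signed_perms[OF u(1) bar_in_pos_roots[OF jK]])
    have u_app: "?u (int r) = (if r = j then - y else if r = K then - u (int j) else u (int r))" if
      "1 \<le> r" for r
      using refl_bar_apply[OF u(1) jK(1,2) that] u(3) by simp
    have "g u = \<gamma> (u (int j))" using step.prems(3) u by auto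
    moreover have "g ?u = \<gamma> (- y)"
    proof -
      have "\<forall>r\<in>{1..k} - {j}. ?u (int r) = v (int r)"
        using u_app u(2) by (auto simp: K_def)
      from step.prems(3)[OF u' this] show ?thesis using u_app[OF jK(1)] by (simp only: refl if_True)
    qed
    moreover have "bar_count n ?u j K = ex y (u (int j))"
    proof -
      have "between_count ?u (u (int j)) (- y) {j<..<K} = ?m (u (int j)) (- y)"
        unfolding between_count_def using u_app u(2) jK
        by (intro arg_cong[of _ _ card]) (auto simp: K_def)
      moreover have "(\<forall>i\<in>{1..K}. e \<noteq> ?u (int i) \<and> e \<noteq> - ?u (int i)) \<longleftrightarrow>
        (\<forall>r\<in>{1..k} - {j}. e \<noteq> v (int r) \<and> e \<noteq> - v (int r)) \<and> e \<notin> {u (int j), - u (int j), y, - y}" for e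
      proof -
        have "{1..K} = ({1..k} - {j}) \<union> {j, K}" using jK by (auto simp: K_def)
        then have "(\<forall>i\<in>{1..K}. e \<noteq> ?u (int i) \<and> e \<noteq> - ?u (int i)) \<longleftrightarrow>
          (\<forall>i\<in>{1..k} - {j}. e \<noteq> ?u (int i) \<and> e \<noteq> - ?u (int i)) \<and>
            (e \<noteq> ?u (int j) \<and> e \<noteq> - ?u (int j)) \<and> (e \<noteq> ?u (int K) \<and> e \<noteq> - ?u (int K))"
          by blast
        moreover have "?u (int i) = v (int i)" if "i \<in> {1..k} - {j}" for i
          using u_app[of i] u(2) that by (auto simp: K_def)
        moreover have "?u (int j) = - y" "?u (int K) = - u (int j)"
          using u_app[of j] u_app[of K] jK by auto
        ultimately show ?thesis by auto
      qed
      then have "{e \<in> letters n. - ?u (int K) \<prec> e \<and> e \<prec> ?u (int j) \<and>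
          (\<forall>i\<in>{1..K}. e \<noteq> ?u (int i) \<and> e \<noteq> - ?u (int i))} =
        {e \<in> ?B. u (int j) \<prec> e \<and> e \<prec> - y \<and> e \<notin> {u (int j), - u (int j), y, - y}}"
        using u_app[of j] u_app[of K] jK by (auto simp: avail_def)
      ultimately show ?thesis
        unfolding bar_count_def ex_def using u_app[of j] u_app[of K] jK by auto
    qed
    ultimately show ?thesis
      unfolding up_step_bar[OF u(1) jK] u(3) by simp
  qed
  \<comment> \<open>Position \<open>K\<close> has moved from below the column into it, which adds
    the indicator that occurs in \<open>wt\<close>.\<close>
  have split: "between_count u a b {j<..K} = ?m a b + of_bool (a \<prec> z \<and> z \<prec> b)"
    if "\<forall>r\<in>{j<..k}. u (int r) = v (int r)" "u (int K) = z" for u a b z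
  proof -
    have K: "{j<..K} = insert K {j<..k}" using jK by (auto simp: K_def)
    have "{i \<in> {j<..K}. a \<prec> u (int i) \<and> u (int i) \<prec> b} =
      {i \<in> {j<..k}. a \<prec> v (int i) \<and> v (int i) \<prec> b} \<union> (if a \<prec> z \<and> z \<prec> b then {K} else {})"
      unfolding K using that by auto
    moreover have "K \<notin> {i \<in> {j<..k}. a \<prec> v (int i) \<and> v (int i) \<prec> b}" by (simp add: K_def)
    moreover have "finite {i \<in> {j<..k}. a \<prec> v (int i) \<and> v (int i) \<prec> b}" by simp
    ultimately show ?thesis unfolding between_count_def
      by (cases "a \<prec> z \<and> z \<prec> b") (simp_all only: if_True if_False Un_empty_right Un_insert_right
        card_insert_disjoint of_bool_eq Suc_eq_plus1 add_0_right simp_thms)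
  qed
  have IH: "up_steps n t (tail_roots n j K) ?g' u = (\<Sum>d\<in>?B - {y, - y}. wt (u (int j)) y d * ?G y d)"
    if u: "u \<in> signed_perms n" "\<forall>r\<in>{1..k} - {j}. u (int r) = v (int r)" "u (int K) = y" for u y
  proof -
    have "up_steps n t (tail_roots n j K) ?g' u = (\<Sum>d\<in>avail n j K u. if u (int j) \<preceq> d
      then t ^ between_count u (u (int j)) d {j<..K} * (if u (int j) = d then 1 else 1 - t) * ?G y d
        else 0)"
      unfolding K_def
    proof (rule step.IH[OF u(1)])
      show "j \<le> Suc k" using jK by (simp add: K_def)
      fix w assume w: "w \<in> signed_perms n" "\<forall>r\<in>{1..Suc k} - {j}. w (int r) = u (int r)"
      show "up_step n t (int j, - int (Suc k)) g w = ?G y (w (int j))"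
      proof -
        have "w (int K) = y" using bspec[OF w(2), of K] jK u(3) by (simp add: K_def)
        moreover have "\<forall>r\<in>{1..k} - {j}. w (int r) = v (int r)" using w(2) u(2) by simp
        ultimately show ?thesis using g'[OF w(1), of y] unfolding K_def by blast
      qed
    qed
    also have "avail n j K u = ?B - {y, - y}"
    proof -
      have "{1..K} - {j} = insert K ({1..k} - {j})" using jK by (auto simp: K_def)
      then show ?thesis using u(2,3) by (auto simp: avail_def)
    qed
    also have "(\<Sum>d\<in>?B - {y, - y}. if u (int j) \<preceq> d
      then t ^ between_count u (u (int j)) d {j<..K} * (if u (int j) = d then 1 else 1 - t) * ?G y d
        else 0) =
      (\<Sum>d\<in>?B - {y, - y}. wt (u (int j)) y d * ?G y d)"
    proof (rule sum.cong[OF refl])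
      fix d
      have "between_count u (u (int j)) d {j<..K} = ?m (u (int j)) d + of_bool (u (int j) \<prec> y \<and> y \<prec> d)"
        by (rule split) (use u jK in \<open>auto\<close>)
      then show "(if u (int j) \<preceq> d
        then t ^ between_count u (u (int j)) d {j<..K} * (if u (int j) = d then 1 else 1 - t) *
          ?G y d else 0) =
        wt (u (int j)) y d * ?G y d"
        unfolding wt_def by simp
    qed
    finally show ?thesis .
  qed
  have "up_steps n t (tail_roots n j k) g v = up_step n t (int j, int K) (up_steps n t (tail_roots n
    j K) ?g') v"
    using step.hyps by (simp add: tail_roots_Suc K_def)
  \<comment> \<open>The last root of the tail either leaves \<open>?c\<close> at \<open>j\<close>
    and \<open>?x\<close> at \<open>K\<close>, or exchanges them; the induction hypothesis applies
    in both situations.\<close>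
  also have "\<dots> = (\<Sum>d\<in>?B - {?x, - ?x}. wt ?c ?x d * ?G ?x d) +
    (if ?c \<prec> ?x then t ^ ?m ?c ?x * (1 - t) * (\<Sum>d\<in>?B - {?c, - ?c}. wt ?x ?c d * ?G ?c d) else 0)"
  proof -
    have "{j<..<K} = {j<..k}" by (auto simp: K_def)
    moreover have "up_steps n t (tail_roots n j K) ?g' ?v1 = (\<Sum>d\<in>?B - {?c, - ?c}. wt ?x ?c d * ?G ?c d)"
      using IH[OF v1, of ?c] v1_app[of j] v1_app[of K] v1_app jK by (auto simp: K_def)
    ultimately show ?thesis
      unfolding up_step_swap[OF v jK] using IH[OF v, of ?x] by simp
  qed
  also have "\<dots> = (\<Sum>d\<in>?B. if ?c \<preceq> d then t ^ ?m ?c d * (if ?c = d then 1 else 1 - t) * \<gamma> d else 0)"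
    by (rule sum_extend[OF inB(1,2) xc])
  finally show ?case .
qed

section \<open>Sequences of bar swaps in a column\<close>

lemma length_bar_swap [simp]: "length (bar_swap C r j) = length C"
  by (simp add: bar_swap_def)

lemma entry_bar_swap:
  assumes "1 \<le> r" "r < j" "j \<le> length C" "1 \<le> k"
  shows "entry (bar_swap C r j) k =
    (if k = r then - entry C j else if k = j then - entry C r else entry C k)"
  using assms unfolding bar_swap_def entry_def by (auto simp: nth_list_update)

lemma bar_swap_bar_swap:
  assumes "1 \<le> r" "r < j" "j \<le> length C"
  shows "bar_swap (bar_swap C r j) r j = C"
  using assms by (intro list_eq_entryI) (auto simp: entry_bar_swap)

lemma bar_swaps_Nil [simp]: "bar_swaps C j [] = C"
  by (simp add: bar_swaps_def)

lemma bar_swaps_snoc: "bar_swaps C j (rs @ [r]) = bar_swap (bar_swaps C j rs) r j"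
  by (simp add: bar_swaps_def)

lemma bar_swaps_Cons: "bar_swaps C j (r # rs) = bar_swaps (bar_swap C r j) j rs"
  by (simp add: bar_swaps_def)

lemma length_bar_swaps [simp]: "length (bar_swaps C j rs) = length C"
  by (induction rs rule: rev_induct) (auto simp: bar_swaps_snoc)

lemma N_swaps_snoc: "N_swaps n j D (rs @ [r]) = N_swaps n j D rs + N_swap n (bar_swaps D j rs) r j"
  by (induction rs arbitrary: D) (auto simp: bar_swaps_Cons)

lemma entry_bar_swaps_other:
  assumes "set rs \<subseteq> {1..<j}" "j \<le> length C" "1 \<le> k" "k \<notin> set rs" "k \<noteq> j"
  shows "entry (bar_swaps C j rs) k = entry C k"
  using assms by (induction rs rule: rev_induct) (auto simp: bar_swaps_snoc entry_bar_swap)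

definition signed_distinct :: "int list \<Rightarrow> bool" where
  "signed_distinct C \<longleftrightarrow> (\<forall>r\<in>{1..length C}. \<forall>s\<in>{1..length C}. r \<noteq> s \<longrightarrow>
     entry C r \<noteq> entry C s \<and> entry C r \<noteq> - entry C s)"

lemma signed_distinct_bar_swap:
  assumes "signed_distinct C" "1 \<le> r" "r < j" "j \<le> length C"
  shows "signed_distinct (bar_swap C r j)"
proof -
  have d: "entry C a \<noteq> entry C b \<and> entry C a \<noteq> - entry C b \<and> - entry C a \<noteq> entry C b"
    if "a \<in> {1..length C}" "b \<in> {1..length C}" "a \<noteq> b" for a b
    using assms(1) that unfolding signed_distinct_def by (metis minus_minus)
  have rj: "r \<in> {1..length C}" "j \<in> {1..length C}" using assms by auto
  have "entry (bar_swap C r j) a \<noteq> entry (bar_swap C r j) b \<and>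
      entry (bar_swap C r j) a \<noteq> - entry (bar_swap C r j) b"
    if ab: "a \<in> {1..length C}" "b \<in> {1..length C}" "a \<noteq> b" for a b
    using d[OF ab] d[OF ab(1) rj(1)] d[OF ab(1) rj(2)] d[OF rj(1) ab(2)] d[OF rj(2) ab(2)]
      d[OF rj(1) rj(2)] d[OF rj(2) rj(1)] ab assms(2,3)
    by (simp add: entry_bar_swap[OF assms(2-4)])
  then show ?thesis unfolding signed_distinct_def length_bar_swap by blast
qed

lemma signed_distinct_bar_swaps:
  assumes "signed_distinct C" "set rs \<subseteq> {1..<j}" "j \<le> length C"
  shows "signed_distinct (bar_swaps C j rs)"
  using assms by (induction rs rule: rev_induct) (auto simp: bar_swaps_snoc intro!:
    signed_distinct_bar_swap)

lemma increasing_below_snoc: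
  "increasing_below j (rs @ [r]) \<longleftrightarrow> increasing_below r rs \<and> 1 \<le> r \<and> r < j"
  unfolding increasing_below_def by (force simp: sorted_wrt_append)

lemma increasing_below_mono: "increasing_below i rs \<Longrightarrow> i \<le> j \<Longrightarrow> increasing_below j rs"
  unfolding increasing_below_def by auto

text \<open>Since \<open>rs\<close> increases, position \<open>r\<close> is touched once. It then
  receives the negative of the current entry at \<open>j\<close>, which differs from its own entry
  because no two entries agree up to sign.\<close>

lemma bar_swaps_differs:
  assumes "signed_distinct C" "increasing_below j rs" "j \<le> length C" "r \<in> set rs"
  shows "entry (bar_swaps C j rs) r \<noteq> entry C r"
  using assms(2,4)
proof (induction rs rule: rev_induct)
  case (snoc q rs)
  then have q: "increasing_below q rs" "1 \<le> q" "q < j" by (simp_all add: increasing_below_snoc)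
  then have rs: "increasing_below j rs" "set rs \<subseteq> {1..<j}" "q \<notin> set rs"
    using increasing_below_mono[of q rs j] by (auto simp: increasing_below_def)
  have len: "j \<le> length (bar_swaps C j rs)" using assms(3) by simp
  show ?case
  proof (cases "r = q")
    case True
    have "entry (bar_swaps C j rs) q \<noteq> - entry (bar_swaps C j rs) j"
      using signed_distinct_bar_swaps[OF assms(1) rs(2) assms(3)] q assms(3)
      unfolding signed_distinct_def by auto
    moreover have "entry (bar_swaps C j rs) q = entry C q"
      using rs q assms(3) by (intro entry_bar_swaps_other) auto
    ultimately show ?thesis using True q len by (simp add: bar_swaps_snoc entry_bar_swap)
  next
    case False
    then have r: "r \<in> set rs" using snoc by auto
    then have "1 \<le> r" "r \<noteq> j" using rs by auto
    then show ?thesis using snoc.IH[OF rs(1) r] False q len by (simp add: bar_swaps_snoc entry_bar_swap)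
  qed
qed simp

text \<open>The first swap leaves \<open>- entry C j\<close> in its position, and no later swap
  touches it. This blocks the original entry from returning to position \<open>j\<close>.\<close>

lemma bar_swaps_first_entry:
  assumes "increasing_below j rs" "j \<le> length C" "rs \<noteq> []"
  shows "\<exists>r\<in>{1..<j}. entry (bar_swaps C j rs) r = - entry C j"
proof -
  obtain q ss where rs: "rs = q # ss" using assms(3) by (cases rs) auto
  with assms have q: "set ss \<subseteq> {1..<j}" "1 \<le> q" "q < j" "q \<notin> set ss"
    by (auto simp: increasing_below_def)
  then have "entry (bar_swaps (bar_swap C q j) j ss) q = - entry C j"
    using assms by (subst entry_bar_swaps_other) (auto simp: entry_bar_swap)
  then show ?thesis using q assms(2) unfolding rs by (auto simp: bar_swaps_Cons)
qed

lemma increasing_below_unique: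
  "increasing_below j rs \<Longrightarrow> increasing_below j' rs' \<Longrightarrow> set rs = set rs' \<Longrightarrow> rs = rs'"
  unfolding increasing_below_def by (auto intro: strict_sorted_equal)

text \<open>The swapped positions can be read off from the result: they are the positions before
  \<open>j\<close> whose entries have changed.\<close>

lemma bar_swaps_eq_imp_rs_eq:
  assumes "signed_distinct C" "j \<le> length C" "increasing_below j rs" "increasing_below j rs'"
    and "\<And>r. r \<in> {1..<j} \<Longrightarrow> entry (bar_swaps C j rs) r = entry (bar_swaps C j rs') r"
  shows "rs = rs'"
proof -
  have mem: "r \<in> set ss \<longleftrightarrow> entry (bar_swaps C j ss) r \<noteq> entry C r"
    if "increasing_below j ss" "r \<in> {1..<j}" for ss r
  proof (cases "r \<in> set ss")
    case False
    have "set ss \<subseteq> {1..<j}" using that by (simp add: increasing_below_def)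
    from entry_bar_swaps_other[OF this assms(2), of r] False that(2) show ?thesis by simp
  qed (use bar_swaps_differs[OF assms(1) that(1) assms(2)] in blast)
  have "r \<in> set rs \<longleftrightarrow> r \<in> set rs'" if "r \<in> {1..<j}" for r
    unfolding mem[OF assms(3) that] mem[OF assms(4) that] assms(5)[OF that] ..
  moreover have "set rs \<subseteq> {1..<j}" "set rs' \<subseteq> {1..<j}" using assms(3,4)
    by (simp_all add: increasing_below_def)
  ultimately have "set rs = set rs'" by blast
  then show ?thesis using increasing_below_unique assms(3,4) by blast
qed

section \<open>Statistics of a pair of columns\<close>

text \<open>Every constructor of \<open>col_stat\<close> other than \<open>equal\<close> changes exactly the positions \<open>rs\<close> and \<open>j\<close>.\<close>

lemma change_positions:
  assumes D: "signed_distinct D" and j: "j \<in> {1..length D}" and rs: "increasing_below j rs"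
    and C: "agree_except j (bar_swaps D j rs) C" and le: "entry C j \<preceq> entry (bar_swaps D j rs) j"
    and ne: "rs \<noteq> [] \<or> entry C j \<prec> entry (bar_swaps D j rs) j"
  shows "{r \<in> {1..length D}. entry C r \<noteq> entry D r} = insert j (set rs)"
proof -
  have sub: "set rs \<subseteq> {1..<j}" using rs by (simp add: increasing_below_def)
  have jl: "j \<le> length D" using j by simp
  have other: "entry C r = entry (bar_swaps D j rs) r" if "r \<in> {1..length D} - {j}" for r
    using C that by (auto simp: agree_except_def)
  have "entry C j \<noteq> entry D j"
  proof (cases "rs = []")
    case True
    then show ?thesis using ne by auto
  next
    case False
    \<comment> \<open>Some entry above \<open>j\<close> is now the negative of
      \<open>entry D j\<close>, and \<open>agree_except\<close> forbids \<open>entry C j\<close> to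
      be the negative of that entry, hence to equal \<open>entry D j\<close>.\<close>
    then obtain r where r: "r \<in> {1..<j}" "entry (bar_swaps D j rs) r = - entry D j"
      using bar_swaps_first_entry[OF rs jl] by blast
    have "r \<in> {1..length (bar_swaps D j rs)} - {j}" using r jl by simp
    then have "entry C j \<noteq> - entry (bar_swaps D j rs) r" using C unfolding agree_except_def by blast
    then show ?thesis using r by simp
  qed
  moreover have "entry C r \<noteq> entry D r" if "r \<in> set rs" for r
    using bar_swaps_differs[OF D rs jl that] other[of r] that sub jl by auto
  moreover have "entry C r = entry D r" if "r \<in> {1..length D}" "r \<noteq> j" "r \<notin> set rs" for r
    using entry_bar_swaps_other[OF sub jl, of r] other[of r] that by auto
  ultimately show ?thesis using sub j by auto
qed

text \<open>One formula for every case of \<open>col_stat\<close>: if the entry at \<open>j\<close>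
  is not lowered after the swaps, \<open>N_between\<close> is taken over an empty interval and the
  last summand of the second component is 0.\<close>

definition stat_data :: "nat \<Rightarrow> int list \<Rightarrow> int list \<Rightarrow> nat \<Rightarrow> nat list \<Rightarrow> nat \<times> nat" where
  "stat_data n D C j rs = (let D' = bar_swaps D j rs in
     (N_swaps n j D rs + N_between (entry C j) (entry D' j) (subword D (j + 1) (length D)),
      length rs + (if entry C j = entry D' j then 0 else 1)))"

lemma N_between_same [simp]: "N_between a a C = 0"
  using letter_less_asym by (auto simp: N_between_def)

lemma agree_except_bar_swaps:
  assumes "signed_distinct D" "set rs \<subseteq> {1..<j}" "j \<in> {1..length D}"
  shows "agree_except j (bar_swaps D j rs) (bar_swaps D j rs)"
  using signed_distinct_bar_swaps[OF assms(1,2)] assms(3)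
  unfolding agree_except_def signed_distinct_def by auto

lemma col_stat_data:
  assumes D: "signed_distinct D" and "col_stat n D C N d" "C \<noteq> D"
  shows "\<exists>j rs. j \<in> {1..length D} \<and> increasing_below j rs \<and>
    {r \<in> {1..length D}. entry C r \<noteq> entry D r} = insert j (set rs) \<and> (N, d) = stat_data n D C j rs"
  using assms(2)
proof cases
  case equal
  then show ?thesis using assms(3) by simp
next
  case (swaps j rs)
  then have sub: "set rs \<subseteq> {1..<j}" by (simp add: increasing_below_def)
  with swaps have j: "j \<in> {1..length D}" by (cases rs) auto
  have "{r \<in> {1..length D}. entry C r \<noteq> entry D r} = insert j (set rs)"
    using change_positions[OF D j, of rs C] agree_except_bar_swaps[OF D sub j] swaps by auto
  moreover have "(N, d) = stat_data n D C j rs" using swaps by (simp add: stat_data_def Let_def)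
  ultimately show ?thesis using swaps(5) j by blast
next
  case (change j rs D')
  have "{r \<in> {1..length D}. entry C r \<noteq> entry D r} = insert j (set rs)"
    using change by (intro change_positions[OF D]) (simp_all add: letter_le_def)
  moreover have "entry C j \<noteq> entry D' j" using change by auto
  then have "(N, d) = stat_data n D C j rs" using change by (simp add: stat_data_def Let_def)
  ultimately show ?thesis using change by blast
qed

text \<open>All members of \<open>rs\<close> are less than \<open>j\<close>, so \<open>j\<close> is
  the maximum of the set of changed positions and the others form \<open>rs\<close>.\<close>

lemma increasing_below_insert_unique:
  assumes "increasing_below j rs" "increasing_below j' rs'" "insert j (set rs) = insert j' (set rs')"
  shows "j = j' \<and> rs = rs'"
proof -
  have "j = Max (insert j (set rs))" if "increasing_below j rs" for j rs
    using that by (intro Max_eqI[symmetric]) (auto simp: increasing_below_def)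
  from this[OF assms(1)] this[OF assms(2)] assms(3) have "j = j'" by simp
  moreover have "set rs = insert j (set rs) - {j}" "set rs' = insert j' (set rs') - {j'}"
    using assms(1,2) by (auto simp: increasing_below_def)
  ultimately have "set rs = set rs'" using assms(3) by metis
  then show ?thesis using \<open>j = j'\<close> increasing_below_unique assms(1,2) by blast
qed

text \<open>Justifies the definite descriptions in \<open>N_col\<close> and \<open>des_col\<close>.
  For different columns the changed positions determine the data; for equal columns the constructors
  \<open>swaps\<close> and \<open>change\<close> would force a change that is not there.\<close>

lemma col_stat_unique:
  assumes D: "signed_distinct D" and "col_stat n D C N d" "col_stat n D C N' d'"
  shows "N = N' \<and> d = d'"
proof (cases "C = D")
  case True
  have False if "col_stat n D D N d" "N \<noteq> 0 \<or> d \<noteq> 0" for N d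
    using that(1)
  proof cases
    case (swaps j rs)
    then have sub: "set rs \<subseteq> {1..<j}" by (simp add: increasing_below_def)
    with swaps have j: "j \<in> {1..length D}" by (cases rs) auto
    show False
      using change_positions[OF D j, of rs D] agree_except_bar_swaps[OF D sub j] swaps by auto
  next
    case (change j rs D')
    have "{r \<in> {1..length D}. entry D r \<noteq> entry D r} = insert j (set rs)"
      using change by (intro change_positions[OF D]) (simp_all add: letter_le_def)
    then show False by simp
  qed (use that in auto)
  with True assms show ?thesis by metis
next
  case False
  from col_stat_data[OF D assms(2) False] col_stat_data[OF D assms(3) False]
  obtain j rs j' rs' where *: "increasing_below j rs" "increasing_below j' rs'"
    "insert j (set rs) = insert j' (set rs')" "(N, d) = stat_data n D C j rs" "(N', d') =
      stat_data n D C j' rs'"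
    by metis
  with increasing_below_insert_unique[OF *(1-3)] show ?thesis by (metis prod.inject)
qed

lemma N_des_col:
  assumes D: "signed_distinct D" and j: "j \<in> {1..length D}" and rs: "increasing_below j rs"
    and ge: "column_ge D (take (length D) C)"
    and C: "agree_except j (bar_swaps D j rs) (take (length D) C)"
    and le: "entry (take (length D) C) j \<preceq> entry (bar_swaps D j rs) j"
  shows "(N_col n D C, des_col n D C) = stat_data n D (take (length D) C) j rs"
proof -
  let ?C = "take (length D) C"
  obtain N d where Nd: "stat_data n D ?C j rs = (N, d)" by (cases "stat_data n D ?C j rs")
  have "col_stat n D ?C N d"
  proof (cases "entry ?C j = entry (bar_swaps D j rs) j")
    case True
    have eq: "?C = bar_swaps D j rs"
      using C True by (intro list_eq_entryI) (auto simp: agree_except_def)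
    show ?thesis
    proof (cases "rs = []")
      case True
      then have "N = 0" "d = 0" "?C = D" using Nd eq by (auto simp: stat_data_def)
      then show ?thesis by (metis col_stat.equal)
    next
      case False
      then have "N = N_swaps n j D rs" "d = length rs" using Nd True by (auto simp: stat_data_def)
      then show ?thesis using col_stat.swaps[OF ge _ rs False eq] j by simp
    qed
  next
    case False
    then have "entry ?C j \<prec> entry (bar_swaps D j rs) j" using le by (auto simp: letter_le_def)
    from col_stat.change[OF ge j rs refl C this, of n] show ?thesis
      using Nd False by (auto simp: stat_data_def Let_def)
  qed
  then have "N_col n D C = N" "des_col n D C = d"
    unfolding N_col_def des_col_def using col_stat_unique[OF D] by (blast intro: the_equality)+
  then show ?thesis using Nd by simp
qed

section \<open>Summation over one factor with prescribed left column\<close>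

lemma window_bar_swap:
  assumes "u \<in> signed_perms n" "1 \<le> r" "r < j" "j \<le> h"
  shows "window h (u \<circ> signed_refl (int r, - int j)) = bar_swap (window h u) r j"
  unfolding window_eq_iff using refl_bar_apply[OF assms(1-3)] assms by (auto simp: entry_bar_swap)

lemma N_between_subword:
  assumes "1 \<le> i"
  shows "N_between a b (subword C i j) = card {k \<in> {i..j}. a \<prec> entry C k \<and> entry C k \<prec> b}"
proof -
  have e: "entry (subword C i j) k = entry C (i + k - 1)" if "1 \<le> k" "k \<le> Suc j - i" for k
    using that unfolding subword_def by (subst entry_def, subst nth_map) (auto simp del: upt_Suc)
  have "{k \<in> {i..j}. a \<prec> entry C k \<and> entry C k \<prec> b} =
    (\<lambda>k. i + k - 1) ` {k \<in> {1..length (subword C i j)}. a \<prec> entry (subword C i j) k \<and>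
      entry (subword C i j) k \<prec> b}"
    (is "?A = ?f ` ?B")
  proof
    show "?A \<subseteq> ?f ` ?B"
    proof
      fix k assume k: "k \<in> ?A"
      then have "k = ?f (Suc k - i)" by auto
      moreover have "Suc k - i \<in> ?B"
        using k assms e[of "Suc k - i"] by (auto simp: subword_def simp del: upt_Suc)
      ultimately show "k \<in> ?f ` ?B" by blast
    qed
    show "?f ` ?B \<subseteq> ?A" using e by (auto simp: subword_def simp del: upt_Suc)
  qed
  moreover have "inj_on ?f ?B" using assms by (auto simp: inj_on_def)
  ultimately show ?thesis unfolding N_between_def by (simp add: card_image)
qed

lemma N_swap_window:
  assumes "1 \<le> r" "r < j" "j \<le> h"
  shows "N_swap n (window h u) r j = bar_count n u r j"
proof -
  have "{k \<in> {r + 1..j - 1}. - u (int j) \<prec> entry (window h u) k \<and> entry (window h u) k \<prec> u (int r)} =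
    {k \<in> {r<..<j}. - u (int j) \<prec> u (int k) \<and> u (int k) \<prec> u (int r)}"
    using assms by auto
  moreover have "{e \<in> letters n. - u (int j) \<prec> e \<and> e \<prec> u (int r)} -
      (\<Union>i\<in>{1..j}. {entry (window h u) i, - entry (window h u) i}) =
    {e \<in> letters n. - u (int j) \<prec> e \<and> e \<prec> u (int r) \<and> (\<forall>i\<in>{1..j}. e \<noteq> u (int i) \<and> e \<noteq> - u (int i))}"
    using assms by auto
  ultimately show ?thesis
    using assms by (simp add: N_swap_def N_between_subword bar_count_def between_count_def Let_def)
qed

lemma entry_in_set: "1 \<le> k \<Longrightarrow> k \<le> length C \<Longrightarrow> entry C k \<in> set C"
  by (simp add: entry_def)

lemma set_bar_swap_letters:
  assumes "set C \<subseteq> letters n" "1 \<le> r" "r < j" "j \<le> length C"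
  shows "set (bar_swap C r j) \<subseteq> letters n"
proof -
  have "- entry C j \<in> letters n" "- entry C r \<in> letters n"
    using entry_in_set[of j C] entry_in_set[of r C] assms by auto
  moreover have "set (bar_swap C r j) \<subseteq> insert (- entry C r) (insert (- entry C j) (set C))"
    unfolding bar_swap_def using set_update_subset_insert by (metis insert_mono order_trans)
  ultimately show ?thesis using assms(1) by blast
qed

lemma set_bar_swaps_letters:
  assumes "set C \<subseteq> letters n" "set rs \<subseteq> {1..<j}" "j \<le> length C"
  shows "set (bar_swaps C j rs) \<subseteq> letters n"
  using assms(2)
proof (induction rs rule: rev_induct)
  case (snoc r rs)
  then show ?case unfolding bar_swaps_snoc using assms(3) by (intro set_bar_swap_letters) auto
qed (use assms in simp)

text \<open>There is at most one path from \<open>D\<close> to the column of \<open>v\<close>. The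
  entry at the last position \<open>Q\<close> decides whether its root is used: swaps at earlier
  positions leave the original entry at \<open>Q\<close>, which must be found at \<open>Q\<close>
  itself or, with sign, at \<open>j\<close>. These two values differ, so one branch of
  \<open>up_step_bar\<close> vanishes by the first claim. The row condition in the second claim
  makes the surviving step a descent.\<close>

lemma up_steps_bars:
  fixes t :: "'a::comm_ring_1"
  assumes g: "\<And>u. u \<in> signed_perms n \<Longrightarrow> g u = (if window h u = D then \<kappa> else 0)"
    and h: "j \<le> h" "h \<le> n" "length D = h" and q: "q < j" and v: "v \<in> signed_perms n"
  shows "(\<forall>rs. increasing_below (Suc q) rs \<longrightarrow> window h v \<noteq> bar_swaps D j rs) \<Longrightarrow>
      up_steps n t (map (\<lambda>r. (int r, - int j)) [1..<Suc q]) g v = 0"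
    and "increasing_below (Suc q) rs \<Longrightarrow> window h v = bar_swaps D j rs \<Longrightarrow>
      \<forall>r\<in>set rs. v (int r) \<preceq> entry D r \<Longrightarrow>
      up_steps n t (map (\<lambda>r. (int r, - int j)) [1..<Suc q]) g v =
        t ^ N_swaps n j D rs * (1 - t) ^ length rs * \<kappa>"
  using q v
proof (induction q arbitrary: v rs)
  case 0
  have e: "increasing_below (Suc 0) rs \<longleftrightarrow> rs = []" for rs by (auto simp: increasing_below_def)
  { case 1 then show ?case using g by (simp add: e) }
  { case 2 then show ?case using g by (simp add: e) }
next
  case (Suc q)
  define Q where "Q = Suc q"
  let ?F = "\<lambda>m. up_steps n t (map (\<lambda>r. (int r, - int j)) [1..<Suc m]) g"
  let ?\<beta> = "(int Q, - int j)"
  have upt: "[1..<Suc (Suc q)] = [1..<Suc q] @ [Suc q]" by simp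
  have F: "?F (Suc q) = up_step n t ?\<beta> (?F q)"
    unfolding upt by (simp add: Q_def del: upt_Suc)
  have below: "increasing_below (Suc q) rs \<Longrightarrow> set rs \<subseteq> {1..<j} \<and> Q \<notin> set rs" if "Suc q < j" for rs
    using that by (auto simp: increasing_below_def Q_def)
  have common: "v \<circ> signed_refl ?\<beta> \<in> signed_perms n"
    "window h (v \<circ> signed_refl ?\<beta>) = bar_swap (window h v) Q j"
    "bar_swap (bar_swap (window h v) Q j) Q j = window h v"
    "?F (Suc q) v = ?F q v + (if v (int Q) \<prec> - v (int j)
      then t ^ bar_count n (v \<circ> signed_refl ?\<beta>) Q j * (1 - t) * ?F q (v \<circ> signed_refl ?\<beta>) else 0)"
    "v (int Q) \<noteq> - v (int j)" "1 \<le> Q" "Q < j" "q < j"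
    if v: "v \<in> signed_perms n" and Qj: "Suc q < j" for v
  proof -
    have Q: "1 \<le> Q" "Q < j" "j \<le> n" using Qj h by (auto simp: Q_def)
    show "v \<circ> signed_refl ?\<beta> \<in> signed_perms n"
      by (rule comp_refl_in_signed_perms[OF v bar_in_pos_roots[OF Q]])
    show "window h (v \<circ> signed_refl ?\<beta>) = bar_swap (window h v) Q j"
      by (rule window_bar_swap[OF v Q(1,2) h(1)])
    show "bar_swap (bar_swap (window h v) Q j) Q j = window h v"
      by (rule bar_swap_bar_swap[OF Q(1,2)]) (use h in simp)
    show "?F (Suc q) v = ?F q v + (if v (int Q) \<prec> - v (int j)
      then t ^ bar_count n (v \<circ> signed_refl ?\<beta>) Q j * (1 - t) * ?F q (v \<circ> signed_refl ?\<beta>) else 0)"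
      unfolding F up_step_bar[OF v Q] ..
    show "v (int Q) \<noteq> - v (int j)" using signed_perms_inj_pos[OF v, of Q j] Q by auto
  qed (use Qj in \<open>auto simp: Q_def\<close>)
  {
    case 1
    note c = common[OF 1(3) 1(2)[unfolded Q_def]]
    have "?F q v = 0"
    proof (rule Suc.IH(1))
      show "\<forall>rs. increasing_below (Suc q) rs \<longrightarrow> window h v \<noteq> bar_swaps D j rs"
        using 1(1) increasing_below_mono[of "Suc q" _ "Suc (Suc q)"] by auto
    qed (use 1 c in auto)
    moreover have "?F q (v \<circ> signed_refl ?\<beta>) = 0"
    proof (rule Suc.IH(1))
      show "\<forall>rs. increasing_below (Suc q) rs \<longrightarrow> window h (v \<circ> signed_refl ?\<beta>) \<noteq> bar_swaps D j rs"
      proof (intro allI impI notI)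
        fix rs assume rs: "increasing_below (Suc q) rs" "window h (v \<circ> signed_refl ?\<beta>) =
          bar_swaps D j rs"
        have "window h v = bar_swaps D j (rs @ [Q])"
          unfolding bar_swaps_snoc rs(2)[symmetric] c(2) c(3) ..
        moreover have "increasing_below (Suc (Suc q)) (rs @ [Q])"
          using rs(1) unfolding increasing_below_snoc by (simp add: Q_def)
        ultimately show False using 1(1) by blast
      qed
    qed (rule c)+
    ultimately show ?case unfolding c(4) by simp
  next
    case 2
    note c = common[OF 2(5) 2(4)[unfolded Q_def]]
    have Qh: "1 \<le> Q" "Q \<le> h" using c h by auto
    \<comment> \<open>The test for the branch: whichever element precedes the root at
      \<open>Q\<close> must still show the entry of \<open>D\<close> there.\<close>
    have wQ: "entry (bar_swaps D j ss) Q = entry D Q" if "increasing_below (Suc q) ss" for ss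
      using below[OF 2(4) that] c h by (intro entry_bar_swaps_other) auto
    show ?case
    proof (cases "increasing_below (Suc q) rs")
      case True
      have vQ: "v (int Q) = entry D Q"
        using wQ[OF True] 2(2) Qh by (metis entry_window)
      have "?F q (v \<circ> signed_refl ?\<beta>) = 0"
      proof (rule Suc.IH(1))
        show "\<forall>rs. increasing_below (Suc q) rs \<longrightarrow> window h (v \<circ> signed_refl ?\<beta>) \<noteq> bar_swaps D j rs"
        proof (intro allI impI notI)
          fix ss assume "increasing_below (Suc q) ss" "window h (v \<circ> signed_refl ?\<beta>) = bar_swaps D j ss"
          then have "entry (bar_swap (window h v) Q j) Q = entry D Q" using wQ c(2) by metis
          then have "- v (int j) = entry D Q" using Qh c h by (simp add: entry_bar_swap)
          then show False using vQ c(5) by simp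
        qed
      qed (rule c)+
      moreover have "?F q v = t ^ N_swaps n j D rs * (1 - t) ^ length rs * \<kappa>"
        using Suc.IH(2)[OF True 2(2,3) c(8) 2(5)] .
      ultimately show ?thesis unfolding c(4) by simp
    next
      case False
      then have "rs \<noteq> []" by (auto simp: increasing_below_def)
      then obtain ss p where rs: "rs = ss @ [p]" by (metis rev_exhaust)
      then have p: "increasing_below p ss" "1 \<le> p" "p < Suc Q" using 2(1)
        by (simp_all add: increasing_below_snoc Q_def)
      moreover have "\<not> p < Q" using False p unfolding rs increasing_below_snoc by (simp add: Q_def)
      ultimately have pQ: "p = Q" by simp
      have ss: "increasing_below (Suc q) ss" using p(1) pQ by (simp add: Q_def)
      have w: "window h (v \<circ> signed_refl ?\<beta>) = bar_swaps D j ss"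
      proof -
        have "window h v = bar_swap (bar_swaps D j ss) Q j"
          using 2(2) unfolding rs pQ bar_swaps_snoc .
        then show ?thesis unfolding c(2) using bar_swap_bar_swap[of Q j "bar_swaps D j ss"] c h by simp
      qed
      have vj: "- v (int j) = entry D Q"
      proof -
        have "entry (window h (v \<circ> signed_refl ?\<beta>)) Q = entry D Q" unfolding w by (rule wQ[OF ss])
        then show ?thesis unfolding c(2) using Qh c h by (simp add: entry_bar_swap)
      qed
      have "v (int Q) \<preceq> entry D Q" using 2(3) unfolding rs pQ by simp
      then have less: "v (int Q) \<prec> - v (int j)" unfolding vj[symmetric] using c(5)
        by (simp add: letter_le_def)
      have "?F q v = 0"
      proof (rule Suc.IH(1))
        show "\<forall>rs. increasing_below (Suc q) rs \<longrightarrow> window h v \<noteq> bar_swaps D j rs"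
        proof (intro allI impI notI)
          fix us assume "increasing_below (Suc q) us" "window h v = bar_swaps D j us"
          then have "v (int Q) = entry D Q" using wQ Qh by (metis entry_window)
          then show False using vj c(5) by simp
        qed
      qed (use 2 c in auto)
      moreover have "?F q (v \<circ> signed_refl ?\<beta>) = t ^ N_swaps n j D ss * (1 - t) ^ length ss * \<kappa>"
      proof (rule Suc.IH(2)[OF ss w _ c(8) c(1)])
        show "\<forall>r\<in>set ss. (v \<circ> signed_refl ?\<beta>) (int r) \<preceq> entry D r"
        proof
          fix r assume r: "r \<in> set ss"
          then have "1 \<le> r" "r \<noteq> Q" "r \<noteq> j" using below[OF 2(4) ss] by auto
          then show "(v \<circ> signed_refl ?\<beta>) (int r) \<preceq> entry D r"
            using refl_bar_apply[OF 2(5) c(6,7), of r] 2(3) r unfolding rs by simp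
        qed
      qed
      moreover have "N_swaps n j D rs = N_swaps n j D ss + bar_count n (v \<circ> signed_refl ?\<beta>) Q j"
        unfolding rs N_swaps_snoc pQ w[symmetric] using N_swap_window[OF c(6,7) h(1)] by simp
      ultimately show ?thesis unfolding c(4) using less by (simp add: rs power_add mult_ac)
    qed
  }
qed

lemma up_steps_Gamma_primed:
  fixes t :: "'a::comm_ring_1"
  assumes g: "\<And>u. u \<in> signed_perms n \<Longrightarrow> g u = (if window h u = D then \<kappa> else 0)"
    and h: "1 \<le> j" "j \<le> h" "h \<le> n" "length D = h" and v: "v \<in> signed_perms n"
  shows "(\<forall>rs. increasing_below j rs \<longrightarrow> window h v \<noteq> bar_swaps D j rs) \<Longrightarrow>
      up_steps n t (Gamma_primed j) g v = 0"
    and "increasing_below j rs \<Longrightarrow> window h v = bar_swaps D j rs \<Longrightarrow>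
      \<forall>r\<in>set rs. v (int r) \<preceq> entry D r \<Longrightarrow>
      up_steps n t (Gamma_primed j) g v = t ^ N_swaps n j D rs * (1 - t) ^ length rs * \<kappa>"
proof -
  have "Suc (j - 1) = j" "j - 1 < j" using h by auto
  then show "(\<forall>rs. increasing_below j rs \<longrightarrow> window h v \<noteq> bar_swaps D j rs) \<Longrightarrow>
      up_steps n t (Gamma_primed j) g v = 0"
    "increasing_below j rs \<Longrightarrow> window h v = bar_swaps D j rs \<Longrightarrow>
      \<forall>r\<in>set rs. v (int r) \<preceq> entry D r \<Longrightarrow>
      up_steps n t (Gamma_primed j) g v = t ^ N_swaps n j D rs * (1 - t) ^ length rs * \<kappa>"
    using up_steps_bars[OF g h(2-4), of "j - 1" v] v unfolding Gamma_primed_def by simp_all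
qed

text \<open>Once the other entries are fixed, the weights after the swaps form a multiple of the
  indicator of one value at \<open>j\<close>. Hence the sum produced by the tail has a single
  nonzero term, which gives the last two ingredients of \<open>stat_data\<close>.\<close>

lemma up_steps_Gamma_plain:
  fixes t :: "'a::comm_ring_1"
  assumes g: "\<And>u. u \<in> signed_perms n \<Longrightarrow> g u = (if window k u = D then \<kappa> else 0)"
    and h: "1 \<le> j" "j \<le> k" "k \<le> n" and v: "v \<in> signed_perms n"
    and D: "signed_distinct D" "length D = k" "set D \<subseteq> letters n"
    and rs: "increasing_below j rs" and C: "window k v = C"
    and agree: "agree_except j (bar_swaps D j rs) C" and le: "entry C j \<preceq> entry (bar_swaps D j rs) j"
    and rows: "\<forall>r\<in>set rs. entry C r \<preceq> entry D r"
  shows "up_steps n t (Gamma_plain n j k) g v =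
    t ^ fst (stat_data n D C j rs) * (1 - t) ^ snd (stat_data n D C j rs) * \<kappa>"
proof -
  let ?D = "bar_swaps D j rs" and ?c = "v (int j)"
  define K where "K = t ^ N_swaps n j D rs * (1 - t) ^ length rs * \<kappa>"
  let ?\<gamma> = "\<lambda>d. if d = entry ?D j then K else 0"
  have sub: "set rs \<subseteq> {1..<j}" using rs by (simp add: increasing_below_def)
  have vC: "v (int r) = entry C r" if "r \<in> {1..k}" for r using C that by auto
  have vD: "v (int r) = entry ?D r" if "r \<in> {1..k} - {j}" for r
    using agree that vC[of r] D by (auto simp: agree_except_def)
  have jk: "j \<in> {1..k}" using h by simp
  have "up_steps n t (Gamma_plain n j k) g v = up_steps n t (tail_roots n j k) (up_steps n t
    (Gamma_primed j) g) v"
    by (simp add: Gamma_plain_eq)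
  also have "\<dots> = (\<Sum>d\<in>avail n j k v. if ?c \<preceq> d
      then t ^ between_count v ?c d {j<..k} * (if ?c = d then 1 else 1 - t) * ?\<gamma> d else 0)"
  proof (rule up_steps_tail_roots[OF v h])
    fix u assume u: "u \<in> signed_perms n" "\<forall>r\<in>{1..k} - {j}. u (int r) = v (int r)"
    have uD: "u (int r) = entry ?D r" if "r \<in> {1..k} - {j}" for r using u(2) vD that by simp
    show "up_steps n t (Gamma_primed j) g u = ?\<gamma> (u (int j))"
    proof (cases "u (int j) = entry ?D j")
      case True
      have "window k u = ?D"
        unfolding window_eq_iff using uD True D(2) by (metis Diff_iff length_bar_swaps singletonD)
      moreover have "\<forall>r\<in>set rs. u (int r) \<preceq> entry D r"
      proof
        fix r assume r: "r \<in> set rs"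
        then have "r \<in> {1..k} - {j}" using sub h by auto
        then show "u (int r) \<preceq> entry D r" using u(2) vC[of r] rows r by auto
      qed
      ultimately show ?thesis
        using up_steps_Gamma_primed(2)[OF g h D(2) u(1) rs] True by (simp add: K_def)
    next
      case False
      have "up_steps n t (Gamma_primed j) g u = 0"
      proof (rule up_steps_Gamma_primed(1)[OF g h D(2) u(1)], safe)
        \<comment> \<open>Another sequence of swaps would have to change the same positions before
          \<open>j\<close>, hence coincide with \<open>rs\<close>; but then the entry at
          \<open>j\<close> would be the excluded one.\<close>
        fix ss assume ss: "increasing_below j ss" "window k u = bar_swaps D j ss"
        have "entry ?D r = entry (bar_swaps D j ss) r" if "r \<in> {1..<j}" for r
          using uD[of r] ss(2)[symmetric] that h by auto
        then have "rs = ss"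
          by (intro bar_swaps_eq_imp_rs_eq[OF D(1) _ rs ss(1)]) (use h D in auto)
        then have "u (int j) = entry ?D j" using ss(2)[symmetric] h by simp
        then show False using False by simp
      qed
      then show ?thesis using False by simp
    qed
  qed
  also have "\<dots> = t ^ between_count v ?c (entry ?D j) {j<..k} * (if ?c = entry ?D j then 1
    else 1 - t) * K"
  proof -
    have "entry ?D j \<in> avail n j k v"
    proof -
      have dist: "signed_distinct ?D" using signed_distinct_bar_swaps[OF D(1) sub] h D by simp
      have "entry ?D j \<in> letters n"
        using set_bar_swaps_letters[OF D(3) sub] entry_in_set[of j ?D] h D by auto
      moreover have "entry ?D j \<noteq> v (int r) \<and> entry ?D j \<noteq> - v (int r)" if "r \<in> {1..k} - {j}" for r
        using dist that vD[OF that] h D jk unfolding signed_distinct_def by auto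
      ultimately show ?thesis unfolding avail_def by blast
    qed
    moreover have "finite (avail n j k v)" by (simp add: avail_def)
    moreover have "?c \<preceq> entry ?D j" using le vC[OF jk] by simp
    ultimately show ?thesis
      by (subst sum.mono_neutral_right[of _ "{entry ?D j}"]) auto
  qed
  also have "between_count v ?c (entry ?D j) {j<..k} =
    N_between (entry C j) (entry ?D j) (subword D (j + 1) (length D))"
  proof -
    have "v (int i) = entry D i" if "i \<in> {j<..k}" for i
    proof -
      have "v (int i) = entry ?D i" using that h by (intro vD) auto
      also have "\<dots> = entry D i" using that h D sub by (intro entry_bar_swaps_other) auto
      finally show ?thesis .
    qed
    then have "{i \<in> {j<..k}. ?c \<prec> v (int i) \<and> v (int i) \<prec> entry ?D j} =
      {i \<in> {j + 1..k}. entry C j \<prec> entry D i \<and> entry D i \<prec> entry ?D j}"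
      using vC[OF jk] by auto
    then show ?thesis
      by (simp add: between_count_def N_between_subword D)
  qed
  finally show ?thesis
    using vC[OF jk] by (simp add: stat_data_def Let_def K_def power_add mult_ac)
qed

section \<open>The part of the chain after the last column\<close>

text \<open>Summation by parts: substituting \<open>v \<circ> signed_refl \<beta>\<close> for
  \<open>v\<close> in the terms that use the root moves the operator from \<open>g\<close> to the
  weight \<open>G\<close>, and \<open>G'\<close> is the result.\<close>

lemma sum_up_step_adjoint:
  fixes t :: "'a::comm_ring_1"
  assumes \<beta>: "\<beta> \<in> pos_roots n"
    and G: "\<And>u. u \<in> signed_perms n \<Longrightarrow> G' u = G u + (if ell n (u \<circ> signed_refl \<beta>) < ell n u
      then t ^ gap n u (u \<circ> signed_refl \<beta>) * (1 - t) * G (u \<circ> signed_refl \<beta>) else 0)"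
  shows "(\<Sum>v\<in>signed_perms n. G v * up_step n t \<beta> g v) = (\<Sum>v\<in>signed_perms n. G' v * g v)"
proof -
  let ?r = "\<lambda>v. v \<circ> signed_refl \<beta>"
  let ?k = "\<lambda>u v. if ell n v < ell n u then t ^ gap n u v * (1 - t) else 0"
  have "(\<Sum>v\<in>signed_perms n. G v * up_step n t \<beta> g v) =
    (\<Sum>v\<in>signed_perms n. G v * g v) + (\<Sum>v\<in>signed_perms n. ?k (?r v) v * G v * g (?r v))"
    unfolding sum.distrib[symmetric] up_step_def by (intro sum.cong) (auto simp: algebra_simps)
  also have "(\<Sum>v\<in>signed_perms n. ?k (?r v) v * G v * g (?r v)) =
    (\<Sum>u\<in>signed_perms n. ?k u (?r u) * G (?r u) * g u)"
    by (rule sum.reindex_bij_witness[of _ ?r ?r])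
      (simp_all only: comp_refl_refl[OF \<beta>] comp_refl_in_signed_perms[OF _ \<beta>])
  also have "(\<Sum>v\<in>signed_perms n. G v * g v) + \<dots> = (\<Sum>v\<in>signed_perms n. G' v * g v)"
    unfolding sum.distrib[symmetric] using G by (intro sum.cong) (auto simp: algebra_simps)
  finally show ?thesis .
qed

text \<open>The pairs that precede \<open>(r, j)\<close> when the roots \<open>(k, -l)\<close>,
  \<open>k \<le> l\<close>, are ordered as in the factors of full height: first by \<open>l\<close>,
  then by \<open>k\<close>.\<close>

abbreviation before :: "nat \<Rightarrow> nat \<Rightarrow> nat \<Rightarrow> nat \<Rightarrow> bool" where
  "before j r \<equiv> \<lambda>k l. l < j \<or> l = j \<and> k < r"

lemma stat_before_Suc:
  assumes "1 \<le> r" "r \<le> j" "j \<le> n"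
  shows "stat n (before j (Suc r)) v = stat n (before j r) v + of_bool (- v (int j) \<prec> v (int r))"
proof -
  let ?A = "{(k, l). 1 \<le> k \<and> k \<le> l \<and> l \<le> n \<and> before j r k l \<and> - v (int l) \<prec> v (int k)}"
  have "{(k, l). 1 \<le> k \<and> k \<le> l \<and> l \<le> n \<and> before j (Suc r) k l \<and> - v (int l) \<prec> v (int k)} =
    (if - v (int j) \<prec> v (int r) then insert (r, j) ?A else ?A)"
    using assms by (auto simp: less_Suc_eq)
  moreover have "(r, j) \<notin> ?A" by simp
  moreover have "finite ?A" by (rule finite_subset[of _ "{1..n} \<times> {1..n}"]) auto
  ultimately show ?thesis unfolding stat_def by (cases "- v (int j) \<prec> v (int r)") simp_all
qed

lemma sum_stat_up_step:
  fixes t :: "'a::comm_ring_1"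
  assumes rj: "1 \<le> r" "r \<le> j" "j \<le> n"
  shows "(\<Sum>v\<in>signed_perms n. t ^ stat n (before j (Suc r)) v * up_step n t (int r, - int j) g v) =
    (\<Sum>v\<in>signed_perms n. t ^ stat n (before j r) v * g v)"
proof (rule sum_up_step_adjoint)
  let ?\<beta> = "(int r, - int j)"
  show \<beta>: "?\<beta> \<in> pos_roots n" using rj bar_in_pos_roots neg_in_pos_roots by (cases "r = j") auto
  fix u assume u: "u \<in> signed_perms n"
  let ?u = "u \<circ> signed_refl ?\<beta>"
  have u': "?u (int r) = - u (int j)" "?u (int j) = - u (int r)"
    using rj refl_bar_apply[OF u, of r j] refl_neg_apply[OF u, of r] by (cases "r = j"; simp)+
  have "stat n (before j (Suc r)) ?u = stat n (before j r) ?u" if "- u (int j) \<prec> u (int r)"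
    unfolding stat_before_Suc[OF rj] u' using that letter_less_asym by auto
  moreover have "ell n ?u < ell n u \<longleftrightarrow> - u (int j) \<prec> u (int r)"
    and "- u (int j) \<prec> u (int r) \<Longrightarrow> stat n (before j r) u = gap n u ?u + stat n (before j r) ?u"
  proof -
    have "(ell n ?u < ell n u \<longleftrightarrow> - u (int j) \<prec> u (int r)) \<and>
      (- u (int j) \<prec> u (int r) \<longrightarrow> stat n (before j r) u = gap n u ?u + stat n (before j r) ?u)"
    proof (cases "r = j")
      case True
      have "- u (int j) \<prec> u (int j) \<longleftrightarrow> u (int j) < 0"
        using signed_perms_nonzero[OF u, of j] rj by (auto simp: letter_less_def)
      then show ?thesis
        using stat_neg_diff[OF u, of j] ell_neg_less_iff[OF u, of j] rj True by (auto simp: gap_def)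
    next
      case False
      then have rj': "1 \<le> r" "r < j" "j \<le> n" using rj by auto
      show ?thesis
        using stat_bar_diff[OF u rj'] ell_bar_less_iff[OF u rj'] by (auto simp: gap_def)
    qed
    then show "ell n ?u < ell n u \<longleftrightarrow> - u (int j) \<prec> u (int r)"
      "- u (int j) \<prec> u (int r) \<Longrightarrow> stat n (before j r) u = gap n u ?u + stat n (before j r) ?u" by blast+
  qed
  \<comment> \<open>If the pair \<open>(r, j)\<close> is counted, the gap makes up for the drop of
    the statistic, and with \<open>s\<close> the old exponent the identity is
    \<open>t ^ s = t ^ (s + 1) + (1 - t) * t ^ s\<close>. Otherwise only the skipping branch exists
    and the exponent does not change.\<close>
  ultimately show "t ^ stat n (before j r) u = t ^ stat n (before j (Suc r)) u + (if ell n ?u < ell n u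
      then t ^ gap n u ?u * (1 - t) * t ^ stat n (before j (Suc r)) ?u else 0)"
    by (cases "- u (int j) \<prec> u (int r)") (simp_all add: stat_before_Suc[OF rj] power_add algebra_simps)
qed

lemma sum_stat_up_steps_row:
  fixes t :: "'a::comm_ring_1"
  assumes "s \<le> j" "j \<le> n"
  shows "(\<Sum>v\<in>signed_perms n. t ^ stat n (before j (Suc s)) v *
      up_steps n t (map (\<lambda>r. (int r, - int j)) [1..<Suc s]) g v) =
    (\<Sum>v\<in>signed_perms n. t ^ stat n (before j 1) v * g v)"
  using assms(1)
proof (induction s)
  case (Suc s)
  have "[1..<Suc (Suc s)] = [1..<Suc s] @ [Suc s]" by simp
  then have "up_steps n t (map (\<lambda>r. (int r, - int j)) [1..<Suc (Suc s)]) g =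
    up_step n t (int (Suc s), - int j) (up_steps n t (map (\<lambda>r. (int r, - int j)) [1..<Suc s]) g)"
    by (simp del: upt_Suc)
  then show ?case using sum_stat_up_step[of "Suc s" j n t] Suc assms(2) by simp
qed simp

text \<open>For columns of height \<open>n\<close> the tail of each factor is a single sign change.
  The factors therefore run through all pairs of \<open>ell_minus\<close>, and each root removes its
  own pair from the exponent.\<close>

lemma sum_ell_up_steps:
  fixes t :: "'a::comm_ring_1"
  shows "(\<Sum>v\<in>signed_perms n. t ^ ell n v *
      up_steps n t (concat (map (\<lambda>j. Gamma_plain n j n) [1..<Suc n])) g v) =
    (\<Sum>v\<in>signed_perms n. t ^ ell_plus (window n v) * g v)"
proof -
  have G: "Gamma_plain n j n = map (\<lambda>r. (int r, - int j)) [1..<Suc j]" if "1 \<le> j" for j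
    unfolding Gamma_plain_eq tail_roots_n Gamma_primed_def using that by simp
  have main: "(\<Sum>v\<in>signed_perms n. t ^ stat n (before (Suc q) 1) v *
      up_steps n t (concat (map (\<lambda>j. Gamma_plain n j n) [1..<Suc q])) g v) =
    (\<Sum>v\<in>signed_perms n. t ^ stat n (before 1 1) v * g v)" if "q \<le> n" for q
    using that
  proof (induction q)
    case (Suc q)
    have "[1..<Suc (Suc q)] = [1..<Suc q] @ [Suc q]" by simp
    then have u: "up_steps n t (concat (map (\<lambda>j. Gamma_plain n j n) [1..<Suc (Suc q)])) g =
      up_steps n t (map (\<lambda>r. (int r, - int (Suc q))) [1..<Suc (Suc q)])
        (up_steps n t (concat (map (\<lambda>j. Gamma_plain n j n) [1..<Suc q])) g)"
      using G[of "Suc q"] by (simp del: upt_Suc)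
    \<comment> \<open>On pairs with \<open>k \<le> l\<close>, the start of row \<open>j + 1\<close>
      is the same cut as the end of row \<open>j\<close>.\<close>
    have s: "stat n (before (Suc (Suc q)) 1) v = stat n (before (Suc q) (Suc (Suc q))) v" for v
      unfolding stat_def by (intro arg_cong2[of _ _ _ _ "(+)"] arg_cong[of _ _ card]) auto
    show ?case unfolding u s
      using sum_stat_up_steps_row[of "Suc q" "Suc q" n t] Suc by simp
  qed simp
  have 1: "stat n (before (Suc n) 1) v = ell n v" for v
    unfolding ell_eq_stat stat_def by (intro arg_cong2[of _ _ _ _ "(+)"] arg_cong[of _ _ card]) auto
  have 2: "stat n (before 1 1) v = ell_plus (window n v)" for v
    unfolding ell_plus_eq_stat stat_def by (intro arg_cong2[of _ _ _ _
      "(+)"] arg_cong[of _ _ card]) auto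
  from main[of n] show ?thesis unfolding 1 2 by simp
qed

section \<open>Labels and positions of the chain\<close>

locale strict_partition =
  fixes n :: nat and lam :: "nat \<Rightarrow> nat"
  assumes n2: "2 \<le> n" and lam_decreasing: "\<forall>i\<in>{1..<n}. lam (i + 1) < lam i" and lam_pos: "0 < lam n"
begin

abbreviation "cp \<equiv> conj_part n lam"
abbreviation "cols \<equiv> columns n lam"
abbreviation "labels \<equiv> chain_labels n lam"
abbreviation "fac \<equiv> factor n lam"
abbreviation "chain \<equiv> lambda_chain n lam"
abbreviation "m \<equiv> length chain"
abbreviation "\<beta> \<equiv> beta n lam"
abbreviation "ht \<equiv> height n lam"

lemma lam_antimono:
  assumes "1 \<le> i" "i \<le> j" "j \<le> n"
  shows "lam j \<le> lam i"
  using assms(2,3)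
proof (induction j rule: dec_induct)
  case (step j)
  then show ?case using lam_decreasing assms(1) by (force dest!: bspec[of _ _ j])
qed simp

lemma le_lam_iff:
  assumes "k \<in> {1..n}"
  shows "i \<le> lam k \<longleftrightarrow> k \<le> cp i"
proof -
  let ?S = "{k \<in> {1..n}. i \<le> lam k}"
  have down: "l \<in> ?S" if "k \<in> ?S" "1 \<le> l" "l \<le> k" for k l
    using that lam_antimono[of l k] by auto
  have fin: "finite ?S" by simp
  show ?thesis
  proof
    assume "i \<le> lam k"
    then have "{1..k} \<subseteq> ?S" using down[of k] assms by auto
    then have "card {1..k} \<le> card ?S" by (rule card_mono[OF fin])
    then show "k \<le> cp i" by (simp add: conj_part_def)
  next
    assume k: "k \<le> cp i"
    show "i \<le> lam k"
    proof (rule ccontr)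
      assume "\<not> i \<le> lam k"
      have "l < k" if "l \<in> ?S" for l
      proof (rule ccontr)
        assume "\<not> l < k"
        then have "k \<in> ?S" using down[OF that, of k] assms by simp
        with \<open>\<not> i \<le> lam k\<close> show False by simp
      qed
      then have "?S \<subseteq> {1..<k}" by auto
      then have "card ?S \<le> card {1..<k}" by (intro card_mono) auto
      moreover have "1 \<le> k" using assms by simp
      ultimately show False using k unfolding conj_part_def by (simp only: card_atLeastLessThan)
    qed
  qed
qed

lemma cp_le_n: "cp i \<le> n"
proof -
  have "card {k \<in> {1..n}. i \<le> lam k} \<le> card {1..n}" by (intro card_mono) auto
  then show ?thesis by (simp add: conj_part_def)
qed

lemma cp_antimono: "i \<le> j \<Longrightarrow> cp j \<le> cp i"
  unfolding conj_part_def by (intro card_mono) auto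

text \<open>All \<open>n\<close> parts are positive, so the last column has full height and
  determines a signed permutation.\<close>

lemma cp_1: "cp 1 = n"
proof -
  have "1 \<le> lam n" using lam_pos by simp
  then have "n \<le> cp 1" using le_lam_iff[of n 1] n2 by auto
  then show ?thesis using cp_le_n[of 1] by simp
qed

lemma cp_pos: "i \<le> lam 1 \<Longrightarrow> 1 \<le> cp i"
  using le_lam_iff[of 1 i] n2 by simp

lemma lam_1_pos: "1 \<le> lam 1"
  using lam_antimono[of 1 n] lam_pos n2 by simp

lemma block_eq: "i \<le> lam 1 \<Longrightarrow>
  block n lam i = map (Primed i) [2..<Suc (cp i)] @ [Plain i 1] @ map (Plain i) [2..<Suc (cp i)]"
  using cp_pos[of i] unfolding block_def
  by (simp add: upt_conv_Cons numeral_2_eq_2 del: upt_Suc)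

text \<open>Apart from a final run of factors in block 1, every factor has a column placed
  immediately before it.\<close>

lemma labels_eq: "labels = cols @ map (Plain 1) [2..<Suc n]"
proof -
  have "[1..<Suc (lam 1)] = 1 # [2..<Suc (lam 1)]"
    using lam_1_pos by (simp add: upt_conv_Cons numeral_2_eq_2 del: upt_Suc)
  then show ?thesis
    unfolding chain_labels_def columns_def using block_eq[OF lam_1_pos] cp_1 by simp
qed

lemma columns_snoc: "\<exists>ls. cols = ls @ [Plain 1 1]"
  by (simp add: columns_def)

lemma set_block: "set (block n lam i) = Primed i ` {2..cp i} \<union> Plain i ` {1..cp i}"
  unfolding block_def set_append set_map set_upt atLeastLessThanSuc_atLeastAtMost ..

lemma set_labels:
  "Plain i j \<in> set labels \<longleftrightarrow> i \<in> {1..lam 1} \<and> j \<in> {1..cp i}"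
  "Primed i j \<in> set labels \<longleftrightarrow> i \<in> {1..lam 1} \<and> j \<in> {2..cp i}"
proof -
  have "set labels = (\<Union>i\<in>{1..lam 1}. set (block n lam i))"
    unfolding chain_labels_def set_concat set_map set_rev set_upt atLeastLessThanSuc_atLeastAtMost
      image_image ..
  then show "Plain i j \<in> set labels \<longleftrightarrow> i \<in> {1..lam 1} \<and> j \<in> {1..cp i}"
    "Primed i j \<in> set labels \<longleftrightarrow> i \<in> {1..lam 1} \<and> j \<in> {2..cp i}"
    unfolding set_block by (simp_all only:) blast+
qed

lemma set_columns:
  "Plain i j \<in> set cols \<longleftrightarrow> i \<in> {2..lam 1} \<and> j \<in> {1..cp i} \<or> i = 1 \<and> j = 1"
  "Primed i j \<in> set cols \<longleftrightarrow> i \<in> {1..lam 1} \<and> j \<in> {2..cp i}"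
proof -
  have S: "set cols = (\<Union>i\<in>{2..lam 1}. set (block n lam i)) \<union> Primed 1 ` {2..cp 1} \<union> {Plain 1 1}"
    unfolding columns_def set_append set_concat set_map set_rev set_upt atLeastLessThanSuc_atLeastAtMost
      image_image cp_1 by (simp only: list.set Un_assoc)
  have "i = 1 \<or> i \<in> {2..lam 1} \<longleftrightarrow> i \<in> {1..lam 1}" using lam_1_pos by auto
  moreover have "Primed i j \<in> set cols \<longleftrightarrow> (i = 1 \<or> i \<in> {2..lam 1}) \<and> j \<in> {2..cp i}"
    unfolding S set_block by blast
  ultimately show "Primed i j \<in> set cols \<longleftrightarrow> i \<in> {1..lam 1} \<and> j \<in> {2..cp i}" by blast
  show "Plain i j \<in> set cols \<longleftrightarrow> i \<in> {2..lam 1} \<and> j \<in> {1..cp i} \<or> i = 1 \<and> j = 1"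
    unfolding S set_block by blast
qed

lemma distinct_labels: "distinct labels"
proof -
  have "distinct is \<Longrightarrow> distinct (concat (map (block n lam) is))" for "is"
  proof (induction "is")
    case (Cons i "is")
    then show ?case by (auto simp: block_def distinct_map inj_on_def simp del: upt_Suc)
  qed simp
  then show ?thesis unfolding chain_labels_def by simp
qed

text \<open>Reconciles two descriptions of neighbouring columns: the filling conditions use
  \<open>next_label\<close>, the path along the chain uses the list order.\<close>

lemma successively_columns: "successively (\<lambda>L M. M = next_label n lam L) cols"
proof -
  let ?P = "\<lambda>L M. M = next_label n lam L"
  \<comment> \<open>Built from the left: \<open>?pre q\<close> holds the complete blocks with index
    above \<open>q\<close>, and \<open>?tl q\<close> is block \<open>q\<close> up to its first plain
    column.\<close>
  let ?pre = "\<lambda>q. concat (map (block n lam) (rev [Suc q..<Suc (lam 1)]))"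
  let ?tl = "\<lambda>q. map (Primed q) [2..<Suc (cp q)] @ [Plain q 1]"
  have primed: "successively ?P (?tl q)" if "q \<le> lam 1" for q
  proof -
    have "?P (map (Primed q) [2..<Suc (cp q)] ! i) (map (Primed q) [2..<Suc (cp q)] ! Suc i)"
      if "Suc i < length [2..<Suc (cp q)]" for i
      using that by (simp del: upt_Suc)
    then have "successively ?P (map (Primed q) [2..<Suc (cp q)])"
      by (simp add: successively_conv_nth del: upt_Suc)
    moreover have "last (map (Primed q) [2..<Suc (cp q)]) = Primed q (cp q)" if "2 \<le> cp q"
      using that by (simp add: last_map)
    ultimately show ?thesis
      by (cases "2 \<le> cp q") (auto simp: successively_append_iff simp del: upt_Suc)
  qed
  have hd_tl: "hd (?tl q) = (if 1 < cp q then Primed q 2 else Plain q 1)" for q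
    by (simp add: hd_append upt_conv_Cons del: upt_Suc)
  have "successively ?P (?pre q @ ?tl q)" if "q \<le> lam 1" "1 \<le> q" for q
    using that
  proof (induction rule: inc_induct)
    case base
    then show ?case using primed[of "lam 1"] by simp
  next
    case (step q)
    let ?Q = "Suc q"
    have QL: "?Q \<le> lam 1" using step.hyps by simp
    have "[Suc q..<Suc (lam 1)] = ?Q # [Suc ?Q..<Suc (lam 1)]"
      using step.hyps by (simp add: upt_conv_Cons del: upt_Suc)
    then have pre: "?pre q = (?pre ?Q @ ?tl ?Q) @ map (Plain ?Q) [2..<Suc (cp ?Q)]"
      using block_eq[OF QL] by (simp del: upt_Suc)
    let ?pl = "map (Plain ?Q) [2..<Suc (cp ?Q)]"
    have IH: "successively ?P (?pre ?Q @ ?tl ?Q)" using step by simp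
    have "?P (?pl ! i) (?pl ! Suc i)" if "Suc i < length [2..<Suc (cp ?Q)]" for i
      using that by (simp del: upt_Suc)
    then have pl: "successively ?P ?pl"
      by (simp add: successively_conv_nth del: upt_Suc)
    have pl_tl: "successively ?P ([Plain ?Q 1] @ ?pl)"
      using pl by (cases "2 \<le> cp ?Q") (auto simp: successively_Cons upt_conv_Cons simp del: upt_Suc)
    have last: "last ([Plain ?Q 1] @ ?pl) = Plain ?Q (cp ?Q)"
      using cp_pos[OF QL] by (cases "2 \<le> cp ?Q") (auto simp: last_map le_Suc_eq numeral_2_eq_2)
    have "successively ?P (([Plain ?Q 1] @ ?pl) @ ?tl q)"
      unfolding successively_append_iff[of _ "[Plain ?Q 1] @ ?pl"] last hd_tl
      using pl_tl primed[of q] step.hyps by simp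
    then have "successively ?P ((?pl) @ ?tl q)" "?pl @ ?tl q \<noteq> []" "?P (Plain ?Q 1) (hd (?pl @ ?tl q))"
      by (auto simp: successively_Cons)
    then have "successively ?P ((?pre ?Q @ ?tl ?Q) @ (?pl @ ?tl q))"
      using IH by (subst successively_append_iff) simp
    then show ?case unfolding pre by simp
  qed
  from this[of 1] have "successively ?P (?pre 1 @ ?tl 1)" using lam_1_pos by blast
  then show ?thesis by (simp add: columns_def cp_1[unfolded One_nat_def] numeral_2_eq_2)
qed

lemma next_column: "Suc p < length cols \<Longrightarrow> cols ! Suc p = next_label n lam (cols ! p)"
  using successively_columns by (simp add: successively_conv_nth)

lemma nth_labels: "p < length cols \<Longrightarrow> labels ! p = cols ! p"
  by (simp add: labels_eq nth_append)

definition off :: "nat \<Rightarrow> nat" where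
  "off p = length (concat (map fac (take p labels)))"

lemma off_0 [simp]: "off 0 = 0"
  by (simp add: off_def)

lemma off_Suc: "p < length labels \<Longrightarrow> off (Suc p) = off p + length (fac (labels ! p))"
  by (simp add: off_def take_Suc_conv_app_nth)

lemma roots_before_nth: "p < length labels \<Longrightarrow> roots_before n lam (labels ! p) = off p"
proof -
  assume p: "p < length labels"
  have "takeWhile (\<lambda>M. M \<noteq> labels ! p) labels = take p labels"
    using p distinct_labels by (intro takeWhile_eq_take_P_nth) (auto simp: nth_eq_iff_index_eq)
  then show ?thesis by (simp add: roots_before_def off_def)
qed

lemma chain_split:
  assumes "p < length labels"
  shows "chain = concat (map fac (take p labels)) @ fac (labels ! p) @ concat (map fac (drop (Suc p)
    labels))"
  unfolding lambda_chain_def using id_take_nth_drop[OF assms]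
  by (metis concat.simps(2) concat_append list.simps(9) map_append)

lemma beta_off:
  assumes "p < length labels" "x < length (fac (labels ! p))"
  shows "\<beta> (off p + Suc x) = fac (labels ! p) ! x"
  unfolding beta_def chain_split[OF assms(1)] using assms(2) by (simp add: off_def nth_append)

text \<open>Primed labels start at 2, so no factor is empty. Consequently \<open>off\<close> is
  injective and a chain position carries at most one column.\<close>

lemma fac_nonempty: "L \<in> set labels \<Longrightarrow> fac L \<noteq> []"
  by (cases L) (auto simp: set_labels Gamma_plain_def Gamma_primed_def)

lemma off_strict_mono:
  assumes "p < q" "q \<le> length labels"
  shows "off p < off q"
  using assms
proof (induction q)
  case (Suc q)
  then have "off q < off (Suc q)" using off_Suc[of q] fac_nonempty[of "labels ! q"] by simp
  then show ?case using Suc by (cases "p = q") auto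
qed simp

lemma off_mono: "p \<le> q \<Longrightarrow> q \<le> length labels \<Longrightarrow> off p \<le> off q"
  using off_strict_mono[of p q] by (cases "p = q") auto

lemma off_length: "off (length labels) = m"
  by (simp add: off_def lambda_chain_def)

lemma off_le_m: "p \<le> length labels \<Longrightarrow> off p \<le> m"
  using off_strict_mono[of p "length labels"] off_length by (cases "p = length labels") auto

lemma off_eq_iff: "p \<le> length labels \<Longrightarrow> q \<le> length labels \<Longrightarrow> off p = off q \<longleftrightarrow> p = q"
  using off_strict_mono[of p q] off_strict_mono[of q p] by (cases p q rule: linorder_cases) auto

lemma fac_pos_roots: "L \<in> set labels \<Longrightarrow> set (fac L) \<subseteq> pos_roots n"
proof (cases L)
  case (Plain i j)
  assume "L \<in> set labels"
  then have j: "1 \<le> j" "j \<le> cp i" "cp i \<le> n" using Plain set_labels cp_le_n by auto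
  then show ?thesis unfolding Plain
    by (auto simp: Gamma_plain_def intro!: bar_in_pos_roots neg_in_pos_roots swap_in_pos_roots simp
      del: upt_Suc)
next
  case (Primed i k)
  assume "L \<in> set labels"
  then have j: "2 \<le> k" "k \<le> cp i" "cp i \<le> n" using Primed set_labels cp_le_n by auto
  then show ?thesis unfolding Primed
    by (auto simp: Gamma_primed_def intro!: bar_in_pos_roots)
qed

lemma beta_pos_roots: "1 \<le> k \<Longrightarrow> k \<le> m \<Longrightarrow> \<beta> k \<in> pos_roots n"
proof -
  assume "1 \<le> k" "k \<le> m"
  then have "\<beta> k \<in> set chain" by (auto simp: beta_def)
  then show ?thesis using fac_pos_roots by (auto simp: lambda_chain_def)
qed

lemma nonlast_column: "Suc p < length cols \<Longrightarrow> cols ! p \<noteq> Plain 1 1"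
proof -
  assume p: "Suc p < length cols"
  have "distinct cols" using distinct_labels labels_eq by simp
  moreover have "cols ! (length cols - 1) = Plain 1 1" using columns_snoc by auto
  ultimately show ?thesis using p nth_eq_iff_index_eq[of cols p "length cols - 1"] by auto
qed

lemma column_index:
  assumes "L \<in> set cols" "L \<noteq> Plain 1 1"
  obtains p where "Suc p < length cols" "cols ! p = L"
proof -
  obtain p where p: "p < length cols" "cols ! p = L" using assms(1) by (metis in_set_conv_nth)
  moreover have "cols ! (length cols - 1) = Plain 1 1" using columns_snoc by auto
  ultimately have "p \<noteq> length cols - 1" using assms(2) by auto
  then show thesis using that[of p] p by simp
qed

lemma height_next:
  assumes "Suc p < length cols"
  shows "ht (cols ! p) \<le> ht (cols ! Suc p)"
proof -
  have "cols ! p \<in> set cols" using assms by simp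
  moreover note nonlast_column[OF assms]
  moreover have "ht L \<le> ht (next_label n lam L)" if "L \<in> set cols" "L \<noteq> Plain 1 1" for L
    by (cases L) (use cp_antimono in auto)
  ultimately show ?thesis unfolding next_column[OF assms] by blast
qed

lemma height_mono: "p \<le> q \<Longrightarrow> q < length cols \<Longrightarrow> ht (cols ! p) \<le> ht (cols ! q)"
proof (induction q rule: dec_induct)
  case (step q)
  then show ?case using height_next[of q] by simp
qed simp

lemma height_le_n: "ht L \<le> n"
  using cp_le_n by (cases L) auto

section \<open>States along the chain\<close>

definition st :: "(int \<Rightarrow> int) \<Rightarrow> nat set \<Rightarrow> nat \<Rightarrow> (int \<Rightarrow> int)" where
  "st w J x = mult_word n lam w (filter (\<lambda>k. k \<in> J) [1..<Suc x])"

lemma st_0 [simp]: "st w J 0 = w"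
  by (simp add: st_def mult_word_def)

lemma st_Suc: "st w J (Suc x) = (if Suc x \<in> J then st w J x \<circ> signed_refl (\<beta> (Suc x)) else st w J x)"
proof -
  have "[1..<Suc (Suc x)] = [1..<Suc x] @ [Suc x]" by simp
  then show ?thesis unfolding st_def mult_word_def     by (cases
    "Suc x \<in> J") (simp_all only: filter_append foldl_append filter.simps foldl.simps if_True if_False)
qed

lemma st_cong: "(\<And>k. 1 \<le> k \<Longrightarrow> k \<le> x \<Longrightarrow> k \<in> J \<longleftrightarrow> k \<in> J') \<Longrightarrow> st w J x = st w J' x"
  by (induction x) (auto simp: st_Suc)

lemma st_signed_perms: "w \<in> signed_perms n \<Longrightarrow> x \<le> m \<Longrightarrow> st w J x \<in> signed_perms n"
  by (induction x) (auto simp: st_Suc intro!: comp_refl_in_signed_perms beta_pos_roots simp del: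
    comp_apply)

lemma sorted_list_below:
  assumes "J \<subseteq> {1..y}"
  shows "sorted_list_of_set {k \<in> J. k \<le> x} = filter (\<lambda>k. k \<in> J) [1..<Suc x]"
proof -
  have "{k \<in> J. k \<le> x} = set (filter (\<lambda>k. k \<in> J) [1..<Suc x])"
    using assms unfolding set_filter set_upt by auto
  then show ?thesis
    by (simp only: sorted_list_of_set.idem_if_sorted_distinct sorted_wrt_filter sorted_upt
      distinct_filter distinct_upt)
qed

lemma mult_T_eq_st: "J \<subseteq> {1..y} \<Longrightarrow> mult_T n lam w {k \<in> J. k \<le> x} = st w J x"
  unfolding mult_T_def st_def sorted_list_below ..

lemma mult_T_eq_st_m: "J \<subseteq> {1..m} \<Longrightarrow> mult_T n lam w J = st w J m"
proof -
  assume J: "J \<subseteq> {1..m}"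
  then have "{k \<in> J. k \<le> m} = J" by auto
  then show ?thesis using mult_T_eq_st[OF J, of w m] by simp
qed

text \<open>Every Bruhat step increases the length, and for two elements that differ by a reflection
  a larger length is already one Bruhat step. Admissibility can thus be tested by lengths.\<close>

lemma bruhat_less_refl_iff:
  assumes "u \<in> signed_perms n" "b \<in> pos_roots n"
  shows "bruhat_less n u (u \<circ> signed_refl b) \<longleftrightarrow> ell n u < ell n (u \<circ> signed_refl b)"
proof
  have "ell n x < ell n y" if "bruhat_less n x y" for x y
    using that unfolding bruhat_less_def by (induction rule: tranclp_induct) auto
  then show "bruhat_less n u (u \<circ> signed_refl b) \<Longrightarrow> ell n u < ell n (u \<circ> signed_refl b)" by blast
  show "ell n u < ell n (u \<circ> signed_refl b) \<Longrightarrow> bruhat_less n u (u \<circ> signed_refl b)"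
    unfolding bruhat_less_def using assms by (intro tranclp.r_into_trancl) blast
qed

definition adm :: "(int \<Rightarrow> int) \<Rightarrow> nat set \<Rightarrow> nat \<Rightarrow> bool" where
  "adm w J x \<longleftrightarrow> (\<forall>y<x. Suc y \<in> J \<longrightarrow> ell n (st w J (Suc y)) < ell n (st w J y))"

lemma adm_0 [simp]: "adm w J 0"
  by (simp add: adm_def)

lemma adm_Suc: "adm w J (Suc x) \<longleftrightarrow> adm w J x \<and> (Suc x \<in> J \<longrightarrow> ell n (st w J (Suc x)) < ell n (st w J x))"
  by (auto simp: adm_def less_Suc_eq)

lemma adm_iff_bruhat:
  fixes J :: "nat set"
  assumes w: "w \<in> signed_perms n" and "x \<le> m"
  defines "ks \<equiv> \<lambda>x. filter (\<lambda>k. k \<in> J) [1..<Suc x]"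
  shows "(\<forall>p<length (ks x). bruhat_less n (mult_word n lam w (take (Suc p) (ks x)))
     (mult_word n lam w (take p (ks x)))) \<longleftrightarrow> adm w J x"
  using assms(2)
proof (induction x)
  case 0
  then show ?case by (simp add: ks_def)
next
  case (Suc x)
  let ?u = "st w J x" and ?b = "\<beta> (Suc x)"
  have b: "?b \<in> pos_roots n" using Suc by (intro beta_pos_roots) auto
  have u: "?u \<circ> signed_refl ?b \<in> signed_perms n"
    using Suc by (intro comp_refl_in_signed_perms b st_signed_perms w) auto
  have ks: "ks (Suc x) = (if Suc x \<in> J then ks x @ [Suc x] else ks x)" by (simp add: ks_def)
  show ?case
  proof (cases "Suc x \<in> J")
    case True
    have "mult_word n lam w (ks x @ [Suc x]) = ?u \<circ> signed_refl ?b" "mult_word n lam w (ks x) = ?u"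
      by (simp_all add: st_def mult_word_def ks_def)
    moreover have "bruhat_less n (?u \<circ> signed_refl ?b) ?u \<longleftrightarrow> ell n (?u \<circ> signed_refl ?b) < ell n ?u"
      using bruhat_less_refl_iff[OF u b] unfolding comp_refl_refl[OF b] .
    moreover have "(\<forall>p<length (ks x @ [Suc x]). bruhat_less n (mult_word n lam w (take (Suc p) (ks x
      @ [Suc x])))
         (mult_word n lam w (take p (ks x @ [Suc x])))) \<longleftrightarrow>
      (\<forall>p<length (ks x). bruhat_less n (mult_word n lam w (take (Suc p) (ks x)))
         (mult_word n lam w (take p (ks x)))) \<and>
      bruhat_less n (mult_word n lam w (ks x @ [Suc x])) (mult_word n lam w (ks x))"
      by (auto simp: less_Suc_eq)
    ultimately show ?thesis unfolding ks adm_Suc st_Suc if_P[OF True] using Suc True by simp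
  next
    case False
    then show ?thesis unfolding ks adm_Suc using Suc by simp
  qed
qed

lemma admissible_iff:
  "(w, J) \<in> admissible n lam \<longleftrightarrow> w \<in> signed_perms n \<and> J \<subseteq> {1..m} \<and> adm w J m"
proof -
  have "(\<forall>p<card J. bruhat_less n (mult_word n lam w (take (Suc p) (sorted_list_of_set J)))
           (mult_word n lam w (take p (sorted_list_of_set J)))) \<longleftrightarrow> adm w J m"
    if w: "w \<in> signed_perms n" and J: "J \<subseteq> {1..m}"
  proof -
    have "{k \<in> J. k \<le> m} = J" using J by auto
    then have s: "sorted_list_of_set J = filter (\<lambda>k. k \<in> J) [1..<Suc m]"
      using sorted_list_below[OF J, of m] by simp
    have "card J = length (sorted_list_of_set J)" by simp
    then show ?thesis using adm_iff_bruhat[OF w order_refl, of J] unfolding s by simp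
  qed
  then show ?thesis unfolding admissible_def by auto
qed

lemma ell_refl_gap:
  assumes u: "u \<in> signed_perms n" and b: "b \<in> pos_roots n" and less:
    "ell n (u \<circ> signed_refl b) < ell n u"
  shows "ell n u = ell n (u \<circ> signed_refl b) + 2 * gap n u (u \<circ> signed_refl b) + 1"
proof -
  have "\<exists>d. ell n u = ell n (u \<circ> signed_refl b) + 2 * d + 1"
  proof -
    from b show ?thesis
    proof (cases rule: pos_roots_cases)
      case (swap i j)
      with less ell_swap_less_iff[OF u swap(2-4)] ell_swap_diff[OF u swap(2-4)] show ?thesis by auto
    next
      case (bar i j)
      with less ell_bar_less_iff[OF u bar(2-4)] stat_bar_diff(1)[OF u bar(2-4)] show ?thesis by auto
    next
      case (neg i)
      with less ell_neg_less_iff[OF u neg(2,3)] stat_neg_diff(1)[OF u neg(2,3)] show ?thesis by auto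
    qed
  qed
  then show ?thesis by (auto simp: gap_def)
qed

definition gap_sum :: "(int \<Rightarrow> int) \<Rightarrow> nat set \<Rightarrow> nat \<Rightarrow> nat" where
  "gap_sum w J x = (\<Sum>y<x. if Suc y \<in> J then gap n (st w J y) (st w J (Suc y)) else 0)"

lemma ell_gap_sum:
  assumes "w \<in> signed_perms n" "J \<subseteq> {1..y}" "adm w J x" "x \<le> m"
  shows "ell n w = ell n (st w J x) + 2 * gap_sum w J x + card {k \<in> J. k \<le> x}"
  using assms(3,4)
proof (induction x)
  case 0
  have "{k \<in> J. k \<le> 0} = {}" using assms(2) by auto
  then show ?case by (simp add: gap_sum_def)
next
  case (Suc x)
  have IH: "ell n w = ell n (st w J x) + 2 * gap_sum w J x + card {k \<in> J. k \<le> x}"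
    using Suc by (simp add: adm_Suc)
  have fin: "finite {k \<in> J. k \<le> x}" by simp
  show ?case
  proof (cases "Suc x \<in> J")
    case True
    have "{k \<in> J. k \<le> Suc x} = insert (Suc x) {k \<in> J. k \<le> x}" using True by auto
    then have "card {k \<in> J. k \<le> Suc x} = Suc (card {k \<in> J. k \<le> x})" using fin by simp
    moreover have "gap_sum w J (Suc x) = gap_sum w J x + gap n (st w J x) (st w J (Suc x))"
      using True by (simp add: gap_sum_def)
    moreover have "ell n (st w J x) = ell n (st w J (Suc x)) + 2 * gap n (st w J x) (st w J (Suc x))
      + 1"
      unfolding st_Suc if_P[OF True]
    proof (rule ell_refl_gap)
      show "ell n (st w J x \<circ> signed_refl (\<beta> (Suc x))) < ell n (st w J x)"
        using Suc(2) True by (simp add: adm_Suc st_Suc)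
    qed (use Suc assms in \<open>auto intro: st_signed_perms beta_pos_roots\<close>)
    ultimately show ?thesis using IH by simp
  next
    case False
    have "{k \<in> J. k \<le> Suc x} = {k \<in> J. k \<le> x}" using False by (auto simp: le_Suc_eq)
    then show ?thesis using IH False by (simp add: gap_sum_def st_Suc)
  qed
qed

text \<open>Each used position lowers the length by \<open>2 * gap + 1\<close>. Summing up shows
  that the half in \<open>half_exponent\<close> is an integer and splits it into a final length and
  local gaps.\<close>

lemma half_exponent_eq:
  assumes "w \<in> signed_perms n" "J \<subseteq> {1..m}" "adm w J m"
  shows "half_exponent n lam w J = ell n (st w J m) + gap_sum w J m"
proof -
  have "{k \<in> J. k \<le> m} = J" using assms(2) by auto
  then have "ell n w = ell n (st w J m) + 2 * gap_sum w J m + card J"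
    using ell_gap_sum[OF assms order_refl] by simp
  then show ?thesis unfolding half_exponent_def mult_T_eq_st_m[OF assms(2)]
    by (intro the_equality) auto
qed

end

section \<open>Congruence of transfer operators; full columns and signed permutations\<close>

lemma finite_signed_perms: "finite (signed_perms n)"
  by (rule finite_subset[OF _ finite_permutations[OF finite_letters[of n]]]) (auto simp:
    signed_perms_def)

lemma up_step_cong:
  assumes "b \<in> pos_roots n" "v \<in> signed_perms n" "\<And>u. u \<in> signed_perms n \<Longrightarrow> g u = g' u"
  shows "up_step n t b g v = up_step n t b g' v"
  unfolding up_step_def using assms(3)[OF assms(2)] assms(3)[OF comp_refl_in_signed_perms[OF
    assms(2,1)]]
  by simp

lemma up_steps_cong:
  assumes "set bs \<subseteq> pos_roots n" "\<And>u. u \<in> signed_perms n \<Longrightarrow> g u = g' u"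
  shows "v \<in> signed_perms n \<Longrightarrow> up_steps n t bs g v = up_steps n t bs g' v"
  using assms(1)
proof (induction bs arbitrary: v rule: rev_induct)
  case (snoc b bs)
  have "up_step n t b (up_steps n t bs g) v = up_step n t b (up_steps n t bs g') v"
    by (rule up_step_cong) (use snoc in auto)
  then show ?case by simp
qed (use assms(2) in simp)

lemma window_determines:
  assumes "u \<in> signed_perms n" "v \<in> signed_perms n" "window n u = window n v"
  shows "u = v"
proof
  fix e
  have pos: "u (int k) = v (int k)" if "k \<in> {1..n}" for k
    using assms(3) that window_eq_iff[of n u "window n v"] by simp
  consider "e \<notin> letters n" | "e \<in> letters n" "0 < e" | "e \<in> letters n" "e < 0"
    using zero_notin_letters by (metis linorder_neqE)
  then show "u e = v e"
  proof cases
    case 1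
    moreover have "u permutes letters n" "v permutes letters n" using assms(1,2)
      by (auto simp: signed_perms_def)
    ultimately show ?thesis by (simp add: permutes_not_in[of u] permutes_not_in[of v])
  next
    case 2
    then have "nat e \<in> {1..n}" "int (nat e) = e" by (auto simp: letters_def)
    then show ?thesis using pos[of "nat e"] by simp
  next
    case 3
    then have "nat (- e) \<in> {1..n}" "int (nat (- e)) = - e" by (auto simp: letters_def)
    then have "u (- e) = v (- e)" using pos[of "nat (- e)"] by simp
    then show ?thesis using signed_perms_minus[OF assms(1)] signed_perms_minus[OF assms(2)] by simp
  qed
qed

text \<open>The column is extended to negative positions by oddness. Distinctness up to sign makes
  the extension injective on the finite set of letters, hence a permutation.\<close>

lemma exists_window:
  assumes "length C = n" "signed_distinct C" "set C \<subseteq> letters n"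
  shows "\<exists>v\<in>signed_perms n. window n v = C"
proof -
  define v where "v e = (if e \<notin> letters n then e else if 0 < e then entry C (nat e)
    else - entry C (nat (- e)))"
    for e
  have pos: "v (int k) = entry C k" if "k \<in> {1..n}" for k
    using that by (simp add: v_def)
  have minus: "v (- e) = - v e" for e
    by (cases "e = 0") (auto simp: v_def)
  have rep: "\<exists>k\<in>{1..n}. e = int k \<or> e = - int k" if "e \<in> letters n" for e
    using that by (intro bexI[of _ "nat \<bar>e\<bar>"]) (auto simp: letters_def)
  have letters: "entry C k \<in> letters n" if "k \<in> {1..n}" for k
    using entry_in_set[of k C] that assms by auto
  have "v ` letters n \<subseteq> letters n"
  proof
    fix d assume "d \<in> v ` letters n"
    then obtain e where e: "e \<in> letters n" "d = v e" by blast
    then obtain k where "k \<in> {1..n}" "e = int k \<or> e = - int k" using rep by blast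
    then show "d \<in> letters n" using e(2) pos letters minus by auto
  qed
  moreover have "inj_on v (letters n)"
  proof (rule inj_onI)
    fix a b assume ab: "a \<in> letters n" "b \<in> letters n" "v a = v b"
    obtain k where k: "k \<in> {1..n}" "a = int k \<or> a = - int k" using rep ab by blast
    obtain l where l: "l \<in> {1..n}" "b = int l \<or> b = - int l" using rep ab by blast
    have "entry C k = entry C l \<or> entry C k = - entry C l"
      using ab(3) k l pos minus by auto
    then have kl: "k = l" using assms(1,2) k(1) l(1) unfolding signed_distinct_def by blast
    have "entry C k \<noteq> - entry C k" using letters[OF k(1)] zero_notin_letters[of n] by force
    then show "a = b" using k(2) l(2) ab(3) pos[OF k(1)] minus[of "int k"] unfolding kl by auto
  qed
  ultimately have "bij_betw v (letters n) (letters n)"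
    using endo_inj_surj[OF finite_letters] by (auto simp: bij_betw_def)
  then have "v permutes letters n" by (rule bij_imp_permutes) (simp add: v_def)
  then have "v \<in> signed_perms n" using minus by (simp add: signed_perms_def)
  moreover have "window n v = C" unfolding window_eq_iff using pos assms(1) by simp
  ultimately show ?thesis by blast
qed

context strict_partition
begin

section \<open>Sums over admissible pairs with prescribed columns\<close>

definition ok :: "filling \<Rightarrow> (int \<Rightarrow> int) \<Rightarrow> nat set \<Rightarrow> nat \<Rightarrow> bool" where
  "ok \<sigma> w J x \<longleftrightarrow> (\<forall>p<length cols. off p \<le> x \<longrightarrow> window (ht (cols ! p)) (st w J (off p)) = \<sigma> (cols ! p))"

text \<open>Because \<open>off\<close> is injective on columns, this constrains \<open>v\<close> by
  one column or, between two column positions, not at all.\<close>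

definition fits :: "filling \<Rightarrow> nat \<Rightarrow> (int \<Rightarrow> int) \<Rightarrow> bool" where
  "fits \<sigma> x v \<longleftrightarrow> (\<forall>p<length cols. off p = x \<longrightarrow> window (ht (cols ! p)) v = \<sigma> (cols ! p))"

definition partials :: "filling \<Rightarrow> nat \<Rightarrow> ((int \<Rightarrow> int) \<times> nat set) set" where
  "partials \<sigma> x = {(w, J). w \<in> signed_perms n \<and> J \<subseteq> {1..x} \<and> adm w J x \<and> ok \<sigma> w J x}"

text \<open>The partition function of the beginning of the chain: the weight of all descending paths
  over the first \<open>x\<close> roots that end at \<open>v\<close> and show every column met so
  far. The final length is not yet included.\<close>

definition Z :: "filling \<Rightarrow> 'a::comm_ring_1 \<Rightarrow> nat \<Rightarrow> (int \<Rightarrow> int) \<Rightarrow> 'a" where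
  "Z \<sigma> t x v = (\<Sum>(w, J)\<in>{(w, J) \<in> partials \<sigma> x. st w J x = v}. t ^ gap_sum w J x * (1 - t) ^ card J)"

lemma finite_partials: "finite (partials \<sigma> x)"
  by (rule finite_subset[of _ "signed_perms n \<times> Pow {1..x}"])
    (auto simp: partials_def finite_signed_perms)

lemma ok_Suc: "ok \<sigma> w J (Suc x) \<longleftrightarrow> ok \<sigma> w J x \<and> fits \<sigma> (Suc x) (st w J (Suc x))"
  unfolding ok_def fits_def le_Suc_eq by metis

lemma ok_0: "ok \<sigma> w J 0 \<longleftrightarrow> fits \<sigma> 0 w"
  unfolding ok_def fits_def by (metis le_zero_eq order_refl st_0)

text \<open>The first column stands at position 0 and constrains the starting permutation
  itself.\<close>

lemma Z_0:
  assumes "v \<in> signed_perms n"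
  shows "Z \<sigma> t 0 v = (if fits \<sigma> 0 v then 1 else 0)"
proof -
  have "{(w, J) \<in> partials \<sigma> 0. st w J 0 = v} = (if fits \<sigma> 0 v then {(v, {})} else {})"
    using assms by (auto simp: partials_def ok_0)
  then show ?thesis by (simp add: Z_def gap_sum_def)
qed

lemma insert_top:
  assumes J: "J \<subseteq> {1..x}"
  defines "K \<equiv> insert (Suc x) J"
  shows "y \<le> x \<Longrightarrow> st w K y = st w J y" "st w K (Suc x) = st w J x \<circ> signed_refl (\<beta> (Suc x))"
    "adm w K x \<longleftrightarrow> adm w J x" "ok \<sigma> w K x \<longleftrightarrow> ok \<sigma> w J x" "gap_sum w K x = gap_sum w J x"
    "card K = Suc (card J)"
proof -
  have st: "st w K y = st w J y" if "y \<le> x" for y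
    using that by (intro st_cong) (auto simp: K_def)
  then show "y \<le> x \<Longrightarrow> st w K y = st w J y" .
  show "st w K (Suc x) = st w J x \<circ> signed_refl (\<beta> (Suc x))"
    unfolding st_Suc using st[of x] by (simp add: K_def)
  show "adm w K x \<longleftrightarrow> adm w J x"
    unfolding adm_def using st by (auto simp: K_def)
  show "ok \<sigma> w K x \<longleftrightarrow> ok \<sigma> w J x"
    unfolding ok_def using st by auto
  show "gap_sum w K x = gap_sum w J x"
    unfolding gap_sum_def by (intro sum.cong) (auto simp: st, auto simp: K_def)
  show "card K = Suc (card J)"
    unfolding K_def using J finite_subset[OF J] by (subst card_insert_disjoint) auto
qed

text \<open>Sets without the position \<open>x + 1\<close> end at \<open>v\<close> already before
  it; sets with it come from \<open>v'\<close>, and removing this position is a bijection onto the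
  paths that end there. The constraint by a column at \<open>x + 1\<close> involves only the new
  state.\<close>

lemma Z_Suc:
  assumes x: "Suc x \<le> m" and v: "v \<in> signed_perms n"
  shows "Z \<sigma> t (Suc x) v = (if fits \<sigma> (Suc x) v then up_step n t (\<beta> (Suc x)) (Z \<sigma> t x) v else 0)"
proof -
  let ?b = "\<beta> (Suc x)"
  let ?A = "{(w, J) \<in> partials \<sigma> (Suc x). st w J (Suc x) = v}"
  let ?F = "\<lambda>x (w, J). t ^ gap_sum w J x * (1 - t) ^ card J"
  have b: "?b \<in> pos_roots n" using x by (intro beta_pos_roots) auto
  define v' where "v' = v \<circ> signed_refl ?b"
  show ?thesis
  proof (cases "fits \<sigma> (Suc x) v")
    case False
    then have "?A = {}" by (auto simp: partials_def ok_Suc)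
    then show ?thesis using False by (simp only: Z_def sum.empty if_False)
  next
    case True
    let ?ins = "\<lambda>(w, J). (w, insert (Suc x) J)"
    let ?P = "{(w, J) \<in> partials \<sigma> x. st w J x = v}" and ?B = "{(w, J) \<in> partials \<sigma> x. st w J x = v'}"
    let ?Q = "if ell n v < ell n v' then ?ins ` ?B else {}"
    have v'b: "v' \<circ> signed_refl ?b = v" unfolding v'_def by (rule comp_refl_refl[OF b])
    have A: "?A = ?P \<union> ?Q"
    proof (intro set_eqI iffI)
      fix z assume z: "z \<in> ?A"
      obtain w J where wJ: "z = (w, J)" by (cases z)
      have h: "w \<in> signed_perms n" "J \<subseteq> {1..Suc x}" "adm w J (Suc x)" "ok \<sigma> w J (Suc x)"
        "st w J (Suc x) = v"
        using z unfolding wJ partials_def by (simp_all only: mem_Collect_eq case_prod_conv)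
      show "z \<in> ?P \<union> ?Q"
      proof (cases "Suc x \<in> J")
        case False
        then have "J \<subseteq> {1..x}" using h(2) by (auto simp: le_Suc_eq)
        then have "z \<in> ?P" using h False unfolding wJ partials_def by (simp add: adm_Suc ok_Suc st_Suc)
        then show ?thesis by blast
      next
        case T: True
        define I where "I = J - {Suc x}"
        have I: "I \<subseteq> {1..x}" "J = insert (Suc x) I" using h(2) T by (auto simp: I_def le_Suc_eq)
        note top = insert_top[OF I(1), folded I(2)]
        have stI: "st w I x = v'"
          using h(5) unfolding top(2) v'_def by (metis comp_refl_refl[OF b])
        have "ell n v < ell n v'"
          using h(3,5) T stI top(1)[of x w] by (simp add: adm_Suc)
        moreover have "(w, I) \<in> ?B"
          using h I(1) stI top(3,4) by (simp add: partials_def adm_Suc ok_Suc)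
        ultimately show ?thesis unfolding wJ I(2) by force
      qed
    next
      fix z assume z: "z \<in> ?P \<union> ?Q"
      obtain w J where wJ: "z = (w, J)" by (cases z)
      show "z \<in> ?A"
      proof (cases "z \<in> ?P")
        case T: True
        then have h: "w \<in> signed_perms n" "J \<subseteq> {1..x}" "adm w J x" "ok \<sigma> w J x" "st w J x = v"
          unfolding wJ by (auto simp: partials_def)
        have "Suc x \<notin> J" "J \<subseteq> {1..Suc x}" using h(2) by auto
        moreover from this have "st w J (Suc x) = v" using h(5) by (simp add: st_Suc)
        ultimately show ?thesis using h(1,3,4) True unfolding wJ partials_def
          by (simp add: adm_Suc ok_Suc)
      next
        case False
        with z have z1: "z \<in> ?ins ` ?B" and less: "ell n v < ell n v'" by (auto split: if_splits)
        then obtain I where I: "J = insert (Suc x) I" "(w, I) \<in> ?B" unfolding wJ by auto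
        then have h: "w \<in> signed_perms n" "I \<subseteq> {1..x}" "adm w I x" "ok \<sigma> w I x" "st w I x = v'"
          by (auto simp: partials_def)
        note top = insert_top[OF h(2), folded I(1)]
        have stv: "st w J (Suc x) = v" unfolding top(2) h(5) by (rule v'b)
        moreover have "adm w J (Suc x)" using h less stv top(1)[of x w] by (simp add: adm_Suc top)
        moreover have "ok \<sigma> w J (Suc x)" using h True stv by (simp add: ok_Suc top)
        moreover have "J \<subseteq> {1..Suc x}" using I(1) h(2) by auto
        ultimately show ?thesis using h(1) unfolding wJ partials_def by simp
      qed
    qed
    have fin: "finite ?P" "finite ?B"
      by (rule finite_subset[OF _ finite_partials[of \<sigma> x]]; auto)+
    have A0: "Suc x \<notin> J" if "(w, J) \<in> ?P" for w J using that by (auto simp: partials_def)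
    have "(\<Sum>z\<in>?A. ?F (Suc x) z) = (\<Sum>z\<in>?P. ?F (Suc x) z) + (\<Sum>z\<in>?Q. ?F (Suc x) z)"
      unfolding A by (rule sum.union_disjoint) (use fin A0 in \<open>auto split: if_splits\<close>)
    also have "(\<Sum>z\<in>?P. ?F (Suc x) z) = Z \<sigma> t x v"
      unfolding Z_def by (rule sum.cong) (auto simp: gap_sum_def partials_def)
    also have "(\<Sum>z\<in>?Q. ?F (Suc x) z) =
      (if ell n v < ell n v' then t ^ gap n v' v * (1 - t) * Z \<sigma> t x v' else 0)"
    proof (cases "ell n v < ell n v'")
      case T: True
      have inj: "inj_on ?ins ?B"
      proof (rule inj_onI)
        fix a c assume ac: "a \<in> ?B" "c \<in> ?B" "?ins a = ?ins c"
        obtain w J w' J' where e: "a = (w, J)" "c = (w', J')" by (cases a, cases c)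
        have "Suc x \<notin> J" "Suc x \<notin> J'" using ac(1,2) unfolding e by (auto simp: partials_def)
        then show "a = c" using ac(3) unfolding e by (auto simp: insert_ident)
      qed
      have "(\<Sum>z\<in>?Q. ?F (Suc x) z) = (\<Sum>z\<in>?B. ?F (Suc x) (?ins z))"
        using T by (simp add: sum.reindex[OF inj] o_def)
      also have "\<dots> = (\<Sum>z\<in>?B. t ^ gap n v' v * (1 - t) * ?F x z)"
      proof (rule sum.cong[OF refl])
        fix z assume z: "z \<in> ?B"
        obtain w J where wJ: "z = (w, J)" by (cases z)
        with z have J: "J \<subseteq> {1..x}" "st w J x = v'" by (auto simp: partials_def)
        note top = insert_top[OF J(1)]
        have "gap_sum w (insert (Suc x) J) (Suc x) = gap_sum w J x + gap n v' v"
          using top(1)[of x w] top(2)[of w] top(5)[of w] J(2) v'b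
            by (simp add: gap_sum_def del: comp_apply)
        then show "?F (Suc x) (?ins z) = t ^ gap n v' v * (1 - t) * ?F x z"
          unfolding wJ using top(6) by (simp add: power_add mult_ac)
      qed
      also have "\<dots> = t ^ gap n v' v * (1 - t) * Z \<sigma> t x v'"
        unfolding Z_def by (simp add: sum_distrib_left case_prod_beta)
      finally show ?thesis using T by simp
    qed simp
    finally show ?thesis
      using True unfolding Z_def[of \<sigma> t "Suc x"] up_step_def v'_def[symmetric] by simp
  qed
qed

lemma take_Suc_up_steps:
  "y < length bs \<Longrightarrow> up_steps n t (take (Suc y) bs) g = up_step n t (bs ! y) (up_steps n t (take y bs) g)"
  by (simp add: take_Suc_conv_app_nth)

text \<open>No column stands strictly inside a factor, so the recursion is free of constraints
  there; the hypothesis \<open>last\<close> is needed only when \<open>y\<close> reaches the end of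
  the factor, where the next column may stand.\<close>

lemma Z_within_factor:
  assumes p: "p < length labels" and y: "y \<le> length (fac (labels ! p))" and v: "v \<in> signed_perms n"
    and last: "y = length (fac (labels ! p)) \<Longrightarrow> fits \<sigma> (off p + y) v"
  shows "Z \<sigma> t (off p + y) v = up_steps n t (take y (fac (labels ! p))) (Z \<sigma> t (off p)) v"
  using y v last
proof (induction y arbitrary: v)
  case (Suc y)
  let ?bs = "fac (labels ! p)"
  have b: "\<beta> (Suc (off p + y)) = ?bs ! y" using beta_off[OF p, of y] Suc by simp
  have m: "Suc (off p + y) \<le> m"
    using off_le_m[of "Suc p"] off_Suc[OF p] p Suc by simp
  have "fits \<sigma> (Suc (off p + y)) v"
  proof (cases "Suc y = length ?bs")
    case True
    then show ?thesis using Suc(4) by (metis add_Suc_right)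
  next
    case False
    \<comment> \<open>A column here would stand strictly between two consecutive values of the
      strictly increasing \<open>off\<close>.\<close>
    have "off q \<noteq> Suc (off p + y)" if "q < length cols" for q
    proof -
      have q: "q \<le> length labels" using that by (simp add: labels_eq)
      have "off p < Suc (off p + y)" "Suc (off p + y) < off (Suc p)"
        using False Suc off_Suc[OF p] by auto
      moreover have "off q \<le> off p \<or> off (Suc p) \<le> off q"
        using off_mono[of q p] off_mono[of "Suc p" q] p q by linarith
      ultimately show ?thesis by linarith
    qed
    then show ?thesis by (simp add: fits_def)
  qed
  then have "Z \<sigma> t (off p + Suc y) v = up_step n t (?bs ! y) (Z \<sigma> t (off p + y)) v"
    using Z_Suc[OF m Suc(3), of \<sigma> t] b by simp
  also have "\<dots> = up_step n t (?bs ! y) (up_steps n t (take y ?bs) (Z \<sigma> t (off p))) v"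
  proof (rule up_step_cong[OF _ Suc(3)])
    show "?bs ! y \<in> pos_roots n" using b beta_pos_roots[OF _ m] by simp
    show "Z \<sigma> t (off p + y) u = up_steps n t (take y ?bs) (Z \<sigma> t (off p)) u" if "u \<in> signed_perms n"
      for u
      using Suc that by auto
  qed
  finally show ?case using Suc by (simp add: take_Suc_up_steps)
qed simp

lemma off_columns_eq_iff: "p < length cols \<Longrightarrow> q < length cols \<Longrightarrow> off p = off q \<longleftrightarrow> p = q"
  by (intro off_eq_iff) (auto simp: labels_eq)

lemma fits_off: "p < length cols \<Longrightarrow> fits \<sigma> (off p) v \<longleftrightarrow> window (ht (cols ! p)) v = \<sigma> (cols ! p)"
  unfolding fits_def using off_columns_eq_iff[of _ p] by auto

lemma entry_take: "1 \<le> r \<Longrightarrow> r \<le> h \<Longrightarrow> entry (take h C) r = entry C r"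
  by (simp add: entry_def)

lemma filling_column:
  assumes "\<sigma> \<in> fillings n lam" "L \<in> set cols"
  shows "length (\<sigma> L) = ht L" "set (\<sigma> L) \<subseteq> letters n" "signed_distinct (\<sigma> L)"
  using assms unfolding fillings_def signed_distinct_def by blast+

lemma filling_column_ge:
  assumes \<sigma>: "\<sigma> \<in> fillings n lam" and p: "Suc p < length cols"
  shows "column_ge (\<sigma> (cols ! p)) (take (ht (cols ! p)) (\<sigma> (cols ! Suc p)))"
proof -
  let ?D = "\<sigma> (cols ! p)" and ?C = "\<sigma> (cols ! Suc p)" and ?h = "ht (cols ! p)"
  have D: "length ?D = ?h" using filling_column(1)[OF \<sigma>] p by simp
  have C: "length ?C = ht (cols ! Suc p)" using filling_column(1)[OF \<sigma>] p by simp
  have le: "?h \<le> length ?C" unfolding C by (rule height_next[OF p])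
  have rows: "\<And>p q r. p < q \<Longrightarrow> q < length cols \<Longrightarrow>
        r \<in> {1..length (\<sigma> (cols ! p))} \<Longrightarrow> r \<in> {1..length (\<sigma> (cols ! q))} \<Longrightarrow>
        entry (\<sigma> (cols ! q)) r \<preceq> entry (\<sigma> (cols ! p)) r"
    using \<sigma> unfolding fillings_def by blast
  have "entry ?C r \<preceq> entry ?D r" if "r \<in> {1..?h}" for r
    using that D le p by (intro rows) auto
  then show ?thesis unfolding column_ge_def D using le by (simp add: entry_take)
qed

text \<open>The filling conditions provide the list of swaps required by the two factor
  computations, the weakly decreasing rows provide the descents, and \<open>N_des_col\<close>
  identifies the exponents.\<close>

lemma up_steps_factor:
  fixes t :: "'a::comm_ring_1"
  assumes \<sigma>: "\<sigma> \<in> fillings n lam" and p: "Suc p < length cols" and v: "v \<in> signed_perms n"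
    and win: "window (ht (cols ! Suc p)) v = \<sigma> (cols ! Suc p)"
    and g: "\<And>u. u \<in> signed_perms n \<Longrightarrow> g u = (if window (ht (cols ! p)) u = \<sigma> (cols ! p) then \<kappa> else 0)"
  shows "up_steps n t (fac (cols ! p)) g v =
    t ^ N_col n (\<sigma> (cols ! p)) (\<sigma> (cols ! Suc p)) * (1 - t) ^ des_col n (\<sigma> (cols ! p)) (\<sigma> (cols !
      Suc p)) * \<kappa>"
proof -
  define D where "D = \<sigma> (cols ! p)"
  define C where "C = \<sigma> (cols ! Suc p)"
  define L where "L = cols ! p"
  have Lin: "L \<in> set cols" using p by (simp add: L_def)
  have D: "length D = ht L" "set D \<subseteq> letters n" "signed_distinct D"
    using filling_column[OF \<sigma> Lin] by (auto simp: D_def L_def)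
  have ge: "column_ge D (take (length D) C)"
    using filling_column_ge[OF \<sigma> p] D(1) by (simp add: D_def C_def L_def)
  have win': "window (ht L) v = take (ht L) C"
  proof -
    have "ht L \<le> ht (cols ! Suc p)" unfolding L_def by (rule height_next[OF p])
    moreover have "length C = ht (cols ! Suc p)" using win unfolding C_def by (metis length_window)
    moreover have "v (int k) = entry C k" if "k \<in> {1..ht (cols ! Suc p)}" for k
      using win that unfolding C_def[symmetric] window_eq_iff by blast
    ultimately show ?thesis unfolding window_eq_iff by (simp add: entry_take)
  qed
  have C: "C = \<sigma> (next_label n lam L)" unfolding C_def L_def next_column[OF p] ..
  have g': "\<And>u. u \<in> signed_perms n \<Longrightarrow> g u = (if window (ht L) u = D then \<kappa> else 0)"
    using g by (simp add: L_def D_def)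
  have rows: "entry (take (length D) C) r \<preceq> entry D r" if "r \<in> {1..length D}" for r
    using ge that by (auto simp: column_ge_def)
  have "up_steps n t (fac L) g v = t ^ N_col n D C * (1 - t) ^ des_col n D C * \<kappa>"
  proof (cases L)
    case (Plain i j)
    with Lin nonlast_column[OF p] have ij: "i \<in> {2..lam 1}" "j \<in> {1..cp i}"
      using set_columns(1)[of i j] by (auto simp: L_def)
    have "\<forall>i\<in>{2..lam 1}. \<forall>j\<in>{1..cp i}. \<exists>rs. increasing_below j rs \<and>
        (let D = bar_swaps (\<sigma> (Plain i j)) j rs;
             E = take (cp i) (\<sigma> (next_label n lam (Plain i j)))
         in agree_except j D E \<and> entry E j \<preceq> entry D j)"
      using \<sigma> unfolding fillings_def by blast
    with ij obtain rs where rs: "increasing_below j rs"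
      "agree_except j (bar_swaps (\<sigma> L) j rs) (take (cp i) (\<sigma> (next_label n lam L)))"
      "entry (take (cp i) (\<sigma> (next_label n lam L))) j \<preceq> entry (bar_swaps (\<sigma> L) j rs) j"
      unfolding Plain Let_def by blast
    have h: "ht L = cp i" "length D = cp i" using Plain D(1) by auto
    have agree: "agree_except j (bar_swaps D j rs) (take (length D) C)"
      and le: "entry (take (length D) C) j \<preceq> entry (bar_swaps D j rs) j"
      using rs(2,3) h(2) unfolding C D_def L_def by simp_all
    have sd: "(N_col n D C, des_col n D C) = stat_data n D (take (length D) C) j rs"
      by (rule N_des_col[OF D(3) _ rs(1) ge agree le]) (use ij h in simp)
    have j: "1 \<le> j" "j \<le> cp i" "cp i \<le> n" using ij cp_le_n by auto
    have "up_steps n t (Gamma_plain n j (cp i)) g v =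
      t ^ fst (stat_data n D (take (length D) C) j rs) * (1 - t) ^ snd (stat_data n D (take (length
        D) C) j rs) * \<kappa>"
    proof (rule up_steps_Gamma_plain[OF _ j v D(3) h(2) D(2) rs(1) _ agree le])
      show "window (cp i) v = take (length D) C" using win' h by simp
      show "\<forall>r\<in>set rs. entry (take (length D) C) r \<preceq> entry D r"
        using rows rs(1) j h by (force simp: increasing_below_def)
    qed (use g' h in simp)
    then show ?thesis unfolding sd[symmetric] using Plain by simp
  next
    case (Primed i k)
    with Lin have ik: "i \<in> {1..lam 1}" "k \<in> {2..cp i}"
      using set_columns(2)[of i k] by auto
    have "\<forall>i\<in>{1..lam 1}. \<forall>k\<in>{2..cp i}. \<exists>rs. increasing_below k rs \<and>
        \<sigma> (next_label n lam (Primed i k)) = bar_swaps (\<sigma> (Primed i k)) k rs"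
      using \<sigma> unfolding fillings_def by blast
    with ik obtain rs where rs: "increasing_below k rs" "C = bar_swaps D k rs"
      using Primed unfolding C D_def L_def by metis
    have h: "ht L = cp i" "length D = cp i" using Primed D(1) by auto
    have tk: "take (length D) C = C" using rs(2) by simp
    have k: "1 \<le> k" "k \<le> cp i" "cp i \<le> n" "k \<in> {1..length D}" using ik cp_le_n h by auto
    have "agree_except k (bar_swaps D k rs) C" unfolding rs(2)
      using rs(1) k by (intro agree_except_bar_swaps[OF D(3)]) (auto simp: increasing_below_def)
    then have "(N_col n D C, des_col n D C) = stat_data n D C k rs"
      using N_des_col[OF D(3) k(4) rs(1) ge] unfolding tk by (simp add: rs(2))
    then have sd: "N_col n D C = N_swaps n k D rs" "des_col n D C = length rs"
      by (simp_all add: stat_data_def rs(2) Let_def)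
    have vC: "v (int r) = entry C r" if "r \<in> {1..cp i}" for r
      using win' that h tk unfolding window_eq_iff by simp
    have "up_steps n t (Gamma_primed k) g v = t ^ N_swaps n k D rs * (1 - t) ^ length rs * \<kappa>"
    proof (rule up_steps_Gamma_primed(2)[OF _ k(1-3) h(2) v rs(1)])
      show "window (cp i) v = bar_swaps D k rs" using win' h tk rs(2) by simp
      show "\<forall>r\<in>set rs. v (int r) \<preceq> entry D r"
        using rows vC rs(1) k h tk by (force simp: increasing_below_def)
    qed (use g' h in simp)
    then show ?thesis unfolding sd using Primed by simp
  qed
  then show ?thesis unfolding L_def D_def C_def .
qed

lemma Z_off:
  fixes t :: "'a::comm_ring_1"
  assumes \<sigma>: "\<sigma> \<in> fillings n lam"
  shows "p < length cols \<Longrightarrow> v \<in> signed_perms n \<Longrightarrow>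
    Z \<sigma> t (off p) v = (if window (ht (cols ! p)) v = \<sigma> (cols ! p)
      then \<Prod>q<p. t ^ N_col n (\<sigma> (cols ! q)) (\<sigma> (cols ! Suc q)) * (1 - t) ^ des_col n (\<sigma> (cols ! q))
        (\<sigma> (cols ! Suc q))
      else 0)"
proof (induction p arbitrary: v)
  case 0
  then show ?case using Z_0[of v \<sigma> t] fits_off[of 0 \<sigma> v] by simp
next
  case (Suc p)
  have pl: "p < length labels" "Suc p < length labels" using Suc.prems by (auto simp: labels_eq)
  have L: "labels ! p = cols ! p" using Suc.prems by (intro nth_labels) simp
  have ne: "0 < length (fac (labels ! p))" using fac_nonempty[of "labels ! p"] pl by simp
  note fo = fits_off[OF Suc.prems(1), of \<sigma> v]
  show ?case
  proof (cases "fits \<sigma> (off (Suc p)) v")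
    case True
    have "Z \<sigma> t (off (Suc p)) v = up_steps n t (fac (cols ! p)) (Z \<sigma> t (off p)) v"
      using Z_within_factor[OF pl(1) order_refl Suc.prems(2), of \<sigma> t] True L off_Suc[OF pl(1)] by simp
    also have "\<dots> = t ^ N_col n (\<sigma> (cols ! p)) (\<sigma> (cols ! Suc p)) * (1 - t) ^ des_col n (\<sigma> (cols !
      p)) (\<sigma> (cols ! Suc p)) *
      (\<Prod>q<p. t ^ N_col n (\<sigma> (cols ! q)) (\<sigma> (cols ! Suc q)) * (1 - t) ^ des_col n (\<sigma> (cols ! q)) (\<sigma>
        (cols ! Suc q)))"
      by (rule up_steps_factor[OF \<sigma> Suc.prems]) (use True fo Suc in auto)
    finally show ?thesis using True fo by (simp add: mult_ac)
  next
    case False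
    have "off (Suc p) \<noteq> 0" using off_Suc[OF pl(1)] ne by linarith
    then obtain x where x: "off (Suc p) = Suc x" using not0_implies_Suc by blast
    have "Suc x \<le> m" using off_le_m[of "Suc p"] pl x by simp
    from Z_Suc[OF this Suc.prems(2), of \<sigma> t] show ?thesis using False fo x by simp
  qed
qed

text \<open>The factors from \<open>Plain 1 1\<close> onwards come after the last column was read,
  so no constraint applies to them.\<close>

lemma Z_tail:
  fixes t :: "'a::comm_ring_1"
  assumes cols: "cols = ls @ [Plain 1 1]"
  shows "y \<le> n \<Longrightarrow> v \<in> signed_perms n \<Longrightarrow> Z \<sigma> t (off (length ls + y)) v =
    up_steps n t (concat (map (\<lambda>j. Gamma_plain n j n) [1..<Suc y])) (Z \<sigma> t (off (length ls))) v"
proof (induction y arbitrary: v)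
  case (Suc y)
  let ?p = "length ls + y"
  have "Plain 1 1 # map (Plain 1) [2..<Suc n] = map (Plain 1) [1..<Suc n]"
    using n2 by (simp add: upt_conv_Cons numeral_2_eq_2 del: upt_Suc)
  then have "labels = ls @ map (Plain 1) [1..<Suc n]" unfolding labels_eq cols by simp
  then have p: "?p < length labels" "labels ! ?p = Plain 1 (Suc y)"
    using Suc.prems by (simp_all add: nth_append del: upt_Suc)
  have f: "fac (labels ! ?p) = Gamma_plain n (Suc y) n" unfolding p(2) using cp_1 by simp
  have fits: "fits \<sigma> (off (Suc ?p)) v" for v
  proof -
    have "off q \<noteq> off (Suc ?p)" if "q < length cols" for q
      using that off_eq_iff[of q "Suc ?p"] p(1) by (simp add: labels_eq cols)
    then show ?thesis by (simp add: fits_def)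
  qed
  have upt: "[1..<Suc (Suc y)] = [1..<Suc y] @ [Suc y]" by simp
  have "Z \<sigma> t (off (Suc ?p)) v = up_steps n t (Gamma_plain n (Suc y) n) (Z \<sigma> t (off ?p)) v"
    using Z_within_factor[OF p(1) order_refl Suc.prems(2), of \<sigma> t] fits off_Suc[OF p(1)] f by simp
  also have "\<dots> = up_steps n t (Gamma_plain n (Suc y) n)
     (up_steps n t (concat (map (\<lambda>j. Gamma_plain n j n) [1..<Suc y])) (Z \<sigma> t (off (length ls)))) v"
  proof (rule up_steps_cong[OF _ _ Suc.prems(2)])
    show "set (Gamma_plain n (Suc y) n) \<subseteq> pos_roots n"
      using fac_pos_roots[of "labels ! ?p"] p(1) f by simp
  qed (use Suc in simp)
  finally show ?case unfolding upt by (simp del: upt_Suc)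
qed simp

lemma filling_map_eq_iff:
  assumes "\<sigma> \<in> fillings n lam" "J \<subseteq> {1..m}"
  shows "filling_map n lam (w, J) = \<sigma> \<longleftrightarrow> ok \<sigma> w J m"
proof -
  have out: "\<sigma> L = []" if "L \<notin> set cols" for L using assms(1) that unfolding fillings_def by blast
  have "filling_map n lam (w, J) = \<sigma> \<longleftrightarrow>
    (\<forall>L\<in>set cols. window (ht L) (mult_T n lam w {k \<in> J. k \<le> roots_before n lam L}) = \<sigma> L)"
    unfolding filling_map_def fun_eq_iff using out by auto
  also have "\<dots> \<longleftrightarrow> (\<forall>L\<in>set cols. window (ht L) (st w J (roots_before n lam L)) = \<sigma> L)"
    unfolding mult_T_eq_st[OF assms(2)] ..
  also have "\<dots> \<longleftrightarrow> (\<forall>p<length cols. window (ht (cols ! p)) (st w J (off p)) = \<sigma> (cols ! p))"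
  proof -
    have "roots_before n lam (cols ! p) = off p" if "p < length cols" for p
      using roots_before_nth[of p] nth_labels[OF that] that by (simp add: labels_eq)
    then show ?thesis unfolding all_set_conv_all_nth by simp
  qed
  also have "\<dots> \<longleftrightarrow> ok \<sigma> w J m"
    unfolding ok_def using off_le_m by (auto simp: labels_eq)
  finally show ?thesis .
qed

theorem generating_function:
  fixes t :: "'a::comm_ring_1"
  assumes \<sigma>: "\<sigma> \<in> fillings n lam"
  shows "(\<Sum>(w, J)\<in>{(w, J)\<in>admissible n lam. filling_map n lam (w, J) = \<sigma>}.
          t ^ half_exponent n lam w J * (1 - t) ^ card J) =
       t ^ N_filling n lam \<sigma> * (1 - t) ^ des_filling n lam \<sigma>"
proof -
  obtain ls where cols: "cols = ls @ [Plain 1 1]" using columns_snoc by blast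
  let ?M = "length ls" and ?C = "\<sigma> (Plain 1 1)"
  have M: "?M < length cols" "cols ! ?M = Plain 1 1" using cols by auto
  have C: "length ?C = n" "set ?C \<subseteq> letters n" "signed_distinct ?C"
    using filling_column[OF \<sigma>, of "Plain 1 1"] cols cp_1 by auto
  obtain v\<^sub>0 where v0: "v\<^sub>0 \<in> signed_perms n" "window n v\<^sub>0 = ?C" using exists_window[OF C(1,3,2)]
    by blast
  have set_eq: "{(w, J)\<in>admissible n lam. filling_map n lam (w, J) = \<sigma>} = partials \<sigma> m"
    unfolding partials_def using filling_map_eq_iff[OF \<sigma>] by (auto simp: admissible_iff)
  let ?P = "\<Prod>q<?M. t ^ N_col n (\<sigma> (cols ! q)) (\<sigma> (cols ! Suc q)) * (1 - t) ^ des_col n (\<sigma> (cols !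
    q)) (\<sigma> (cols ! Suc q))"
  have "length labels = ?M + n" using cols n2 by (simp add: labels_eq)
  then have off_m: "off (?M + n) = m" using off_length by simp
  have "(\<Sum>(w, J)\<in>partials \<sigma> m. t ^ half_exponent n lam w J * (1 - t) ^ card J) =
    (\<Sum>(w, J)\<in>partials \<sigma> m. t ^ ell n (st w J m) * (t ^ gap_sum w J m * (1 - t) ^ card J))"
    by (rule sum.cong) (auto simp: partials_def half_exponent_eq power_add mult_ac)
  \<comment> \<open>Grouping by the end point \<open>wT\<close> separates its length from the
    weights collected along the path.\<close>
  also have "\<dots> = (\<Sum>v\<in>signed_perms n. \<Sum>(w, J)\<in>{z \<in> partials \<sigma> m. (case z of (w, J) \<Rightarrow> st w J m) = v}.
      t ^ ell n (st w J m) * (t ^ gap_sum w J m * (1 - t) ^ card J))"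
    by (rule sum.group[symmetric])
      (auto simp: finite_partials finite_signed_perms, auto simp: partials_def intro: st_signed_perms)
  also have "\<dots> = (\<Sum>v\<in>signed_perms n. t ^ ell n v * Z \<sigma> t m v)"
    unfolding Z_def sum_distrib_left by (intro sum.cong) (auto intro!: sum.cong)
  also have "\<dots> = (\<Sum>v\<in>signed_perms n. t ^ ell n v *
      up_steps n t (concat (map (\<lambda>j. Gamma_plain n j n) [1..<Suc n])) (Z \<sigma> t (off ?M)) v)"
    using Z_tail[OF cols order_refl, of _ \<sigma> t] off_m by (intro sum.cong) simp_all
  also have "\<dots> = (\<Sum>v\<in>signed_perms n. t ^ ell_plus (window n v) * Z \<sigma> t (off ?M) v)"
    by (rule sum_ell_up_steps)
  also have "\<dots> = (\<Sum>v\<in>signed_perms n. if v = v\<^sub>0 then t ^ ell_plus ?C * ?P else 0)"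
  proof (rule sum.cong[OF refl])
    fix v assume v: "v \<in> signed_perms n"
    \<comment> \<open>The full last column leaves exactly one signed permutation in the sum.\<close>
    have "window n v = ?C \<longleftrightarrow> v = v\<^sub>0" using window_determines[OF v v0(1)] v0(2) by auto
    then show "t ^ ell_plus (window n v) * Z \<sigma> t (off ?M) v = (if v = v\<^sub>0 then t ^ ell_plus ?C * ?P
      else 0)"
      unfolding Z_off[OF \<sigma> M(1) v] M(2) using cp_1 v0(2) by simp
  qed
  also have "\<dots> = t ^ ell_plus ?C * ?P"
    using v0(1) finite_signed_perms by simp
  also have "\<dots> = t ^ N_filling n lam \<sigma> * (1 - t) ^ des_filling n lam \<sigma>"
  proof -
    have l: "length (map \<sigma> cols) - 1 = ?M" "last (map \<sigma> cols) = ?C" using cols by auto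
    have c: "map \<sigma> cols ! p = \<sigma> (cols ! p)" "map \<sigma> cols ! (p + 1) = \<sigma> (cols ! Suc p)" if "p < ?M" for p
      using that cols by (auto simp del: map_append)
    have "N_filling n lam \<sigma> = (\<Sum>p<?M. N_col n (\<sigma> (cols ! p)) (\<sigma> (cols ! Suc p))) + ell_plus ?C"
      "des_filling n lam \<sigma> = (\<Sum>p<?M. des_col n (\<sigma> (cols ! p)) (\<sigma> (cols ! Suc p)))"
      unfolding N_filling_def des_filling_def Let_def l using c by (auto intro!: sum.cong)
    then show ?thesis by (simp add: power_add power_sum prod.distrib mult_ac)
  qed
  finally show ?thesis unfolding set_eq .
qed

end

section \<open>The filling of an admissible pair\<close>

text \<open>Reachability by descending paths that use a subsequence of the listed roots. Weights are
  dropped: this relation serves the inclusion of the image of the filling map in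
  \<open>fillings\<close>.\<close>

primrec desc :: "nat \<Rightarrow> root list \<Rightarrow> (int \<Rightarrow> int) \<Rightarrow> (int \<Rightarrow> int) \<Rightarrow> bool" where
  "desc n [] u v \<longleftrightarrow> v = u"
| "desc n (b # bs) u v \<longleftrightarrow> desc n bs u v \<or>
     ell n (u \<circ> signed_refl b) < ell n u \<and> desc n bs (u \<circ> signed_refl b) v"

lemma desc_append: "desc n (bs @ cs) u v \<longleftrightarrow> (\<exists>w. desc n bs u w \<and> desc n cs w v)"
  by (induction bs arbitrary: u) auto

lemma desc_bars:
  assumes u: "u \<in> signed_perms n" and h: "j \<le> h" "h \<le> n"
  shows "q < j \<Longrightarrow> desc n (map (\<lambda>r. (int r, - int j)) [1..<Suc q]) u v \<Longrightarrow>
    v \<in> signed_perms n \<and> (\<forall>r\<in>{1..n}. v (int r) \<preceq> u (int r)) \<and>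
    (\<exists>rs. increasing_below (Suc q) rs \<and> window h v = bar_swaps (window h u) j rs)"
proof (induction q arbitrary: v)
  case 0
  then show ?case using u by (auto simp: increasing_below_def intro!: exI[of _ "[]"])
next
  case (Suc q)
  let ?b = "(int (Suc q), - int j)"
  have "[1..<Suc (Suc q)] = [1..<Suc q] @ [Suc q]" by simp
  with Suc.prems(2) obtain w where w: "desc n (map (\<lambda>r. (int r, - int j)) [1..<Suc q]) u w"
    "v = w \<or> ell n (w \<circ> signed_refl ?b) < ell n w \<and> v = w \<circ> signed_refl ?b"
    by (auto simp: desc_append simp del: upt_Suc)
  from Suc.IH[OF _ w(1)] Suc.prems obtain rs where IH: "w \<in> signed_perms n"
    "\<forall>r\<in>{1..n}. w (int r) \<preceq> u (int r)" "increasing_below (Suc q) rs" "window h w =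
      bar_swaps (window h u) j rs"
    by auto
  have Q: "1 \<le> Suc q" "Suc q < j" "j \<le> n" using Suc.prems h by auto
  from w(2) show ?case
  proof
    assume "v = w"
    then show ?thesis using IH increasing_below_mono[OF IH(3), of "Suc (Suc q)"] by auto
  next
    assume v: "ell n (w \<circ> signed_refl ?b) < ell n w \<and> v = w \<circ> signed_refl ?b"
    have vv: "v = w \<circ> signed_refl ?b" using v by blast
    have less: "- w (int j) \<prec> w (int (Suc q))" using v ell_bar_less_iff[OF IH(1) Q] by blast
    \<comment> \<open>Negating both sides of the descent inequality gives the inequality for
      position \<open>j\<close>, so both changed rows go down.\<close>
    then have less': "- w (int (Suc q)) \<prec> w (int j)"
      using letter_less_minus[of "w (int (Suc q))" "- w (int j)"] by simp
    have "v \<in> signed_perms n" unfolding vv by (rule comp_refl_in_signed_perms[OF IH(1)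
      bar_in_pos_roots[OF Q]])
    moreover have "v (int r) \<preceq> u (int r)" if "r \<in> {1..n}" for r
    proof -
      have r1: "1 \<le> r" using that by simp
      have "v (int r) = (if r = Suc q then - w (int j) else if r = j then - w (int (Suc q))
        else w (int r))"
        unfolding vv by (rule refl_bar_apply[OF IH(1) Q(1,2) r1])
      then have "v (int r) \<preceq> w (int r)" using less less' by (auto simp: letter_le_def)
      then show ?thesis using IH(2) that letter_le_trans by blast
    qed
    moreover have "window h v = bar_swaps (window h u) j (rs @ [Suc q])"
      unfolding vv window_bar_swap[OF IH(1) Q(1,2) h(1)] bar_swaps_snoc IH(4) ..
    moreover have "increasing_below (Suc (Suc q)) (rs @ [Suc q])"
      using IH(3) by (simp add: increasing_below_snoc)
    ultimately show ?thesis by blast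
  qed
qed

lemma desc_Gamma_primed:
  assumes "u \<in> signed_perms n" "1 \<le> j" "j \<le> h" "h \<le> n" "desc n (Gamma_primed j) u v"
  shows "v \<in> signed_perms n \<and> (\<forall>r\<in>{1..n}. v (int r) \<preceq> u (int r)) \<and>
    (\<exists>rs. increasing_below j rs \<and> window h v = bar_swaps (window h u) j rs)"
proof -
  have j: "Suc (j - 1) = j" "j - 1 < j" using assms(2) by auto
  show ?thesis
    using desc_bars[OF assms(1,3,4) j(2), unfolded j(1)] assms(5) unfolding Gamma_primed_def .
qed

lemma desc_tail_roots_step:
  assumes u: "u \<in> signed_perms n" and jk: "1 \<le> j" "j \<le> k" "k \<le> n"
    and b: "b \<in> set (tail_roots n j k)" and less: "ell n (u \<circ> signed_refl b) < ell n u"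
  defines "v \<equiv> u \<circ> signed_refl b"
  shows "v \<in> signed_perms n \<and> (\<forall>r\<in>{1..k} - {j}. v (int r) = u (int r)) \<and> v (int j) \<preceq> u (int j)"
proof -
  from b consider x where "b = (int j, - int x)" "k < x" "x \<le> n" | "b = (int j, - int j)"
    | x where "b = (int j, int x)" "k < x" "x \<le> n"
    unfolding tail_roots_def set_append set_map set_rev set_upt by fastforce
  then show ?thesis
  proof cases
    case 1
    have x: "1 \<le> j" "j < x" "x \<le> n" using 1 jk by auto
    have a: "v (int r) = (if r = j then - u (int x) else if r = x then - u (int j) else u (int r))"
      if "1 \<le> r" for r
      unfolding v_def 1(1) by (rule refl_bar_apply[OF u x(1,2) that])
    have "v \<in> signed_perms n"
      unfolding v_def 1(1) by (rule comp_refl_in_signed_perms[OF u bar_in_pos_roots[OF x]])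
    moreover have "- u (int x) \<prec> u (int j)" using less ell_bar_less_iff[OF u x] 1(1) by simp
    ultimately show ?thesis using a 1(2) jk by (auto simp: letter_le_def)
  next
    case 2
    have x: "1 \<le> j" "j \<le> n" using jk by auto
    have a: "v (int r) = (if r = j then - u (int j) else u (int r))" if "1 \<le> r" for r
      unfolding v_def 2 by (rule refl_neg_apply[OF u x(1) that])
    have "v \<in> signed_perms n"
      unfolding v_def 2 by (rule comp_refl_in_signed_perms[OF u neg_in_pos_roots[OF x]])
    moreover have "- u (int j) \<prec> u (int j)" using less ell_neg_less_iff[OF u x] 2
      by (simp add: letter_less_def)
    ultimately show ?thesis using a jk by (auto simp: letter_le_def)
  next
    case 3
    have x: "1 \<le> j" "j < x" "x \<le> n" using 3 jk by auto
    have a: "v (int r) = (if r = j then u (int x) else if r = x then u (int j) else u (int r))" if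
      "1 \<le> r" for r
      unfolding v_def 3(1) by (rule refl_swap_apply[OF x(1,2) that])
    have "v \<in> signed_perms n"
      unfolding v_def 3(1) by (rule comp_refl_in_signed_perms[OF u swap_in_pos_roots[OF x]])
    moreover have "u (int x) \<prec> u (int j)" using less ell_swap_less_iff[OF u x] 3(1) by simp
    ultimately show ?thesis using a 3(2) jk by (auto simp: letter_le_def)
  qed
qed

text \<open>Every tail root moves only \<open>j\<close> among the rows of the column, and a descent
  lowers the entry there. The list ranges over arbitrary lists of such roots so that induction on it
  is possible.\<close>

lemma desc_tail_roots:
  assumes jk: "1 \<le> j" "j \<le> k" "k \<le> n"
  shows "u \<in> signed_perms n \<Longrightarrow> set bs \<subseteq> set (tail_roots n j k) \<Longrightarrow> desc n bs u v \<Longrightarrow>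
    v \<in> signed_perms n \<and> (\<forall>r\<in>{1..k} - {j}. v (int r) = u (int r)) \<and> v (int j) \<preceq> u (int j)"
proof (induction bs arbitrary: u)
  case (Cons b bs)
  let ?u = "u \<circ> signed_refl b"
  from Cons.prems(3) consider "desc n bs u v" | "ell n ?u < ell n u" "desc n bs ?u v" by auto
  then show ?case
  proof cases
    case 2
    have b: "b \<in> set (tail_roots n j k)" using Cons.prems(2) by simp
    have *: "?u \<in> signed_perms n" "\<forall>r\<in>{1..k} - {j}. ?u (int r) = u (int r)" "?u (int j) \<preceq> u (int j)"
      using desc_tail_roots_step[OF Cons.prems(1) jk b 2(1)] by blast+
    have "set bs \<subseteq> set (tail_roots n j k)" using Cons.prems(2) by simp
    from Cons.IH[OF *(1) this 2(2)] *(2,3) letter_le_trans show ?thesis by (metis (no_types, lifting))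
  qed (use Cons in auto)
qed simp

context strict_partition
begin

lemma desc_st:
  assumes p: "p < length labels"
  shows "y \<le> length (fac (labels ! p)) \<Longrightarrow> adm w J (off p + y) \<Longrightarrow>
    desc n (take y (fac (labels ! p))) (st w J (off p)) (st w J (off p + y))"
proof (induction y)
  case (Suc y)
  let ?bs = "fac (labels ! p)"
  have b: "\<beta> (Suc (off p + y)) = ?bs ! y" using beta_off[OF p, of y] Suc by simp
  have "desc n [?bs ! y] (st w J (off p + y)) (st w J (Suc (off p + y)))"
    using Suc.prems(2) by (auto simp: st_Suc b adm_Suc)
  moreover have "desc n (take y ?bs) (st w J (off p)) (st w J (off p + y))"
    using Suc by (simp add: adm_Suc)
  ultimately show ?case using Suc.prems(1) desc_append by (simp add: take_Suc_conv_app_nth del: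
    desc.simps) blast
qed simp

lemma adm_mono: "adm w J x \<Longrightarrow> y \<le> x \<Longrightarrow> adm w J y"
  by (auto simp: adm_def)

text \<open>For a plain factor the path is cut where its primed part ends: up to that point it
  performs swaps, afterwards it can only lower the entry at \<open>j\<close>. Distinctness of the
  new entry holds because the end point is again a signed permutation.\<close>

lemma column_step:
  assumes w: "w \<in> signed_perms n" and adm: "adm w J m" and p: "Suc p < length cols"
  defines "u \<equiv> st w J (off p)" and "v \<equiv> st w J (off (Suc p))"
  shows "\<forall>r\<in>{1..ht (cols ! p)}. v (int r) \<preceq> u (int r)"
    and "cols ! p = Primed i k \<Longrightarrow>
      \<exists>rs. increasing_below k rs \<and> window (cp i) v = bar_swaps (window (cp i) u) k rs"
    and "cols ! p = Plain i j \<Longrightarrow> \<exists>rs. increasing_below j rs \<and>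
      agree_except j (bar_swaps (window (cp i) u) j rs) (window (cp i) v) \<and>
      v (int j) \<preceq> entry (bar_swaps (window (cp i) u) j rs) j"
proof -
  have pl: "p < length labels" "Suc p \<le> length labels" using p by (auto simp: labels_eq)
  have L: "labels ! p = cols ! p" using p by (intro nth_labels) simp
  have "adm w J (off (Suc p))" by (rule adm_mono[OF adm off_le_m[OF pl(2)]])
  then have d: "desc n (fac (cols ! p)) u v"
    using desc_st[OF pl(1) order_refl, of w J] unfolding u_def v_def off_Suc[OF pl(1)] L by simp
  have u: "u \<in> signed_perms n" unfolding u_def using off_le_m[of p] pl by (intro st_signed_perms w) auto
  have Lin: "cols ! p \<in> set cols" using p by simp
  have primed: "(\<forall>r\<in>{1..n}. v (int r) \<preceq> u (int r)) \<and>
      (\<exists>rs. increasing_below k rs \<and> window (cp i) v = bar_swaps (window (cp i) u) k rs)"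
    if L: "cols ! p = Primed i k" for i k
  proof -
    have k: "1 \<le> k" "k \<le> cp i" using Lin set_columns(2)[of i k] unfolding L by auto
    from desc_Gamma_primed[OF u k cp_le_n] d show ?thesis unfolding L by simp
  qed
  have plain: "(\<forall>r\<in>{1..cp i}. v (int r) \<preceq> u (int r)) \<and> (\<exists>rs. increasing_below j rs \<and>
      agree_except j (bar_swaps (window (cp i) u) j rs) (window (cp i) v) \<and>
      v (int j) \<preceq> entry (bar_swaps (window (cp i) u) j rs) j)"
    if L: "cols ! p = Plain i j" for i j
  proof -
    have j: "1 \<le> j" "j \<le> cp i" "cp i \<le> n" using Lin set_columns(1)[of i j] cp_le_n cp_1 n2
      unfolding L by auto
    from d obtain x where x: "desc n (Gamma_primed j) u x" "desc n (tail_roots n j (cp i)) x v"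
      unfolding L by (auto simp: Gamma_plain_eq desc_append)
    from desc_Gamma_primed[OF u j x(1)] obtain rs where rs: "x \<in> signed_perms n"
      "\<forall>r\<in>{1..n}. x (int r) \<preceq> u (int r)" "increasing_below j rs" "window (cp i) x =
        bar_swaps (window (cp i) u) j rs"
      by blast
    from desc_tail_roots[OF j rs(1) order_refl x(2)]
    have v: "v \<in> signed_perms n" "\<forall>r\<in>{1..cp i} - {j}. v (int r) = x (int r)" "v (int j) \<preceq> x (int j)"
      by auto
    have "v (int r) \<preceq> u (int r)" if "r \<in> {1..cp i}" for r
    proof -
      have "x (int r) \<preceq> u (int r)" using rs(2) that j by auto
      moreover have "v (int r) \<preceq> x (int r)" using v(2,3) that by (cases "r = j") auto
      ultimately show ?thesis using letter_le_trans by blast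
    qed
    moreover have "agree_except j (bar_swaps (window (cp i) u) j rs) (window (cp i) v)"
      unfolding rs(4)[symmetric] agree_except_def
    proof (intro conjI ballI)
      fix r assume r: "r \<in> {1..length (window (cp i) x)} - {j}"
      then have r': "r \<in> {1..cp i} - {j}" "r \<in> {1..n}" "j \<in> {1..n}" using j by auto
      have vx: "v (int r) = x (int r)" using v(2) r' by blast
      then show "entry (window (cp i) v) r = entry (window (cp i) x) r" using r' by simp
      have "v (int j) \<noteq> v (int r)" "v (int j) \<noteq> - v (int r)"
        using signed_perms_inj_pos[OF v(1) r'(3,2)] r' by auto
      then show "entry (window (cp i) v) j \<noteq> entry (window (cp i) x) r"
        "entry (window (cp i) v) j \<noteq> - entry (window (cp i) x) r"
        using vx r' j by auto
    qed simp
    moreover have "v (int j) \<preceq> entry (bar_swaps (window (cp i) u) j rs) j"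
      unfolding rs(4)[symmetric] using v(3) j by simp
    ultimately show ?thesis using rs(3) by blast
  qed
  show "\<forall>r\<in>{1..ht (cols ! p)}. v (int r) \<preceq> u (int r)"
  proof (cases "cols ! p")
    case (Plain i j)
    then show ?thesis using plain[OF Plain] by simp
  next
    case (Primed i k)
    then show ?thesis using primed[OF Primed] cp_le_n[of i] by simp
  qed
  show "cols ! p = Primed i k \<Longrightarrow>
      \<exists>rs. increasing_below k rs \<and> window (cp i) v = bar_swaps (window (cp i) u) k rs"
    using primed by blast
  show "cols ! p = Plain i j \<Longrightarrow> \<exists>rs. increasing_below j rs \<and>
      agree_except j (bar_swaps (window (cp i) u) j rs) (window (cp i) v) \<and>
      v (int j) \<preceq> entry (bar_swaps (window (cp i) u) j rs) j"
    using plain by blast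
qed

lemma filling_map_nth:
  assumes "J \<subseteq> {1..m}" "p < length cols"
  shows "filling_map n lam (w, J) (cols ! p) = window (ht (cols ! p)) (st w J (off p))"
proof -
  have "roots_before n lam (cols ! p) = off p"
    using roots_before_nth[of p] nth_labels[OF assms(2)] assms(2) by (simp add: labels_eq)
  then show ?thesis unfolding filling_map_def using assms(2) by (simp add: mult_T_eq_st[OF assms(1)])
qed

lemma filling_map_in_fillings:
  assumes "(w, J) \<in> admissible n lam"
  shows "filling_map n lam (w, J) \<in> fillings n lam"
proof -
  have w: "w \<in> signed_perms n" and J: "J \<subseteq> {1..m}" and adm: "adm w J m"
    using assms by (auto simp: admissible_iff)
  let ?\<sigma> = "filling_map n lam (w, J)"
  have nth: "?\<sigma> (cols ! p) = window (ht (cols ! p)) (st w J (off p))" if "p < length cols" for p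
    by (rule filling_map_nth[OF J that])
  have sp: "st w J (off p) \<in> signed_perms n" if "p < length cols" for p
    using that off_le_m[of p] by (intro st_signed_perms w) (auto simp: labels_eq)
  have col: "\<exists>u\<in>signed_perms n. ?\<sigma> L = window (ht L) u" if "L \<in> set cols" for L
    using that nth sp by (metis in_set_conv_nth)
  have "?\<sigma> L = []" if "L \<notin> set cols" for L using that by (simp add: filling_map_def)
  moreover have "length (?\<sigma> L) = ht L \<and> set (?\<sigma> L) \<subseteq> letters n" if L: "L \<in> set cols" for L
  proof -
    obtain u where u: "u \<in> signed_perms n" "?\<sigma> L = window (ht L) u" using col[OF L] by blast
    have "u (int k) \<in> letters n" if "k \<in> {1..<Suc (ht L)}" for k
      using that height_le_n[of L] by (intro signed_perms_in_letters[OF u(1)]) auto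
    then show ?thesis unfolding u(2) by (auto simp: window_def simp del: upt_Suc)
  qed
  moreover have "entry (?\<sigma> (cols ! q)) r \<preceq> entry (?\<sigma> (cols ! p)) r"
    if "p < q \<and> q < length cols \<and> r \<in> {1..length (?\<sigma> (cols ! p))} \<and> r \<in> {1..length (?\<sigma> (cols ! q))}"
      for p q r
  proof -
    have pq: "p < q" "q < length cols" and r: "r \<in> {1..ht (cols ! p)}" "r \<in> {1..ht (cols ! q)}"
      using that nth[of p] nth[of q] by auto
    \<comment> \<open>Rows of distant columns are compared through all columns between them; heights
      do not decrease to the right, so row \<open>r\<close> exists in each.\<close>
    have "st w J (off s) (int r) \<preceq> st w J (off p) (int r)" if "p \<le> s" "s < length cols" for s
      using that
    proof (induction s rule: dec_induct)
      case (step s)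
      have "r \<in> {1..ht (cols ! s)}" using r(1) height_mono[of p s] step by auto
      then have "st w J (off (Suc s)) (int r) \<preceq> st w J (off s) (int r)"
        using column_step(1)[OF w adm step(4)] by blast
      then show ?case using step letter_le_trans[of "st w J (off (Suc s)) (int r)"] by auto
    qed simp
    from this[of q] show ?thesis using pq r nth[of p] nth[of q] by auto
  qed
  moreover have "entry (?\<sigma> L) r \<noteq> entry (?\<sigma> L) s \<and> entry (?\<sigma> L) r \<noteq> - entry (?\<sigma> L) s"
    if L: "L \<in> set cols" and rs: "r \<in> {1..length (?\<sigma> L)}" "s \<in> {1..length (?\<sigma> L)}" "r \<noteq> s" for L r s
  proof -
    obtain u where u: "u \<in> signed_perms n" "?\<sigma> L = window (ht L) u" using col[OF L] by blast
    have "r \<in> {1..n}" "s \<in> {1..n}" using rs height_le_n[of L] unfolding u(2) by auto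
    from signed_perms_inj_pos[OF u(1) this rs(3)] show ?thesis using rs unfolding u(2) by simp
  qed
  moreover have "\<exists>rs. increasing_below j rs \<and>
        (let D = bar_swaps (?\<sigma> (Plain i j)) j rs;
             E = take (cp i) (?\<sigma> (next_label n lam (Plain i j)))
         in agree_except j D E \<and> entry E j \<preceq> entry D j)"
    if i: "i \<in> {2..lam 1}" and j: "j \<in> {1..cp i}" for i j
  proof -
    have "Plain i j \<in> set cols" using i j set_columns(1) by blast
    then obtain p where p': "Suc p < length cols" and p: "p < length cols" "cols ! p = Plain i j"
      using column_index[of "Plain i j"] i by auto
    let ?u = "st w J (off p)" and ?v = "st w J (off (Suc p))"
    obtain rs where rs: "increasing_below j rs" "agree_except j (bar_swaps (window (cp i) ?u) j rs)
      (window (cp i) ?v)"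
      "?v (int j) \<preceq> entry (bar_swaps (window (cp i) ?u) j rs) j"
      using column_step(3)[OF w adm p' p(2)] by blast
    have D: "?\<sigma> (Plain i j) = window (cp i) ?u" using nth[OF p(1)] p(2) by simp
    have E: "take (cp i) (?\<sigma> (next_label n lam (Plain i j))) = window (cp i) ?v"
    proof -
      have "?\<sigma> (next_label n lam (Plain i j)) = window (ht (cols ! Suc p)) ?v"
        using nth[OF p'] next_column[OF p'] p(2) by simp
      moreover have "cp i \<le> ht (cols ! Suc p)" using height_next[OF p'] p(2) by simp
      ultimately show ?thesis
        by (intro list_eq_entryI) (auto simp: entry_take)
    qed
    show ?thesis unfolding Let_def D E using rs j by auto
  qed
  moreover have "\<exists>rs. increasing_below k rs \<and>
        ?\<sigma> (next_label n lam (Primed i k)) = bar_swaps (?\<sigma> (Primed i k)) k rs"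
    if i: "i \<in> {1..lam 1}" and k: "k \<in> {2..cp i}" for i k
  proof -
    have "Primed i k \<in> set cols" using i k set_columns(2) by blast
    then obtain p where p': "Suc p < length cols" and p: "p < length cols" "cols ! p = Primed i k"
      using column_index[of "Primed i k"] by auto
    have nl: "cols ! Suc p = next_label n lam (Primed i k)" using next_column[OF p'] p(2) by simp
    then have "ht (cols ! Suc p) = cp i" by simp
    then show ?thesis
      using column_step(2)[OF w adm p' p(2)] nth[OF p(1)] nth[OF p'] nl p(2) by simp
  qed
  ultimately show ?thesis unfolding fillings_def mem_Collect_eq
    by (intro conjI allI ballI impI) simp_all
qed

lemma filling_map_image: "filling_map n lam ` admissible n lam = fillings n lam"
proof
  show "filling_map n lam ` admissible n lam \<subseteq> fillings n lam"
    using filling_map_in_fillings by auto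
  text \<open>At \<open>t = 2\<close> the generating function of every fibre is nonzero.\<close>
  show "fillings n lam \<subseteq> filling_map n lam ` admissible n lam"
  proof
    fix \<sigma> assume \<sigma>: "\<sigma> \<in> fillings n lam"
    have "{(w, J)\<in>admissible n lam. filling_map n lam (w, J) = \<sigma>} \<noteq> {}"
    proof
      assume e: "{(w, J)\<in>admissible n lam. filling_map n lam (w, J) = \<sigma>} = {}"
      show False using generating_function[OF \<sigma>, of "2::int"] unfolding e by simp
    qed
    then show "\<sigma> \<in> filling_map n lam ` admissible n lam" by auto
  qed
qed

end

section \<open>The content\<close>

lemma eps_minus: "k \<ge> 1 \<Longrightarrow> eps (- e) k = - eps e k"
  by (auto simp: eps_def)

definition pairing :: "nat \<Rightarrow> (nat \<Rightarrow> real) \<Rightarrow> root \<Rightarrow> real" where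
  "pairing n v b = inner_prod n v (coroot n b)"

lemma sum_eps: "i \<in> {1..n} \<Longrightarrow> (\<Sum>k = 1..n. f k * eps (int i) k) = f i"
proof -
  assume i: "i \<in> {1..n}"
  have "(\<Sum>k = 1..n. f k * eps (int i) k) = (\<Sum>k = 1..n. if k = i then f k else 0)"
    by (intro sum.cong) (auto simp: eps_def)
  then show ?thesis using i by simp
qed

lemma sum_eps_minus: "i \<in> {1..n} \<Longrightarrow> (\<Sum>k = 1..n. f k * eps (- int i) k) = - f i"
proof -
  assume i: "i \<in> {1..n}"
  have "(\<Sum>k = 1..n. f k * eps (- int i) k) = - (\<Sum>k = 1..n. f k * eps (int i) k)"
    unfolding sum_negf[symmetric] by (intro sum.cong) (auto simp: eps_minus)
  then show ?thesis using sum_eps[OF i] by simp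
qed

lemma inner_prod_root:
  assumes "i \<in> {1..n}" "j \<in> {1..n}"
  shows "inner_prod n v (root_vec (int i, int j)) = v i - v j"
    "inner_prod n v (root_vec (int i, - int j)) = v i + v j"
  unfolding inner_prod_def root_vec_def fst_conv snd_conv right_diff_distrib sum_subtractf
    sum_eps[OF assms(1)] sum_eps[OF assms(2)] sum_eps_minus[OF assms(2)] by simp_all

lemma pairing_eq:
  "pairing n v b = 2 * inner_prod n v (root_vec b) / inner_prod n (root_vec b) (root_vec b)"
  by (simp add: pairing_def coroot_def inner_prod_def sum_distrib_left sum_divide_distrib algebra_simps)

lemma pairing_simps:
  assumes "1 \<le> i" "i < j" "j \<le> n"
  shows "pairing n v (int i, int j) = v i - v j" "pairing n v (int i, - int j) = v i + v j"
  using assms unfolding pairing_eq by (simp_all add: inner_prod_root) (simp_all add: root_vec_def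
    eps_def)

lemma pairing_neg:
  assumes "1 \<le> i" "i \<le> n"
  shows "pairing n v (int i, - int i) = v i"
  using assms unfolding pairing_eq by (simp add: inner_prod_root) (simp add: root_vec_def eps_def)

lemma affine_refl_eq: "affine_refl n b l v = (\<lambda>k. v k - (pairing n v b - real l) * root_vec b k)"
  by (simp add: affine_refl_def pairing_def)

lemma vec_act_root:
  assumes "i \<in> {1..n}" "j \<in> {1..n}"
  shows "vec_act n u (root_vec (int i, int j)) k = eps (u (int i)) k - eps (u (int j)) k"
    "vec_act n u (root_vec (int i, - int j)) k = eps (u (int i)) k + eps (u (int j)) k"
proof -
  have "vec_act n u v k = inner_prod n (\<lambda>i. eps (u (int i)) k) v" for v
    by (simp add: vec_act_def inner_prod_def mult.commute)
  then show "vec_act n u (root_vec (int i, int j)) k = eps (u (int i)) k - eps (u (int j)) k"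
    "vec_act n u (root_vec (int i, - int j)) k = eps (u (int i)) k + eps (u (int j)) k"
    by (simp_all add: inner_prod_root[OF assms])
qed

lemma sum_diff_two:
  fixes f g :: "nat \<Rightarrow> real"
  assumes "finite A" "i \<in> A" "j \<in> A" "i \<noteq> j" "\<And>x. x \<in> A \<Longrightarrow> x \<noteq> i \<Longrightarrow> x \<noteq> j \<Longrightarrow> f x = g x"
  shows "(\<Sum>x\<in>A. f x) = (\<Sum>x\<in>A. g x) + (f i - g i) + (f j - g j)"
proof -
  have "(\<Sum>x\<in>A. f x) = f i + (f j + (\<Sum>x\<in>A - {i} - {j}. f x))" for f :: "nat \<Rightarrow> real"
    using assms(1-4) by (simp add: sum.remove[of A i] sum.remove[of "A - {i}" j])
  from this[of f] this[of g] have "(\<Sum>x\<in>A. f x) - (\<Sum>x\<in>A. g x) =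
    f i + f j - g i - g j + ((\<Sum>x\<in>A - {i} - {j}. f x) - (\<Sum>x\<in>A - {i} - {j}. g x))" by simp
  moreover have "(\<Sum>x\<in>A - {i} - {j}. f x) = (\<Sum>x\<in>A - {i} - {j}. g x)"
    using assms(5) by (intro sum.cong) auto
  ultimately show ?thesis by simp
qed

text \<open>This is \<open>u s_b (v) = u (v - <v, b^> b)\<close> with \<open>b^\<close> the coroot,
  in coordinates: right multiplication on windows agrees with the linear reflection.\<close>

lemma vec_act_refl:
  assumes u: "u \<in> signed_perms n" and b: "b \<in> pos_roots n" and k: "1 \<le> k"
  shows "vec_act n (u \<circ> signed_refl b) v k = vec_act n u v k - pairing n v b *
    vec_act n u (root_vec b) k"
  using b
proof (cases rule: pos_roots_cases)
  case (swap i j)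
  have a: "(u \<circ> signed_refl b) (int r) = (if r = i then u (int j) else if r = j then u (int i)
    else u (int r))"
    if "1 \<le> r" for r unfolding swap(1) by (rule refl_swap_apply[OF swap(2,3) that])
  have ij: "i \<in> {1..n}" "j \<in> {1..n}" "i \<noteq> j" using swap by auto
  have "vec_act n (u \<circ> signed_refl b) v k = vec_act n u v k +
    (v i * eps (u (int j)) k - v i * eps (u (int i)) k) + (v j * eps (u (int i)) k - v j *
      eps (u (int j)) k)"
    unfolding vec_act_def
    by (subst sum_diff_two[OF _ ij, where g =
      "\<lambda>i. v i * eps (u (int i)) k"]) (use a swap ij in \<open>auto simp del: comp_apply\<close>)
  then show ?thesis unfolding swap(1) pairing_simps(1)[OF swap(2-4)] vec_act_root(1)[OF ij(1,2)]
    by (simp add: algebra_simps)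
next
  case (bar i j)
  have a: "(u \<circ> signed_refl b) (int r) = (if r = i then - u (int j) else if r = j then - u (int i)
    else u (int r))"
    if "1 \<le> r" for r unfolding bar(1) by (rule refl_bar_apply[OF u bar(2,3) that])
  have ij: "i \<in> {1..n}" "j \<in> {1..n}" "i \<noteq> j" using bar by auto
  have "vec_act n (u \<circ> signed_refl b) v k = vec_act n u v k +
    (- v i * eps (u (int j)) k - v i * eps (u (int i)) k) + (- v j * eps (u (int i)) k - v j *
      eps (u (int j)) k)"
    unfolding vec_act_def
    by (subst sum_diff_two[OF _ ij, where g =
      "\<lambda>i. v i * eps (u (int i)) k"]) (use a bar ij k in \<open>auto simp: eps_minus simp del: comp_apply\<close>)
  then show ?thesis unfolding bar(1) pairing_simps(2)[OF bar(2-4)] vec_act_root(2)[OF ij(1,2)]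
    by (simp add: algebra_simps)
next
  case (neg i)
  have a: "(u \<circ> signed_refl b) (int r) = (if r = i then - u (int i) else u (int r))"
    if "1 \<le> r" for r unfolding neg(1) by (rule refl_neg_apply[OF u neg(2) that])
  have i: "i \<in> {1..n}" using neg by auto
  have "vec_act n (u \<circ> signed_refl b) v k = vec_act n u v k - 2 * (v i * eps (u (int i)) k)"
    unfolding vec_act_def sum.remove[OF finite_atLeastAtMost i]
    using a[of i] a i k by (simp add: eps_minus del: comp_apply)
  then show ?thesis unfolding neg(1) pairing_neg[OF neg(2,3)] vec_act_root(2)[OF i i]
    by (simp add: algebra_simps)
qed

text \<open>An affine reflection is its linear part followed by translation by \<open>l\<close>
  times the root, so the linear part can be absorbed into the group element.\<close>

lemma vec_act_affine_refl:
  assumes u: "u \<in> signed_perms n" and b: "b \<in> pos_roots n" and k: "1 \<le> k"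
  shows "vec_act n u (affine_refl n b l v) k =
    vec_act n (u \<circ> signed_refl b) v k + real l * vec_act n u (root_vec b) k"
proof -
  have "vec_act n u (affine_refl n b l v) k =
    vec_act n u v k - (pairing n v b - real l) * vec_act n u (root_vec b) k"
    unfolding vec_act_def affine_refl_eq
    by (simp add: algebra_simps sum.distrib sum_subtractf sum_distrib_left)
  then show ?thesis unfolding vec_act_refl[OF assms] by (simp add: algebra_simps)
qed

text \<open>The fundamental weight \<epsilon>_1 + ... + \<epsilon>_h. A column of height
  \<open>h\<close> records the images of its summands, so its entries sum to the image of this
  weight.\<close>

definition omega :: "nat \<Rightarrow> nat \<Rightarrow> real" where
  "omega h i = (if i \<in> {1..h} then 1 else 0)"

lemma vec_act_omega: "h \<le> n \<Longrightarrow> (\<Sum>e\<leftarrow>window h u. eps e k) = vec_act n u (omega h) k"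
proof -
  assume h: "h \<le> n"
  have "(\<Sum>e\<leftarrow>window h u. eps e k) = (\<Sum>i\<in>{1..<Suc h}. eps (u (int i)) k)"
    unfolding window_def map_map o_def by (simp add: interv_sum_list_conv_sum_set_nat del: upt_Suc)
  also have "\<dots> = (\<Sum>i = 1..n. omega h i * eps (u (int i)) k)"
    using h by (intro sum.mono_neutral_cong_left) (auto simp: omega_def)
  finally show ?thesis by (simp add: vec_act_def)
qed

section \<open>Multiplicities of roots in a block of the chain\<close>

lemma distinct_concat_map:
  "distinct xs \<Longrightarrow> (\<And>x. x \<in> set xs \<Longrightarrow> distinct (f x)) \<Longrightarrow>
    (\<And>x y. x \<in> set xs \<Longrightarrow> y \<in> set xs \<Longrightarrow> x \<noteq> y \<Longrightarrow> set (f x) \<inter> set (f y) = {}) \<Longrightarrow>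
    distinct (concat (map f xs))"
proof (induction xs)
  case (Cons x xs)
  have "set (f x) \<inter> set (f y) = {}" if "y \<in> set xs" for y
    using Cons.prems(1) Cons.prems(3)[of x y] that by auto
  then show ?case using Cons by auto
qed simp

lemma count_list_distinct: "distinct xs \<Longrightarrow> count_list xs x = of_bool (x \<in> set xs)"
  by (induction xs) auto

lemma count_list_take_distinct:
  assumes "distinct xs" "z < length xs"
  shows "count_list (take (Suc z) xs) (xs ! z) = 1"
proof -
  have "xs ! z \<in> set (take (Suc z) xs)" using assms(2) by (simp add: take_Suc_conv_app_nth)
  then show ?thesis using assms(1) by (simp add: count_list_distinct)
qed

definition primed_roots :: "nat \<Rightarrow> root list" where
  "primed_roots h = concat (map Gamma_primed [2..<Suc h])"

definition plain_roots :: "nat \<Rightarrow> nat \<Rightarrow> root list" where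
  "plain_roots n h = concat (map (\<lambda>j. Gamma_plain n j h) [1..<Suc h])"

lemma set_Gamma_primed: "set (Gamma_primed j) = {(int r, - int j) | r. 1 \<le> r \<and> r < j}"
  by (auto simp: Gamma_primed_def)

lemma set_Gamma_plain: "set (Gamma_plain n j h) =
  {(int r, - int j) | r. 1 \<le> r \<and> r < j} \<union> {(int j, - int x) | x. h < x \<and> x \<le> n} \<union> {(int j, - int j)} \<union>
  {(int j, int x) | x. h < x \<and> x \<le> n}"
  unfolding Gamma_plain_def set_append set_map set_rev set_upt by auto

lemma distinct_primed_roots: "distinct (primed_roots h)"
  unfolding primed_roots_def
proof (rule distinct_concat_map)
  show "distinct (Gamma_primed x)" for x
    by (auto simp: Gamma_primed_def distinct_map inj_on_def)
qed (auto simp: set_Gamma_primed)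

lemma distinct_plain_roots: "distinct (plain_roots n h)"
  unfolding plain_roots_def
proof (rule distinct_concat_map)
  show "distinct (Gamma_plain n x h)" if "x \<in> set [1..<Suc h]" for x
  proof -
    have "1 \<le> x" "x \<le> h" using that by auto
    then show ?thesis unfolding Gamma_plain_def
      by (auto simp: distinct_map inj_on_def simp del: upt_Suc)
  qed
  show "set (Gamma_plain n x h) \<inter> set (Gamma_plain n y h) = {}"
    if "x \<in> set [1..<Suc h]" "y \<in> set [1..<Suc h]" "x \<noteq> y" for x y
  proof -
    have "x \<le> h" "y \<le> h" using that(1,2) by auto
    then show ?thesis using that(3) unfolding set_Gamma_plain by auto
  qed
qed simp

text \<open>The pairing of a positive root with the fundamental weight is 0, 1 or 2. It is 2 exactly
  for \<open>(i, -j)\<close> with \<open>i < j \<le> h\<close>, which occurs once in each half of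
  the block; roots with pairing 1 occur only in the plain half.\<close>

lemma count_roots:
  assumes b: "b \<in> pos_roots n" and h: "1 \<le> h" "h \<le> n"
  shows "real (count_list (primed_roots h) b) + real (count_list (plain_roots n h) b) =
    pairing n (omega h) b"
    and "b \<in> set (primed_roots h) \<Longrightarrow> pairing n (omega h) b = 2"
    and "b \<in> set (plain_roots n h) \<Longrightarrow>
      real (count_list (primed_roots h) b) + 1 = pairing n (omega h) b"
proof -
  have P: "b \<in> set (primed_roots h) \<longleftrightarrow> (\<exists>j\<in>{2..h}. b \<in> set (Gamma_primed j))"
    unfolding primed_roots_def by (auto simp del: upt_Suc simp: less_Suc_eq_le)
  have Q: "b \<in> set (plain_roots n h) \<longleftrightarrow> (\<exists>j\<in>{1..h}. b \<in> set (Gamma_plain n j h))"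
    unfolding plain_roots_def by (auto simp del: upt_Suc simp: less_Suc_eq_le)
  have "pairing n (omega h) b = of_bool (b \<in> set (primed_roots h)) + of_bool (b \<in> set (plain_roots n
    h)) \<and>
    (b \<in> set (primed_roots h) \<longrightarrow> b \<in> set (plain_roots n h))"
    using b
  proof (cases rule: pos_roots_cases)
    case (swap i j)
    have "b \<notin> set (primed_roots h)" using P unfolding swap(1) set_Gamma_primed by auto
    moreover have "b \<in> set (plain_roots n h) \<longleftrightarrow> i \<le> h \<and> h < j"
      using Q swap(2-4) unfolding swap(1) set_Gamma_plain by auto
    moreover have "pairing n (omega h) b = of_bool (i \<le> h \<and> h < j)"
      unfolding swap(1) pairing_simps(1)[OF swap(2-4)] omega_def using swap(2-4) by auto
    ultimately show ?thesis by simp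
  next
    case (bar i j)
    have "b \<in> set (primed_roots h) \<longleftrightarrow> j \<le> h" using P bar(2-4) unfolding bar(1) set_Gamma_primed by auto
    moreover have "b \<in> set (plain_roots n h) \<longleftrightarrow> i \<le> h"
      using Q bar(2-4) unfolding bar(1) set_Gamma_plain by (cases "j \<le> h") auto
    moreover have "pairing n (omega h) b = of_bool (j \<le> h) + of_bool (i \<le> h)"
      unfolding bar(1) pairing_simps(2)[OF bar(2-4)] omega_def using bar(2-4) by auto
    ultimately show ?thesis using bar(3) by simp
  next
    case (neg i)
    have "b \<notin> set (primed_roots h)" using P unfolding neg(1) set_Gamma_primed by auto
    moreover have "b \<in> set (plain_roots n h) \<longleftrightarrow> i \<le> h"
      using Q neg(2-3) unfolding neg(1) set_Gamma_plain by auto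
    moreover have "pairing n (omega h) b = of_bool (i \<le> h)"
      unfolding neg(1) pairing_neg[OF neg(2,3)] omega_def using neg(2) by auto
    ultimately show ?thesis by simp
  qed
  then show "real (count_list (primed_roots h) b) + real (count_list (plain_roots n h) b) =
    pairing n (omega h) b"
    "b \<in> set (primed_roots h) \<Longrightarrow> pairing n (omega h) b = 2"
    "b \<in> set (plain_roots n h) \<Longrightarrow> real (count_list (primed_roots h) b) + 1 = pairing n (omega h) b"
    by (auto simp: count_list_distinct[OF distinct_primed_roots] count_list_distinct[OF
      distinct_plain_roots])
qed

context strict_partition
begin

section \<open>Levels of the affine reflections\<close>

definition prefix_labels :: "nat \<Rightarrow> label list" where
  "prefix_labels i = concat (map (block n lam) (rev [Suc i..<Suc (lam 1)]))"

text \<open>The blocks are listed with decreasing index, so this decreases in \<open>i\<close>: it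
  is 0 at \<open>lam 1\<close> and the length of the chain at 0.\<close>

definition block_start :: "nat \<Rightarrow> nat" where
  "block_start i = length (concat (map fac (prefix_labels i)))"

definition plain_start :: "nat \<Rightarrow> nat" where
  "plain_start i = block_start i + length (primed_roots (cp i))"

lemma concat_fac_block: "concat (map fac (block n lam i)) = primed_roots (cp i) @ plain_roots n (cp i)"
  by (simp add: block_def primed_roots_def plain_roots_def o_def del: upt_Suc)

lemma prefix_labels_Suc:
  assumes "i < lam 1"
  shows "prefix_labels i = prefix_labels (Suc i) @ block n lam (Suc i)"
proof -
  have "[Suc i..<Suc (lam 1)] = Suc i # [Suc (Suc i)..<Suc (lam 1)]"
    using assms by (simp add: upt_conv_Cons del: upt_Suc)
  then show ?thesis by (simp add: prefix_labels_def del: upt_Suc)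
qed

lemma prefix_labels_0: "prefix_labels 0 = labels"
  by (simp add: prefix_labels_def chain_labels_def)

lemma block_start_step:
  assumes "i \<in> {1..lam 1}"
  shows "block_start (i - 1) = block_start i + length (primed_roots (cp i)) +
    length (plain_roots n (cp i))"
proof -
  obtain q where q: "i = Suc q" "q < lam 1" using assms by (cases i) auto
  show ?thesis
    using prefix_labels_Suc[OF q(2)] concat_fac_block[of i] unfolding q(1)
      by (simp add: block_start_def)
qed

lemma block_start_mono:
  assumes "i \<le> j" "j \<le> lam 1"
  shows "block_start j \<le> block_start i"
  using assms
proof (induction j rule: dec_induct)
  case (step j)
  then show ?case using block_start_step[of "Suc j"] by simp
qed simp

lemma labels_split:
  assumes "i \<in> {1..lam 1}"
  shows "\<exists>rest. labels = prefix_labels i @ block n lam i @ rest"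
proof -
  have "\<exists>rest. labels = prefix_labels q @ rest" if "q \<le> lam 1" for q
    using that
  proof (induction q)
    case 0
    then show ?case by (simp add: prefix_labels_0)
  next
    case (Suc q)
    then show ?case using prefix_labels_Suc[of q] by auto
  qed
  note pre = this
  obtain q where q: "i = Suc q" "q < lam 1" using assms by (cases i) auto
  show ?thesis using pre[of q] prefix_labels_Suc[OF q(2)] q by auto
qed

lemma chain_block:
  assumes "i \<in> {1..lam 1}"
  shows "\<exists>rest. chain = concat (map fac (prefix_labels i)) @ primed_roots (cp i) @ plain_roots n (cp
    i) @ rest"
proof -
  obtain rest where "labels = prefix_labels i @ block n lam i @ rest" using labels_split[OF assms]
    by blast
  then show ?thesis unfolding lambda_chain_def using concat_fac_block[of i] by simp
qed

lemma roots_before_split: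
  assumes "labels = xs @ L # ys"
  shows "roots_before n lam L = length (concat (map fac xs))"
proof -
  have "L \<notin> set xs" using distinct_labels unfolding assms by simp
  then have "takeWhile (\<lambda>M. M \<noteq> L) labels = xs" unfolding assms by (subst takeWhile_append2) auto
  then show ?thesis by (simp add: roots_before_def)
qed

lemma roots_before_Plain_1:
  assumes "i \<in> {1..lam 1}"
  shows "roots_before n lam (Plain i 1) = plain_start i"
proof -
  obtain rest where "labels = prefix_labels i @ block n lam i @ rest" using labels_split[OF assms]
    by blast
  then have "labels = (prefix_labels i @ map (Primed i) [2..<Suc (cp i)]) @ Plain i 1 # (map (Plain
    i) [2..<Suc (cp i)] @ rest)"
    using block_eq[of i] assms by simp
  from roots_before_split[OF this] show ?thesis
    by (simp add: plain_start_def block_start_def primed_roots_def o_def del: upt_Suc)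
qed

lemma roots_before_block:
  assumes "i \<in> {1..lam 1}"
  shows "roots_before n lam (if cp i = 1 then Plain i 1 else Primed i 2) = block_start i"
proof (cases "cp i = 1")
  case True
  then show ?thesis using roots_before_Plain_1[OF assms] by (simp add: plain_start_def primed_roots_def)
next
  case False
  then have "2 \<le> cp i" using cp_pos[of i] assms by simp
  then have u: "[2..<Suc (cp i)] = 2 # [3..<Suc (cp i)]" by (simp add: upt_conv_Cons del: upt_Suc)
  obtain rest where "labels = prefix_labels i @ block n lam i @ rest" using labels_split[OF assms]
    by blast
  then have "labels = prefix_labels i @ Primed i 2 #
     (map (Primed i) [3..<Suc (cp i)] @ map (Plain i) [1..<Suc (cp i)] @ rest)"
    unfolding block_def u by simp
  from roots_before_split[OF this] False show ?thesis by (simp add: block_start_def)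
qed

lemma count_prefix:
  assumes b: "b \<in> pos_roots n"
  shows "i \<le> lam 1 \<Longrightarrow> real (count_list (concat (map fac (prefix_labels i))) b) =
    (\<Sum>q\<in>{i<..lam 1}. pairing n (omega (cp q)) b)"
proof (induction i rule: inc_induct)
  case base
  then show ?case by (simp add: prefix_labels_def)
next
  case (step i)
  have "{i<..lam 1} = insert (Suc i) {Suc i<..lam 1}" using step.hyps by auto
  then have "(\<Sum>q\<in>{i<..lam 1}. pairing n (omega (cp q)) b) =
    pairing n (omega (cp (Suc i))) b + (\<Sum>q\<in>{Suc i<..lam 1}. pairing n (omega (cp q)) b)" by simp
  moreover have "real (count_list (primed_roots (cp (Suc i))) b) + real (count_list (plain_roots n
    (cp (Suc i))) b) =
    pairing n (omega (cp (Suc i))) b"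
    using count_roots(1)[OF b cp_pos cp_le_n, of "Suc i"] step.hyps by simp
  ultimately show ?case
    using step.IH prefix_labels_Suc[OF step.hyps(2)] concat_fac_block[of "Suc i"] by simp
qed

lemma level_eq_count:
  assumes "k \<le> m"
  shows "level n lam k = count_list (take k chain) (\<beta> k)"
proof -
  have "count_list (take k chain) (\<beta> k) = card {i. i < k \<and> chain ! i = \<beta> k}"
    unfolding count_list_eq_length_filter length_filter_conv_card
    using assms by (intro arg_cong[of _ _ card]) auto
  also have "\<dots> = card (Suc ` {i. i < k \<and> chain ! i = \<beta> k})"
    by (rule card_image[symmetric]) simp
  also have "Suc ` {i. i < k \<and> chain ! i = \<beta> k} = {j \<in> {1..k}. \<beta> j = \<beta> k}"
  proof (intro set_eqI iffI)
    fix j assume j: "j \<in> {j \<in> {1..k}. \<beta> j = \<beta> k}"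
    then have "j = Suc (j - 1)" "j - 1 < k" "chain ! (j - 1) = \<beta> k" by (auto simp: beta_def)
    then show "j \<in> Suc ` {i. i < k \<and> chain ! i = \<beta> k}" by blast
  qed (auto simp: beta_def)
  finally show ?thesis by (simp add: level_def)
qed

text \<open>
  Every occurrence of a root in the chain before position \<open>y + 1\<close> is accounted for by one half
  of its pairing with \<open>\<omega>\<^bsub>\<lambda>'\<^sub>i\<^esub>\<close> for each of the two halves of the blocks that have been started.
\<close>

lemma level_eq_pairing:
  assumes y: "y < m"
  shows "real (level n lam (Suc y)) = 1 / 2 * (\<Sum>i = 1..lam 1.
    (of_bool (block_start i \<le> y) + of_bool (plain_start i \<le> y)) * pairing n (omega (cp i)) (\<beta> (Suc y)))"
proof -
  let ?b = "\<beta> (Suc y)"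
  let ?c = "\<lambda>i. pairing n (omega (cp i)) ?b"
  have b: "?b \<in> pos_roots n" using y by (intro beta_pos_roots) auto
  \<comment> \<open>The block that contains position \<open>y + 1\<close>: starts decrease with the
    index, so the block begun last has the least index.\<close>
  define i where "i = (LEAST q. block_start q \<le> y)"
  have "block_start (lam 1) = 0" by (simp add: block_start_def prefix_labels_def)
  then have ex: "block_start (lam 1) \<le> y" by simp
  have i1: "block_start i \<le> y" unfolding i_def by (rule LeastI[of "\<lambda>q. block_start q \<le> y", OF ex])
  have i2: "i \<le> lam 1" unfolding i_def by (rule Least_le[of "\<lambda>q. block_start q \<le> y", OF ex])
  have "block_start 0 = m" by (simp add: block_start_def prefix_labels_0 lambda_chain_def)
  then have i3: "i \<noteq> 0" using i1 y by (metis not_le)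
  then have iin: "i \<in> {1..lam 1}" using i2 by simp
  have i4: "y < block_start (i - 1)"
  proof (rule ccontr)
    assume "\<not> y < block_start (i - 1)"
    then have "i \<le> i - 1" unfolding i_def by (intro Least_le) simp
    then show False using i3 by simp
  qed
  let ?P = "primed_roots (cp i)" and ?Q = "plain_roots n (cp i)" and ?pre =
    "concat (map fac (prefix_labels i))"
  obtain rest where ch: "chain = ?pre @ ?P @ ?Q @ rest" using chain_block[OF iin] by blast
  define z where "z = y - block_start i"
  have yz: "y = length ?pre + z" using i1 by (simp add: z_def block_start_def)
  have zlt: "z < length ?P + length ?Q" using i4 block_start_step[OF iin] i1 by (simp add: z_def)
  have bz: "?b = (?P @ ?Q) ! z" unfolding beta_def ch yz using zlt by (auto simp: nth_append)
  have "take (Suc y) chain = ?pre @ take (Suc z) (?P @ ?Q)"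
    unfolding ch yz using zlt by simp
  then have lev: "real (level n lam (Suc y)) = (\<Sum>q\<in>{i<..lam 1}. ?c q) + real (count_list (take (Suc
    z) (?P @ ?Q)) ?b)"
    using level_eq_count[of "Suc y"] y count_prefix[OF b i2] by simp
  have h: "1 \<le> cp i" "cp i \<le> n" using cp_pos[OF i2] cp_le_n by auto
  \<comment> \<open>In the primed half a root has pairing 2 and this is its first occurrence in the
    block, so the count is half the pairing. In the plain half the earlier primed occurrences plus
    the present one give the full pairing.\<close>
  have here: "real (count_list (take (Suc z) (?P @ ?Q)) ?b) = 1 / 2 * ((1 + of_bool (plain_start i \<le>
    y)) * ?c i)"
  proof (cases "z < length ?P")
    case True
    have bP: "?b = ?P ! z" using bz True by (simp add: nth_append)
    then have "?b \<in> set ?P" using True by simp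
    then have "?c i = 2" using count_roots(2)[OF b h] by simp
    moreover have "\<not> plain_start i \<le> y" using True i1 by (simp add: plain_start_def z_def)
    moreover have "count_list (take (Suc z) (?P @ ?Q)) ?b = 1"
      using count_list_take_distinct[OF distinct_primed_roots True] True unfolding bP by simp
    ultimately show ?thesis by simp
  next
    case False
    define x where "x = z - length ?P"
    have x: "x < length ?Q" "z = length ?P + x" using False zlt by (auto simp: x_def)
    have bQ: "?b = ?Q ! x" using bz x by (simp add: nth_append)
    then have "?b \<in> set ?Q" using x by simp
    then have "real (count_list ?P ?b) + 1 = ?c i" using count_roots(3)[OF b h] by simp
    moreover have "plain_start i \<le> y" using False i1 by (simp add: plain_start_def z_def)
    moreover have "count_list (take (Suc z) (?P @ ?Q)) ?b = count_list ?P ?b + 1"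
      using count_list_take_distinct[OF distinct_plain_roots x(1)] unfolding bQ x(2) by simp
    ultimately show ?thesis by simp
  qed
  have "(\<Sum>q = 1..lam 1. (of_bool (block_start q \<le> y) + of_bool (plain_start q \<le> y)) * ?c q) =
    (1 + of_bool (plain_start i \<le> y)) * ?c i + (\<Sum>q\<in>{i<..lam 1}. 2 * ?c q)"
  proof -
    \<comment> \<open>Blocks with larger index are complete and count in full; those with smaller
      index have not begun and contribute nothing.\<close>
    have late: "block_start q \<le> y \<and> plain_start q \<le> y" if "q \<in> {i<..lam 1}" for q
    proof -
      have "plain_start q \<le> block_start (q - 1)"
        using block_start_step[of q] that iin by (simp add: plain_start_def)
      moreover have "block_start (q - 1) \<le> block_start i" using that by (intro block_start_mono) auto
      moreover have "block_start q \<le> plain_start q" by (simp add: plain_start_def)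
      ultimately show ?thesis using i1 by simp
    qed
    have early: "\<not> block_start q \<le> y \<and> \<not> plain_start q \<le> y" if "q \<in> {1..<i}" for q
    proof -
      have "block_start (i - 1) \<le> block_start q" using that i2 by (intro block_start_mono) auto
      then show ?thesis using i4 by (simp add: plain_start_def)
    qed
    have split: "{1..lam 1} = {1..<i} \<union> insert i {i<..lam 1}" using iin by auto
    have "(\<Sum>q\<in>{1..<i}. (of_bool (block_start q \<le> y) + of_bool (plain_start q \<le> y)) * ?c q) = 0"
      using early by (intro sum.neutral) simp
    moreover have "(\<Sum>q\<in>{i<..lam 1}. (of_bool (block_start q \<le> y) + of_bool (plain_start q \<le> y)) *
      ?c q) =
      (\<Sum>q\<in>{i<..lam 1}. 2 * ?c q)" using late by (intro sum.cong) simp_all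
    ultimately show ?thesis unfolding split using i1
      by (subst sum.union_disjoint) auto
  qed
  then show ?thesis unfolding lev here by (simp add: sum_distrib_left[symmetric] algebra_simps)
qed

section \<open>Expansion of the content and of the weight\<close>

text \<open>Each used reflection after position \<open>x\<close> is undone in turn, contributing its
  pairing times the image of its root; the contributions telescope to the end of the chain.\<close>

lemma vec_act_st:
  assumes w: "w \<in> signed_perms n" and k: "1 \<le> k" and x: "x \<le> m"
  shows "vec_act n (st w J x) v k = vec_act n (st w J m) v k +
    (\<Sum>y<m. of_bool (x \<le> y \<and> Suc y \<in> J) * (pairing n v (\<beta> (Suc y)) * vec_act n (st w J y) (root_vec
      (\<beta> (Suc y))) k))"
proof -
  let ?f = "\<lambda>y. of_bool (Suc y \<in> J) * (pairing n v (\<beta> (Suc y)) * vec_act n (st w J y) (root_vec (\<beta>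
    (Suc y))) k)"
  have "vec_act n (st w J x) v k = vec_act n (st w J m) v k + (\<Sum>y\<in>{x..<m}. ?f y)"
    using x
  proof (induction x rule: inc_induct)
    case (step x)
    have sp: "st w J x \<in> signed_perms n" using step.hyps by (intro st_signed_perms w) simp
    have b: "\<beta> (Suc x) \<in> pos_roots n" using step.hyps by (intro beta_pos_roots) auto
    have "vec_act n (st w J x) v k = vec_act n (st w J (Suc x)) v k + ?f x"
      unfolding st_Suc using vec_act_refl[OF sp b k, of v] by simp
    then show ?case
      unfolding sum.atLeast_Suc_lessThan[OF step.hyps(2), of ?f] step.IH by (simp only: add_ac)
  qed simp
  also have "(\<Sum>y\<in>{x..<m}. ?f y) =
    (\<Sum>y<m. of_bool (x \<le> y \<and> Suc y \<in> J) * (pairing n v (\<beta> (Suc y)) * vec_act n (st w J y) (root_vec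
      (\<beta> (Suc y))) k))"
    by (intro sum.mono_neutral_cong_left) auto
  finally show ?thesis .
qed

text \<open>The affine reflections are absorbed one by one into the group element, and each leaves
  behind its level times the image of its root. The images are the same as in
  \<open>vec_act_st\<close>, which is what makes the two expansions comparable.\<close>

lemma vec_act_mu:
  assumes w: "w \<in> signed_perms n" and J: "J \<subseteq> {1..m}" and k: "1 \<le> k"
  shows "vec_act n w (mu n lam J) k =
    vec_act n (st w J m) (\<lambda>i. if i \<in> {1..n} then real (lam i) else 0) k +
    (\<Sum>y<m. of_bool (Suc y \<in> J) * (real (level n lam (Suc y)) * vec_act n (st w J y) (root_vec (\<beta>
      (Suc y))) k))"
proof -
  let ?l = "\<lambda>i. if i \<in> {1..n} then real (lam i) else 0"
  let ?g = "\<lambda>k. affine_refl n (\<beta> k) (level n lam k)"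
  let ?f = "\<lambda>y. of_bool (Suc y \<in> J) * (real (level n lam (Suc y)) * vec_act n (st w J y) (root_vec
    (\<beta> (Suc y))) k)"
  have "vec_act n (st w J x) (foldr ?g (filter (\<lambda>k. k \<in> J) [Suc x..<Suc m]) ?l) k =
    vec_act n (st w J m) ?l k + (\<Sum>y\<in>{x..<m}. ?f y)" if "x \<le> m" for x
    using that
  proof (induction x rule: inc_induct)
    case (step x)
    have sp: "st w J x \<in> signed_perms n" using step.hyps by (intro st_signed_perms w) simp
    have b: "\<beta> (Suc x) \<in> pos_roots n" using step.hyps by (intro beta_pos_roots) auto
    let ?M = "foldr ?g (filter (\<lambda>k. k \<in> J) [Suc (Suc x)..<Suc m]) ?l"
    have upt: "[Suc x..<Suc m] = Suc x # [Suc (Suc x)..<Suc m]"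
      using step.hyps by (simp add: upt_conv_Cons del: upt_Suc)
    have "vec_act n (st w J x) (foldr ?g (filter (\<lambda>k. k \<in> J) [Suc x..<Suc m]) ?l) k =
      vec_act n (st w J (Suc x)) ?M k + ?f x"
    proof (cases "Suc x \<in> J")
      case True
      have "vec_act n (st w J x) (?g (Suc x) ?M) k =
        vec_act n (st w J (Suc x)) ?M k + real (level n lam (Suc x)) *
          vec_act n (st w J x) (root_vec (\<beta> (Suc x))) k"
        unfolding st_Suc if_P[OF True] by (rule vec_act_affine_refl[OF sp b k])
      then show ?thesis unfolding upt filter.simps if_P[OF True] using True by (simp del: upt_Suc)
    next
      case False
      then show ?thesis unfolding upt filter.simps if_not_P[OF False] st_Suc by (simp del: upt_Suc)
    qed
    then show ?case
      unfolding sum.atLeast_Suc_lessThan[OF step.hyps(2), of ?f] step.IH by (simp only: add_ac)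
  qed simp
  from this[of 0] have "vec_act n w (foldr ?g (filter (\<lambda>k. k \<in> J) [1..<Suc m]) ?l) k =
    vec_act n (st w J m) ?l k + (\<Sum>y<m. ?f y)"
    by (simp add: lessThan_atLeast0 del: upt_Suc)
  moreover have "sorted_list_of_set J = filter (\<lambda>k. k \<in> J) [1..<Suc m]"
  proof -
    have "{k \<in> J. k \<le> m} = J" using J by auto
    then show ?thesis using sorted_list_below[OF J, of m] by simp
  qed
  ultimately show ?thesis by (simp only: mu_def)
qed

text \<open>The partition is the sum of the fundamental weights of its columns: row \<open>q\<close>
  meets column \<open>i\<close> exactly when \<open>i \<le> lam q\<close>.\<close>

lemma vec_act_lam:
  "vec_act n u (\<lambda>i. if i \<in> {1..n} then real (lam i) else 0) k = (\<Sum>i = 1..lam 1. vec_act n u (omega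
    (cp i)) k)"
proof -
  have "(if q \<in> {1..n} then real (lam q) else 0) = (\<Sum>i = 1..lam 1. omega (cp i) q)" if q:
    "q \<in> {1..n}" for q
  proof -
    have "lam q \<le> lam 1" using q by (intro lam_antimono) auto
    have "(\<Sum>i = 1..lam 1. omega (cp i) q) = (\<Sum>i\<in>{1..lam q}. 1)"
    proof (rule sum.mono_neutral_cong_right)
      show "{1..lam q} \<subseteq> {1..lam 1}" using \<open>lam q \<le> lam 1\<close> by auto
    qed (use le_lam_iff[OF q] q in \<open>auto simp: omega_def\<close>)
    then show ?thesis using q by simp
  qed
  then have "vec_act n u (\<lambda>i. if i \<in> {1..n} then real (lam i) else 0) k =
    (\<Sum>q = 1..n. \<Sum>i = 1..lam 1. omega (cp i) q * eps (u (int q)) k)"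
    unfolding vec_act_def sum_distrib_right[symmetric] by (intro sum.cong) simp_all
  also have "\<dots> = (\<Sum>i = 1..lam 1. \<Sum>q = 1..n. omega (cp i) q * eps (u (int q)) k)"
    by (rule sum.swap)
  finally show ?thesis by (simp add: vec_act_def)
qed

lemma start_le_m:
  assumes "i \<in> {1..lam 1}"
  shows "block_start i \<le> m" "plain_start i \<le> m"
proof -
  have m: "block_start 0 = m" by (simp add: block_start_def prefix_labels_0 lambda_chain_def)
  show "block_start i \<le> m" using block_start_mono[of 0 i] m assms by simp
  have "plain_start i \<le> block_start (i - 1)" using block_start_step[OF assms]
    by (simp add: plain_start_def)
  also have "\<dots> \<le> block_start 0" using assms by (intro block_start_mono) auto
  also have "\<dots> = m" by (rule m)
  finally show "plain_start i \<le> m" .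
qed

lemma ct_eq:
  assumes J: "J \<subseteq> {1..m}"
  shows "ct n lam (filling_map n lam (w, J)) k = 1 / 2 * (\<Sum>i = 1..lam 1.
    vec_act n (st w J (block_start i)) (omega (cp i)) k + vec_act n (st w J (plain_start i)) (omega
      (cp i)) k)"
proof -
  let ?\<sigma> = "filling_map n lam (w, J)"
  have "(\<Sum>e\<leftarrow>?\<sigma> (if cp i = 1 then Plain i 1 else Primed i 2) @ ?\<sigma> (Plain i 1). eps e k) =
    vec_act n (st w J (block_start i)) (omega (cp i)) k + vec_act n (st w J (plain_start i)) (omega
      (cp i)) k"
    if i: "i \<in> {1..lam 1}" for i
  proof -
    let ?L = "if cp i = 1 then Plain i 1 else Primed i 2"
    have c: "1 \<le> cp i" using cp_pos i by simp
    have P: "Plain i 1 \<in> set cols" unfolding set_columns(1) using i c by auto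
    have "Primed i 2 \<in> set cols" if "cp i \<noteq> 1" unfolding set_columns(2) using i c that by auto
    then have L: "?L \<in> set cols" using P by simp
    have "ht ?L = cp i" by simp
    then have "?\<sigma> ?L = window (cp i) (st w J (block_start i))"
      using L by (simp only: filling_map_def case_prod_conv
        if_True mult_T_eq_st[OF J] roots_before_block[OF i])
    moreover have "?\<sigma> (Plain i 1) = window (cp i) (st w J (plain_start i))"
      using P by (simp only: filling_map_def case_prod_conv
        if_True mult_T_eq_st[OF J] roots_before_Plain_1[OF i] height.simps)
    ultimately show ?thesis
      by (simp only: map_append sum_list_append vec_act_omega[OF cp_le_n])
  qed
  then show ?thesis unfolding ct_def by (intro arg_cong2[of _ _ _ _ "(*)"] sum.cong) simp_all
qed

lemma vec_act_0: "u \<in> signed_perms n \<Longrightarrow> vec_act n u v 0 = 0"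
  unfolding vec_act_def using signed_perms_nonzero[of u n] by (intro sum.neutral) (auto simp: eps_def)

theorem content:
  assumes "(w, J) \<in> admissible n lam"
  shows "ct n lam (filling_map n lam (w, J)) = vec_act n w (mu n lam J)"
proof
  fix k
  have w: "w \<in> signed_perms n" and J: "J \<subseteq> {1..m}" using assms by (auto simp: admissible_iff)
  show "ct n lam (filling_map n lam (w, J)) k = vec_act n w (mu n lam J) k"
  proof (cases "k = 0")
    \<comment> \<open>Vectors are functions on all naturals, but index 0 is not a coordinate; both
      sides vanish there, while the reflection formulas apply to indices from 1 on.\<close>
    case True
    have "vec_act n (st w J (block_start i)) v 0 = 0" "vec_act n (st w J (plain_start i)) v 0 = 0"
      if "i \<in> {1..lam 1}" for i v
      using start_le_m[OF that] by (auto intro!: vec_act_0 st_signed_perms w)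
    then show ?thesis unfolding ct_eq[OF J] True using vec_act_0[OF w] by simp
  next
    case False
    then have k: "1 \<le> k" by simp
    let ?R = "\<lambda>y. vec_act n (st w J y) (root_vec (\<beta> (Suc y))) k"
    let ?p = "\<lambda>i y. pairing n (omega (cp i)) (\<beta> (Suc y))"
    let ?v = "\<lambda>i. vec_act n (st w J m) (omega (cp i)) k"
    let ?c = "\<lambda>i y. of_bool (block_start i \<le> y) + of_bool (plain_start i \<le> y) :: real"
    have "ct n lam (filling_map n lam (w, J)) k =
      1 / 2 * (\<Sum>i = 1..lam 1. 2 * ?v i + (\<Sum>y<m. of_bool (Suc y \<in> J) * (?c i y * ?p i y * ?R y)))"
      unfolding ct_eq[OF J]
    proof (intro arg_cong2[of _ _ _ _ "(*)"] sum.cong refl)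
      fix i assume i: "i \<in> {1..lam 1}"
      show "vec_act n (st w J (block_start i)) (omega (cp i)) k + vec_act n (st w J (plain_start i))
        (omega (cp i)) k =
        2 * ?v i + (\<Sum>y<m. of_bool (Suc y \<in> J) * (?c i y * ?p i y * ?R y))"
        unfolding vec_act_st[OF w k start_le_m(1)[OF i]] vec_act_st[OF w k start_le_m(2)[OF i]]
        by (simp add: algebra_simps sum.distrib of_bool_conj)
    qed
    also have "\<dots> = (\<Sum>i = 1..lam 1. ?v i) +
      1 / 2 * (\<Sum>i = 1..lam 1. \<Sum>y<m. of_bool (Suc y \<in> J) * (?c i y * ?p i y * ?R y))"
      by (simp add: sum.distrib sum_distrib_left[symmetric] algebra_simps)
    also have "(\<Sum>i = 1..lam 1. \<Sum>y<m. of_bool (Suc y \<in> J) * (?c i y * ?p i y * ?R y)) =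
      (\<Sum>y<m. \<Sum>i = 1..lam 1. of_bool (Suc y \<in> J) * (?c i y * ?p i y * ?R y))"
      by (rule sum.swap)
    \<comment> \<open>After the exchange of sums, the coefficient of each used root is half the sum
      of pairings over the started halves of blocks, which is its level.\<close>
    also have "1 / 2 * \<dots> = (\<Sum>y<m. of_bool (Suc y \<in> J) * (real (level n lam (Suc y)) * ?R y))"
    proof (subst sum_distrib_left, rule sum.cong[OF refl])
      fix y assume "y \<in> {..<m}"
      then have "y < m" by simp
      show "1 / 2 * (\<Sum>i = 1..lam 1. of_bool (Suc y \<in> J) * (?c i y * ?p i y * ?R y)) =
        of_bool (Suc y \<in> J) * (real (level n lam (Suc y)) * ?R y)"
        unfolding level_eq_pairing[OF \<open>y < m\<close>]
        by (simp only: sum_distrib_left sum_distrib_right mult_ac)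
    qed
    finally show ?thesis unfolding vec_act_mu[OF w J k] vec_act_lam .
  qed
qed

end

theorem theorem4p6:
  fixes n :: nat and lam :: "nat \<Rightarrow> nat" and t :: "'a :: comm_ring_1"
  assumes "2 \<le> n"
    and "\<forall>i\<in>{1..<n}. lam (i + 1) < lam i"
    and "0 < lam n"
  shows "filling_map n lam ` admissible n lam = fillings n lam \<and>
    (\<forall>\<sigma>\<in>fillings n lam. \<forall>(w, J)\<in>admissible n lam. filling_map n lam (w, J) = \<sigma> \<longrightarrow>
       ct n lam (filling_map n lam (w, J)) = vec_act n w (mu n lam J)) \<and>
    (\<forall>\<sigma>\<in>fillings n lam.
       (\<Sum>(w, J)\<in>{(w, J)\<in>admissible n lam. filling_map n lam (w, J) = \<sigma>}.
          t ^ half_exponent n lam w J * (1 - t) ^ card J) =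
       t ^ N_filling n lam \<sigma> * (1 - t) ^ des_filling n lam \<sigma>)"
proof -
  interpret strict_partition n lam
    using assms by unfold_locales
  show ?thesis
    using filling_map_image content generating_function[of _ t] by blast
qed

end
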